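(* Let $k>0$, $a>0$. Let $f_I\in L^\infty(\mathbb{R})\cap L^1(\mathbb{R})$ with $xf_I\in L^1(\mathbb{R})$, $f_I\ge 0$ on $(-\infty,0)$, $f_I(0)=0$, $f_I\le 0$ on $(0,\infty)$, and with $M^l:=\int_{\mathbb{R}} f_I^+\,dx>0$, $M^r:=\int_{\mathbb{R}} f_I^-\,dx>0$. Define $F_I(x)=\sum_{n=0}^\infty f_I^+(x+na)$ for $x<0$ and $F_I(x)=-\sum_{n=0}^\infty f_I^-(x-na)$ for $x>0$, and assume $F_I\in W^{1,\infty}(\mathbb{R})$. Let $b_l,b_r\in C^{0,1}[0,\infty)$ with $b_l(0)=b_r(0)=0$ be such that: (i) $b:=\frac12(b_l-b_r)\in W^{1,\infty}(0,\infty)\cap W^{1,1}(0,\infty)$; (ii) the limits $\lim_{t\to\infty}b_l(t)=b_l^\infty$ and $\lim_{t\to\infty}b_r(t)=b_r^\infty$ exist; (iii) $|b_l(t)-b_l^\infty|+|b_r(t)-b_r^\infty|=\mathcal{O}(t^{-w})$ for all $t>0$, with some $w>1$. Let $p=p(t)$ be the free boundary defined in the context. Then, as $t\to\infty$, $$p(t)=\Bigl(\beta_1+\mathcal{O}\bigl(\tfrac{1}{\sqrt t}\bigr)\Bigr)\sqrt t,\qquad \beta_1=\sqrt{4k}\,\operatorname{erf}^{-1}\!\Bigl(\frac{\alpha^l-\alpha^r}{\alpha^l+\alpha^r}\Bigr),$$ where $\alpha^l=\frac{1}{a}e^{b_l^\infty}M^l$ and $\alpha^r=\frac1a e^{b_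r^\infty}M^r$.
   Context: For a real-valued function $g$, $g^+=\max(g,0)$ and $g^-=-\min(g,0)$. The error function is $\operatorname{erf}(z)=\frac{2}{\sqrt\pi}\int_0^z e^{-r^2}\,dr$. $C^{0,1}[0,\infty)$ denotes Lipschitz continuous functions on $[0,\infty)$, and dots denote (a.e.) time derivatives. Free boundary: $F=F(x,t)$ is the unique global solution of $$F_t=kF_{xx}+\dot b_l(t)F^+-\dot b_r(t)F^-\ \text{ in }\mathbb{R}\times(0,\infty),\qquad F(\cdot,0)=F_I\ \text{ in }\mathbb{R},$$ and $p(t)$ is the unique zero of $F(\cdot,t)$, i.e. $F(p(t),t)=0$, with $p(0)=0$; $F(\cdot,t)$ is positive to the left of $p(t)$ and negative to the right. *)

theory Defs
  imports "HOL-Analysis.Analysis" "HOL-Library.Landau_Symbols"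
begin

definition pos_part :: "real \<Rightarrow> real" where
  "pos_part y = max y 0"

definition neg_part :: "real \<Rightarrow> real" where
  "neg_part y = - min y 0"

text \<open>The interval integral is oriented, so this is also correct for negative arguments.
  The function is injective with range the open interval from -1 to 1; its inverse is
  written \<^term>\<open>inv erf\<close>.\<close>

definition erf :: "real \<Rightarrow> real" where
  "erf z = 2 / sqrt pi * (LBINT r=ereal 0..ereal z. exp (- r\<^sup>2))"

subsection \<open>Lebesgue and Sobolev spaces on open subsets of the line\<close>

text \<open>Members are functions rather than classes; membership is invariant under changes on
  null sets.\<close>

definition L1 :: "real set \<Rightarrow> (real \<Rightarrow> real) \<Rightarrow> bool" where
  "L1 S f \<longleftrightarrow> integrable (lebesgue_on S) f"

definition Linf :: "real set \<Rightarrow> (real \<Rightarrow> real) \<Rightarrow> bool" where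
  "Linf S f \<longleftrightarrow> f \<in> borel_measurable (lebesgue_on S) \<and>
     (\<exists>C. AE x in lebesgue_on S. \<bar>f x\<bar> \<le> C)"

definition test_function :: "real set \<Rightarrow> (real \<Rightarrow> real) \<Rightarrow> bool" where
  "test_function S \<phi> \<longleftrightarrow>
     (\<forall>n x. (deriv ^^ n) \<phi> field_differentiable at x) \<and>
     compact (closure {x. \<phi> x \<noteq> 0}) \<and> closure {x. \<phi> x \<noteq> 0} \<subseteq> S"

definition weak_derivative :: "real set \<Rightarrow> (real \<Rightarrow> real) \<Rightarrow> (real \<Rightarrow> real) \<Rightarrow> bool" where
  "weak_derivative S f g \<longleftrightarrow>
     (\<forall>\<phi>. test_function S \<phi> \<longrightarrow>
        (LINT x|lebesgue_on S. f x * deriv \<phi> x) = - (LINT x|lebesgue_on S. g x * \<phi> x))"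

definition W11 :: "real set \<Rightarrow> (real \<Rightarrow> real) \<Rightarrow> bool" where
  "W11 S f \<longleftrightarrow> L1 S f \<and> (\<exists>g. L1 S g \<and> weak_derivative S f g)"

definition W1inf :: "real set \<Rightarrow> (real \<Rightarrow> real) \<Rightarrow> bool" where
  "W1inf S f \<longleftrightarrow> Linf S f \<and> (\<exists>g. Linf S g \<and> weak_derivative S f g)"

definition ae_time_derivative :: "(real \<Rightarrow> real) \<Rightarrow> (real \<Rightarrow> real) \<Rightarrow> bool" where
  "ae_time_derivative h h' \<longleftrightarrow>
     (AE t in lebesgue. t > 0 \<longrightarrow> (h has_real_derivative h' t) (at t))"

subsection \<open>The free boundary problem\<close>

text \<open>The value at \<open>x = 0\<close> plays no role: the function is only used up to null sets.
  If \<open>f\<close> vanishes at 0, is nonnegative to the left of 0 and nonpositive to the right of it,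
  then only finitely many terms of each series are nonzero.\<close>

definition initial_datum :: "real \<Rightarrow> (real \<Rightarrow> real) \<Rightarrow> real \<Rightarrow> real" where
  "initial_datum a f x =
     (if x < 0 then (\<Sum>n. pos_part (f (x + real n * a)))
      else if x > 0 then - (\<Sum>n. neg_part (f (x - real n * a)))
      else 0)"

text \<open>Solutions of \<open>F\<^sub>t = k F\<^sub>x\<^sub>x + bl' F\<^sup>+ - br' F\<^sup>-\<close> on the upper half plane.  The
  coefficients \<open>bl'\<close>, \<open>br'\<close> are only defined for almost every time, so the equation is required
  for every \<open>x\<close> at almost every \<open>t\<close>; local Lipschitz continuity in time makes that
  a.e. derivative determine the function.  Boundedness on strips \<open>0 \<le> t \<le> T\<close> is the growth
  condition needed for uniqueness in the Cauchy problem.  The initial value is prescribed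
  almost everywhere, so the initial trace of \<open>F\<close> is the continuous representative of the datum.\<close>

definition global_solution ::
  "real \<Rightarrow> (real \<Rightarrow> real) \<Rightarrow> (real \<Rightarrow> real) \<Rightarrow> (real \<Rightarrow> real) \<Rightarrow> (real \<Rightarrow> real \<Rightarrow> real) \<Rightarrow> bool" where
  "global_solution k bl' br' FI F \<longleftrightarrow>
     continuous_on (UNIV \<times> {0..}) (\<lambda>(x, t). F x t) \<and>
     (\<forall>T>0. \<exists>C. \<forall>x. \<forall>t\<in>{0..T}. \<bar>F x t\<bar> \<le> C) \<and>
     (AE x in lebesgue. F x 0 = FI x) \<and>
     (\<forall>x. \<forall>s>0. \<forall>T>s. \<exists>L. L-lipschitz_on {s..T} (\<lambda>t. F x t)) \<and>
     (\<exists>Fx Fxx.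
        (\<forall>x. \<forall>t>0. ((\<lambda>y. F y t) has_real_derivative Fx x t) (at x) \<and>
                    ((\<lambda>y. Fx y t) has_real_derivative Fxx x t) (at x)) \<and>
        continuous_on (UNIV \<times> {0<..}) (\<lambda>(x, t). Fxx x t) \<and>
        (\<forall>x. AE t in lebesgue. t > 0 \<longrightarrow>
           ((\<lambda>t. F x t) has_real_derivative
              (k * Fxx x t + bl' t * pos_part (F x t) - br' t * neg_part (F x t))) (at t)))"

text \<open>At \<open>t = 0\<close> the zero need not be unique (the datum may vanish on an interval), whence the
  normalisation \<open>p 0 = 0\<close>.\<close>

definition free_boundary :: "(real \<Rightarrow> real \<Rightarrow> real) \<Rightarrow> (real \<Rightarrow> real) \<Rightarrow> bool" where
  "free_boundary F p \<longleftrightarrow> p 0 = 0 \<and>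
     (\<forall>t>0. F (p t) t = 0 \<and> (\<forall>x<p t. F x t > 0) \<and> (\<forall>x>p t. F x t < 0))"

end

theory Submission
  imports Defs "HOL-Probability.Distributions" "HOL-Real_Asymp.Real_Asymp"
begin

text \<open>The functions \<open>exp (- b\<^sub>l) F\<^sup>+\<close> and \<open>exp (- b\<^sub>r) F\<^sup>-\<close> solve the heat equation on the
  two sides of the free boundary, so their difference \<open>W\<close> solves it up to a source on \<open>x = p(t)\<close>
  of strength proportional to \<open>(exp (- b\<^sub>l) - exp (- b\<^sub>r)) F\<^sub>x(p(t), t)\<close>.  Since \<open>b\<^sub>l - b\<^sub>r\<close> is
  integrable, both limits agree and the first factor is \<open>O(t\<^bsup>-w\<^esup>)\<close>; a barrier argument bounds the
  second one.  Testing with the backward heat kernel centred at \<open>(p(T), T)\<close>, where \<open>W\<close> vanishes, shows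
  that the heat evolution of the initial datum is \<open>O(1 / sqrt T)\<close> at \<open>(p(T), T)\<close>.  The initial datum
  is asymptotically periodic on both sides, and its heat evolution is an error function profile
  up to another \<open>O(1 / sqrt T)\<close>, because a Riemann sum of the heat kernel differs from its
  integral by at most its variation.  Inverting the error function gives the claim.\<close>

section \<open>Lipschitz functions with given derivative almost everywhere\<close>

text \<open>The coefficients \<open>bl'\<close> and \<open>br'\<close> exist only almost everywhere
  in time, and continuity is all that is established about \<open>p\<close>, so no law of motion for
  the boundary enters. Instead, the integrating factors turn the equation on each side into a
  classical one, and averages over fixed intervals are differentiated by dominated convergence: at
  each time only the single point \<open>p s\<close> is exceptional. The slope bound needs a bound
  on \<open>F\<close> that does not grow with time. It comes from the same averages with one phase
  switched off, since \<open>Fx (p t) t \<le> 0\<close> then gives the boundary term a favourable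
  sign. The hypothesis \<open>w > 1\<close> makes the boundary flux integrable over long times and
  also compensates the kernel singularity at the final time, so that every contribution has the
  order \<open>1 / sqrt T\<close> of the averaging error of the datum. Because the two limits agree,
  their common exponential cancels from the quotient that defines \<open>\<beta>1\<close>.\<close>

text \<open>A Lipschitz function maps the exceptional null set to a null set.  If the tilted function
  \<open>g\<close> decreased from \<open>a\<close> to \<open>b\<close>, some intermediate value would thus be taken on only where its
  derivative is positive, which fails at the last point where \<open>g\<close> attains that value.\<close>

lemma lipschitz_AE_deriv_nonneg_imp_le:
  fixes f :: "real \<Rightarrow> real"
  assumes lip: "L-lipschitz_on {a..b} f" and "a \<le> b"
    and deriv: "AE t in lebesgue. a < t \<and> t < b \<longrightarrow> (\<exists>d\<ge>0. (f has_real_derivative d) (at t))"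
  shows "f a \<le> f b"
proof (rule ccontr)
  assume "\<not> f a \<le> f b"
  then have ab: "f b < f a" "a < b" using \<open>a \<le> b\<close> by (auto simp: less_le)
  \<comment> \<open>Half of the average descent, so that the tilted \<open>g\<close> still descends
    from a to b.\<close>
  define e where "e = (f a - f b) / (2 * (b - a))"
  have "e > 0" using ab by (auto simp: e_def)
  define g where "g t = f t + e * (t - a)" for t
  have "b - a \<noteq> 0" using ab by simp
  then have "e * (b - a) = (f a - f b) / 2" by (simp add: e_def divide_simps)
  then have gab: "g b < g a" using ab by (simp add: g_def)
  have glip: "(L + e)-lipschitz_on {a..b} g"
    unfolding g_def using \<open>e > 0\<close>
    by (intro lipschitz_on_add lip lipschitz_on_cmult_real_upper[where C=1 and D=e, simplified]
        lipschitz_on_diff[where D=0 and C=1, simplified] lipschitz_on_id lipschitz_on_constant) auto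
  have gcont: "continuous_on {a..b} g" by (rule lipschitz_on_continuous_on[OF glip])
  obtain N where N: "N \<in> null_sets lebesgue"
    "{t. \<not> (a < t \<and> t < b \<longrightarrow> (\<exists>d\<ge>0. (f has_real_derivative d) (at t)))} \<subseteq> N"
    using deriv by (auto simp: eventually_ae_filter)
  \<comment> \<open>The endpoints join the exceptional set because the derivative is only controlled
    in the interior.\<close>
  define S where "S = insert a (insert b (N \<inter> {a..b}))"
  have "negligible N" using N(1) by (simp add: negligible_iff_null_sets)
  then have "negligible S" unfolding S_def by (auto intro: negligible_Int)
  have Sab: "S \<subseteq> {a..b}" using ab by (auto simp: S_def)
  have "negligible (g ` S)"
  proof (rule negligible_locally_Lipschitz_image[OF _ \<open>negligible S\<close>])
    fix x assume "x \<in> S"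
    then show "\<exists>T B. open T \<and> x \<in> T \<and> (\<forall>y\<in>S \<inter> T. norm (g y - g x) \<le> B * norm (y - x))"
      using Sab by (intro exI[of _ UNIV] exI[of _ "L + e"]) (auto intro!: lipschitz_on_normD[OF glip, unfolded real_norm_def])
  qed simp
  have "\<exists>y\<in>{g b<..<g a}. y \<notin> g ` S"
    using gab \<open>negligible (g ` S)\<close> negligible_interval(2)[of "g b" "g a"] negligible_subset[of "g ` S" "{g b<..<g a}"]
    by (auto simp: subset_eq)
  then obtain y where y: "g b < y" "y < g a" "y \<notin> g ` S" by (meson greaterThanLessThan_iff)
  define Z where "Z = {t\<in>{a..b}. g t \<ge> y}"
  have "compact Z"
  proof -
    have "Z = {a..b} \<inter> g -` {y..}" by (auto simp: Z_def)
    then show ?thesis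
      using continuous_closed_preimage[OF gcont closed_atLeastAtMost closed_atLeast]
      by (metis compact_Icc compact_Int_closed inf.left_idem)
  qed
  moreover have "a \<in> Z" using y ab by (auto simp: Z_def)
  ultimately obtain c where c: "c \<in> Z" "\<And>t. t \<in> Z \<Longrightarrow> t \<le> c"
    using compact_attains_sup[of Z] by auto
  have cab: "a \<le> c" "c \<le> b" "g c \<ge> y" using c(1) by (auto simp: Z_def)
  have "c \<noteq> b" using cab y by auto
  have "g c = y"
  proof (rule ccontr)
    assume "g c \<noteq> y"
    then have "g c > y" using cab by auto
    have "continuous_on {c..b} g" using gcont cab by (auto intro: continuous_on_subset)
    from IVT2'[OF _ _ _ this, of y] obtain t where "c \<le> t" "t \<le> b" "g t = y"
      using \<open>g c > y\<close> y cab by auto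
    then have "t \<in> Z" using cab by (auto simp: Z_def)
    with c(2) \<open>c \<le> t\<close> have "t = c" by force
    then show False using \<open>g t = y\<close> \<open>g c > y\<close> by auto
  qed
  then have "c \<notin> S" using y(3) by auto
  then have "c \<notin> N" "a < c" "c < b" using cab by (auto simp: S_def)
  then obtain d where d: "d \<ge> 0" "(f has_real_derivative d) (at c)" using N(2) by blast
  have "(g has_real_derivative (d + e)) (at c)"
    unfolding g_def by (auto intro!: derivative_eq_intros d(2))
  then obtain h where h: "h > 0" "\<And>u. u > 0 \<Longrightarrow> u < h \<Longrightarrow> g c < g (c + u)"
    using DERIV_pos_inc_right[of g "d + e" c] d \<open>e > 0\<close> by auto
  define u where "u = min (h / 2) (b - c)"
  have u: "u > 0" "u < h" "c + u \<le> b" using h(1) \<open>c < b\<close> by (auto simp: u_def min_def)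
  have "c + u \<in> Z" using h(2)[OF u(1,2)] u \<open>a < c\<close> \<open>g c = y\<close> by (auto simp: Z_def)
  then show False using c(2) u(1) by force
qed

lemma lipschitz_AE_deriv_le_imp_diff_le:
  fixes f :: "real \<Rightarrow> real"
  assumes lip: "L-lipschitz_on {a..b} f" and "a \<le> b"
    and deriv: "AE t in lebesgue. a < t \<and> t < b \<longrightarrow> (\<exists>d\<le>m. (f has_real_derivative d) (at t))"
  shows "f b - f a \<le> m * (b - a)"
proof -
  have "(\<bar>m\<bar> + L)-lipschitz_on {a..b} (\<lambda>t. m * t - f t)"
    by (intro lipschitz_on_diff lip lipschitz_on_cmult_real_upper[where C=1 and D="\<bar>m\<bar>", simplified]
        lipschitz_on_id) auto
  moreover have "AE t in lebesgue. a < t \<and> t < b \<longrightarrow>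
      (\<exists>d\<ge>0. ((\<lambda>t. m * t - f t) has_real_derivative d) (at t))"
    using deriv
  proof eventually_elim
    case (elim t)
    show ?case
    proof
      assume "a < t \<and> t < b"
      then obtain d where "d \<le> m" "(f has_real_derivative d) (at t)" using elim by auto
      then show "\<exists>d\<ge>0. ((\<lambda>t. m * t - f t) has_real_derivative d) (at t)"
        by (intro exI[of _ "m - d"]) (auto intro!: derivative_eq_intros)
    qed
  qed
  ultimately have "m * a - f a \<le> m * b - f b"
    using lipschitz_AE_deriv_nonneg_imp_le[of _ a b "\<lambda>t. m * t - f t"] \<open>a \<le> b\<close> by blast
  then show ?thesis by (simp add: algebra_simps)
qed

text \<open>Near s the almost everywhere derivative lies within e of \<open>D s\<close>, and the
  one-sided growth estimate for \<open>f\<close> and \<open>- f\<close> integrates this without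
  measure theory. It serves to upgrade the equation to a classical one once the rough coefficients
  are gone.\<close>

lemma lipschitz_AE_deriv_continuous_imp_deriv:
  fixes f D :: "real \<Rightarrow> real"
  assumes lip: "L-lipschitz_on {a..b} f" and s: "a < s" "s < b"
    and cont: "continuous_on {a..b} D"
    and deriv: "AE t in lebesgue. a < t \<and> t < b \<longrightarrow> (f has_real_derivative D t) (at t)"
  shows "(f has_real_derivative D s) (at s)"
proof -
  have "isCont D s" using cont s by (auto intro!: continuous_on_interior)
  \<comment> \<open>Stated for two arbitrary points near s, so that difference quotients from the
    left and from the right are both instances.\<close>
  have up: "\<exists>\<eta>>0. \<forall>t u. \<bar>t - s\<bar> < \<eta> \<longrightarrow> \<bar>u - s\<bar> < \<eta> \<longrightarrow> t \<le> u \<longrightarrow>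
      \<bar>f u - f t - D s * (u - t)\<bar> \<le> e * (u - t)" if "e > 0" for e
  proof -
    have "\<exists>d>0. \<forall>t. \<bar>t - s\<bar> < d \<longrightarrow> \<bar>D t - D s\<bar> < e"
      using \<open>isCont D s\<close> that unfolding continuous_at_eps_delta dist_real_def by simp
    then obtain d where d: "d > 0" "\<forall>t. \<bar>t - s\<bar> < d \<longrightarrow> \<bar>D t - D s\<bar> < e" by (elim exE conjE)
    define \<eta> where "\<eta> = min d (min (s - a) (b - s))"
    have "\<bar>f u - f t - D s * (u - t)\<bar> \<le> e * (u - t)"
      if tu: "\<bar>t - s\<bar> < \<eta>" "\<bar>u - s\<bar> < \<eta>" "t \<le> u" for t u
    proof -
      have sub: "{t..u} \<subseteq> {a..b}" using tu s by (auto simp: \<eta>_def)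
      have lip': "L-lipschitz_on {t..u} f" by (rule lipschitz_on_subset[OF lip sub])
      have ae: "AE r in lebesgue. t < r \<and> r < u \<longrightarrow>
          (f has_real_derivative D r) (at r) \<and> \<bar>D r - D s\<bar> < e"
        using deriv
      proof eventually_elim
        case (elim r)
        show ?case using elim sub tu d(2)[rule_format, of r] by (auto simp: \<eta>_def)
      qed
      have "AE r in lebesgue. t < r \<and> r < u \<longrightarrow> (\<exists>d\<le>D s + e. (f has_real_derivative d) (at r))"
        using ae
      proof eventually_elim
        case (elim r)
        then show ?case by (intro impI exI[of _ "D r"]) auto
      qed
      then have 1: "f u - f t \<le> (D s + e) * (u - t)"
        using lipschitz_AE_deriv_le_imp_diff_le[OF lip' tu(3)] by blast
      have "L-lipschitz_on {t..u} (\<lambda>t. - f t)"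
        using lipschitz_on_subset[OF lip sub] by simp
      moreover have "AE r in lebesgue. t < r \<and> r < u \<longrightarrow> (\<exists>d\<le>- D s + e. ((\<lambda>t. - f t) has_real_derivative d) (at r))"
        using ae
      proof eventually_elim
        case (elim r)
        then show ?case by (intro impI exI[of _ "- D r"]) (auto intro!: derivative_eq_intros)
      qed
      ultimately have 2: "- f u - - f t \<le> (- D s + e) * (u - t)"
        by (rule lipschitz_AE_deriv_le_imp_diff_le[OF _ tu(3)])
      show ?thesis using 1 2 by (auto simp: abs_le_iff algebra_simps)
    qed
    moreover have "\<eta> > 0" using d s by (auto simp: \<eta>_def)
    ultimately show ?thesis by blast
  qed
  show ?thesis
    unfolding has_field_derivative_def has_derivative_at_alt
  proof (intro conjI allI impI)
    show "bounded_linear ((*) (D s))" by (rule bounded_linear_mult_right)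
    fix e :: real assume "e > 0"
    obtain \<eta> where \<eta>: "\<eta> > 0" "\<And>t u. \<bar>t - s\<bar> < \<eta> \<Longrightarrow> \<bar>u - s\<bar> < \<eta> \<Longrightarrow> t \<le> u \<Longrightarrow>
      \<bar>f u - f t - D s * (u - t)\<bar> \<le> e * (u - t)" using up[OF \<open>e > 0\<close>] by blast
    show "\<exists>d>0. \<forall>y. norm (y - s) < d \<longrightarrow> norm (f y - f s - D s * (y - s)) \<le> e * norm (y - s)"
    proof (intro exI[of _ \<eta>] conjI allI impI \<eta>(1))
      fix y assume y: "norm (y - s) < \<eta>"
      show "norm (f y - f s - D s * (y - s)) \<le> e * norm (y - s)"
      proof (cases "s \<le> y")
        case True
        then show ?thesis using \<eta>(2)[of s y] y \<eta>(1) by auto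
      next
        case False
        then show ?thesis using \<eta>(2)[of y s] y \<eta>(1) by (auto simp: abs_le_iff algebra_simps)
      qed
    qed
  qed
qed

section \<open>One-variable estimates for products, exponentials, zeros and maxima\<close>

lemma lipschitz_on_mult_bounded:
  fixes f g :: "real \<Rightarrow> real"
  assumes f: "C-lipschitz_on U f" and g: "D-lipschitz_on U g"
    and A: "\<And>x. x \<in> U \<Longrightarrow> \<bar>f x\<bar> \<le> A" and B: "\<And>x. x \<in> U \<Longrightarrow> \<bar>g x\<bar> \<le> B"
    and "A \<ge> 0" "B \<ge> 0"
  shows "(A * D + B * C)-lipschitz_on U (\<lambda>x. f x * g x)"
proof (rule lipschitz_onI)
  show "0 \<le> A * D + B * C"
    using lipschitz_on_nonneg[OF f] lipschitz_on_nonneg[OF g] assms(5,6) by auto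
  fix x y assume xy: "x \<in> U" "y \<in> U"
  have 1: "\<bar>f x - f y\<bar> \<le> C * \<bar>x - y\<bar>" "\<bar>g x - g y\<bar> \<le> D * \<bar>x - y\<bar>"
    using lipschitz_onD[OF f xy] lipschitz_onD[OF g xy] by (auto simp: dist_real_def)
  have "f x * g x - f y * g y = f x * (g x - g y) + g y * (f x - f y)" by (simp add: algebra_simps)
  also have "\<bar>\<dots>\<bar> \<le> \<bar>f x\<bar> * \<bar>g x - g y\<bar> + \<bar>g y\<bar> * \<bar>f x - f y\<bar>"
    by (metis abs_mult abs_triangle_ineq)
  also have "\<dots> \<le> A * (D * \<bar>x - y\<bar>) + B * (C * \<bar>x - y\<bar>)"
    using 1 A[OF xy(1)] B[OF xy(2)] assms(5,6) by (intro add_mono mult_mono) auto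
  finally show "dist (f x * g x) (f y * g y) \<le> (A * D + B * C) * dist x y"
    by (simp add: dist_real_def algebra_simps)
qed

lemma lipschitz_on_exp_uminus:
  fixes h :: "real \<Rightarrow> real"
  assumes h: "C-lipschitz_on {a..b} h"
  shows "\<exists>D. D-lipschitz_on {a..b} (\<lambda>t. exp (- h t))"
proof -
  have "compact ((\<lambda>t. - h t) ` {a..b})"
    using lipschitz_on_continuous_on[OF h] by (intro compact_continuous_image continuous_intros) auto
  then obtain m where m: "\<And>t. t \<in> {a..b} \<Longrightarrow> - h t \<le> m"
    using bounded_imp_bdd_above[OF compact_imp_bounded] by (fastforce simp: bdd_above_def)
  have "(exp m)-lipschitz_on {..m} (exp :: real \<Rightarrow> real)"
  proof (rule bounded_derivative_imp_lipschitz)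
    fix x assume "x \<in> {..m}"
    show "(exp has_derivative (\<lambda>y. exp x * y)) (at x within {..m})"
      using has_field_derivative_at_within[OF DERIV_exp[of x]] unfolding has_field_derivative_def .
    show "onorm (\<lambda>y. exp x * y) \<le> exp m"
      using \<open>x \<in> {..m}\<close> by (intro onorm_bound) (auto simp: abs_mult intro!: mult_right_mono)
  qed auto
  then have "(exp m)-lipschitz_on ((\<lambda>t. - h t) ` {a..b}) (exp :: real \<Rightarrow> real)"
    by (rule lipschitz_on_subset) (use m in auto)
  then show ?thesis
    using lipschitz_on_compose2[of C "{a..b}" "\<lambda>t. - h t"] h by auto
qed

text \<open>Before the first and after the last zero the mean value theorem applies; between these
  two zeros the net increment is 0. Hence nothing has to be known about the set of zeros. It is
  applied at fixed x to functions of time that may fail to be differentiable when the free boundary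
  passes through x, which is exactly when they vanish.\<close>

lemma abs_diff_le_of_deriv_off_zeros:
  fixes g :: "real \<Rightarrow> real"
  assumes cont: "continuous_on {a..b} g" and "a \<le> b" and "M \<ge> 0"
    and deriv: "\<And>t. a < t \<Longrightarrow> t < b \<Longrightarrow> g t \<noteq> 0 \<Longrightarrow> \<exists>d. (g has_real_derivative d) (at t) \<and> \<bar>d\<bar> \<le> M"
  shows "\<bar>g b - g a\<bar> \<le> M * (b - a)"
proof -
  have mvt: "\<bar>g v - g u\<bar> \<le> M * (v - u)"
    if uv: "a \<le> u" "u \<le> v" "v \<le> b" and nz: "\<And>t. u < t \<Longrightarrow> t < v \<Longrightarrow> g t \<noteq> 0" for u v
  proof (cases "u = v")
    case False
    then have "u < v" using uv by auto
    have c: "continuous_on {u..v} g" using cont uv by (auto intro: continuous_on_subset)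
    have "\<exists>l z. u < z \<and> z < v \<and> (g has_real_derivative l) (at z) \<and> g v - g u = (v - u) * l"
    proof (rule MVT[OF \<open>u < v\<close> c])
      fix x assume "u < x" "x < v"
      then show "g differentiable at x" using deriv[of x] nz[of x] uv
        by (auto simp: real_differentiable_def)
    qed
    then obtain l z where z: "u < z" "z < v" "(g has_real_derivative l) (at z)" "g v - g u = (v - u) * l"
      by blast
    then obtain d where "(g has_real_derivative d) (at z)" "\<bar>d\<bar> \<le> M"
      using deriv[of z] nz[of z] uv by auto
    then have "\<bar>l\<bar> \<le> M" using z(3) DERIV_unique by blast
    then show ?thesis using z(4) \<open>u < v\<close> by (simp add: abs_mult mult.commute mult_right_mono)
  qed auto
  define Z where "Z = {t\<in>{a..b}. g t = 0}"
  have "Z = {a..b} \<inter> g -` {0}" by (auto simp: Z_def)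
  then have "compact Z"
    using continuous_closed_preimage[OF cont closed_atLeastAtMost closed_singleton[of 0]]
    by (metis compact_Icc compact_Int_closed inf.left_idem)
  show ?thesis
  proof (cases "Z = {}")
    case True
    then show ?thesis using mvt[of a b] \<open>a \<le> b\<close> by (force simp: Z_def)
  next
    case False
    obtain z1 where z1: "z1 \<in> Z" "\<And>t. t \<in> Z \<Longrightarrow> z1 \<le> t"
      using compact_attains_inf[OF \<open>compact Z\<close> False] by auto
    obtain z2 where z2: "z2 \<in> Z" "\<And>t. t \<in> Z \<Longrightarrow> t \<le> z2"
      using compact_attains_sup[OF \<open>compact Z\<close> False] by auto
    have "\<bar>g z1 - g a\<bar> \<le> M * (z1 - a)"
    proof (rule mvt)
      show "g t \<noteq> 0" if "a < t" "t < z1" for t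
        using z1(2)[of t] z1(1) that by (auto simp: Z_def)
    qed (use z1 in \<open>auto simp: Z_def\<close>)
    moreover have "\<bar>g b - g z2\<bar> \<le> M * (b - z2)"
    proof (rule mvt)
      show "g t \<noteq> 0" if "z2 < t" "t < b" for t
        using z2(2)[of t] z2(1) that by (auto simp: Z_def)
    qed (use z2 in \<open>auto simp: Z_def\<close>)
    moreover have "g z1 = 0" "g z2 = 0" "z1 \<le> z2" using z1 z2 by (auto simp: Z_def)
    moreover have "M * (z2 - z1) \<ge> 0" using calculation(5) \<open>M \<ge> 0\<close> by simp
    ultimately show ?thesis by (auto simp: abs_le_iff algebra_simps)
  qed
qed

text \<open>Only the value of the second derivative at c is available here: if it were positive,
  \<open>f'\<close> would be positive just to the right of c and the mean value theorem would
  contradict maximality.\<close>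

lemma local_max_second_deriv_le_0:
  fixes f f' :: "real \<Rightarrow> real"
  assumes "d > 0" and f: "\<And>x. \<bar>x - c\<bar> < d \<Longrightarrow> (f has_real_derivative f' x) (at x)"
    and f': "(f' has_real_derivative D) (at c)"
    and max: "\<And>x. \<bar>x - c\<bar> < d \<Longrightarrow> f x \<le> f c"
  shows "D \<le> 0"
proof (rule ccontr)
  assume "\<not> D \<le> 0"
  then have "D > 0" by simp
  have "f' c = 0"
    by (rule DERIV_local_max[OF f \<open>d > 0\<close>]) (use \<open>d > 0\<close> max in \<open>auto simp: abs_minus_commute\<close>)
  obtain h where h: "h > 0" "\<And>u. u > 0 \<Longrightarrow> u < h \<Longrightarrow> f' c < f' (c + u)"
    using DERIV_pos_inc_right[OF f' \<open>D > 0\<close>] by auto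
  define u where "u = min h d / 2"
  have u: "u > 0" "u < h" "u < d" using h(1) \<open>d > 0\<close> by (auto simp: u_def min_def)
  obtain z where z: "c < z" "z < c + u" "f (c + u) - f c = (c + u - c) * f' z"
    using MVT2[of c "c + u" f f'] u f by (auto simp: abs_less_iff)
  have "f' z > 0" using h(2)[of "z - c"] z u \<open>f' c = 0\<close> by auto
  then have "f (c + u) > f c" using z(3) u(1) by (simp add: algebra_simps)
  then show False using max[of "c + u"] u by auto
qed

section \<open>The heat kernel and the error function\<close>

definition heat_kernel :: "real \<Rightarrow> real \<Rightarrow> real \<Rightarrow> real" where
  "heat_kernel k \<tau> x = exp (- x\<^sup>2 / (4 * k * \<tau>)) / sqrt (4 * pi * k * \<tau>)"

definition heat_kernel_x :: "real \<Rightarrow> real \<Rightarrow> real \<Rightarrow> real" where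
  "heat_kernel_x k \<tau> x = - (x / (2 * k * \<tau>)) * heat_kernel k \<tau> x"

definition heat_kernel_xx :: "real \<Rightarrow> real \<Rightarrow> real \<Rightarrow> real" where
  "heat_kernel_xx k \<tau> x = (x\<^sup>2 / (4 * k\<^sup>2 * \<tau>\<^sup>2) - 1 / (2 * k * \<tau>)) * heat_kernel k \<tau> x"

lemma heat_kernel_eq_normal_density:
  "k > 0 \<Longrightarrow> \<tau> > 0 \<Longrightarrow> heat_kernel k \<tau> = normal_density 0 (sqrt (2 * k * \<tau>))"
  by (rule ext) (simp add: heat_kernel_def normal_density_def field_simps)

lemma heat_kernel_measurable [measurable]: "heat_kernel k \<tau> \<in> borel_measurable borel"
  unfolding heat_kernel_def by measurable

lemma heat_kernel_pos: "k > 0 \<Longrightarrow> \<tau> > 0 \<Longrightarrow> heat_kernel k \<tau> x > 0"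
  by (simp add: heat_kernel_def)

lemma heat_kernel_le: "k > 0 \<Longrightarrow> \<tau> > 0 \<Longrightarrow> heat_kernel k \<tau> x \<le> 1 / sqrt (4 * pi * k * \<tau>)"
  by (auto simp: heat_kernel_def intro!: divide_right_mono)

lemma integrable_heat_kernel: "k > 0 \<Longrightarrow> \<tau> > 0 \<Longrightarrow> integrable lborel (heat_kernel k \<tau>)"
  using integrable_normal_density[of "sqrt (2 * k * \<tau>)" 0]
  by (simp add: heat_kernel_eq_normal_density)

lemma integral_heat_kernel: "k > 0 \<Longrightarrow> \<tau> > 0 \<Longrightarrow> (LINT x|lborel. heat_kernel k \<tau> x) = 1"
  using integral_normal_density[of "sqrt (2 * k * \<tau>)" 0]
  by (simp add: heat_kernel_eq_normal_density)

lemma integrable_heat_kernel_shift: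
  "k > 0 \<Longrightarrow> \<tau> > 0 \<Longrightarrow> integrable lborel (\<lambda>x. heat_kernel k \<tau> (x - y))"
  using lborel_integrable_real_affine[of "heat_kernel k \<tau>" 1 "- y"] integrable_heat_kernel[of k \<tau>]
  by simp

lemma heat_kernel_cont [continuous_intros]:
  assumes "continuous_on S f" "continuous_on S g" "\<And>z. z \<in> S \<Longrightarrow> g z > 0" "k > 0"
  shows "continuous_on S (\<lambda>z. heat_kernel k (g z) (f z))"
  unfolding heat_kernel_def using assms by (force intro!: continuous_intros)

lemma heat_kernel_xx_cont [continuous_intros]:
  assumes "continuous_on S f" "continuous_on S g" "\<And>z. z \<in> S \<Longrightarrow> g z > 0" "k > 0"
  shows "continuous_on S (\<lambda>z. heat_kernel_xx k (g z) (f z))"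
  unfolding heat_kernel_xx_def using assms by (force intro!: continuous_intros)

lemma DERIV_heat_kernel:
  assumes "k > 0" "\<tau> > 0"
  shows "((\<lambda>x. heat_kernel k \<tau> (x - y)) has_real_derivative heat_kernel_x k \<tau> (x - y)) (at x)"
proof -
  have "((\<lambda>x. - (x - y)\<^sup>2 / (4 * k * \<tau>)) has_real_derivative - ((x - y) / (2 * k * \<tau>))) (at x)"
    using assms by (auto intro!: derivative_eq_intros simp: field_simps)
  from DERIV_cdivide[OF DERIV_fun_exp[OF this], of "sqrt (4 * pi * k * \<tau>)"]
  show ?thesis unfolding heat_kernel_def heat_kernel_x_def by (simp add: mult.commute)
qed

lemma DERIV_heat_kernel_x:
  assumes "k > 0" "\<tau> > 0"
  shows "((\<lambda>x. heat_kernel_x k \<tau> (x - y)) has_real_derivative heat_kernel_xx k \<tau> (x - y)) (at x)"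
proof -
  have "((\<lambda>x. - ((x - y) / (2 * k * \<tau>))) has_real_derivative - 1 / (2 * k * \<tau>)) (at x)"
    using assms by (auto intro!: derivative_eq_intros simp: field_simps power2_eq_square)
  from DERIV_mult[OF this DERIV_heat_kernel[OF assms, of y]]
  have "((\<lambda>x. - ((x - y) / (2 * k * \<tau>)) * heat_kernel k \<tau> (x - y)) has_real_derivative
      heat_kernel_xx k \<tau> (x - y)) (at x)"
    by (rule DERIV_cong) (simp add: heat_kernel_x_def heat_kernel_xx_def field_simps power2_eq_square)
  then show ?thesis by (simp add: heat_kernel_x_def)
qed

lemma DERIV_heat_kernel_time:
  assumes "k > 0" "\<tau> > 0"
  shows "((\<lambda>\<tau>. heat_kernel k \<tau> x) has_real_derivative k * heat_kernel_xx k \<tau> x) (at \<tau>)"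
proof -
  have 1: "((\<lambda>\<tau>. - x\<^sup>2 / (4 * k * \<tau>)) has_real_derivative x\<^sup>2 / (4 * k * \<tau>\<^sup>2)) (at \<tau>)"
    using assms by (auto intro!: derivative_eq_intros simp: field_simps power2_eq_square)
  have 2: "((\<lambda>\<tau>. sqrt (4 * pi * k * \<tau>)) has_real_derivative sqrt (4 * pi * k * \<tau>) / (2 * \<tau>)) (at \<tau>)"
  proof -
    have D: "((\<lambda>\<tau>. sqrt (4 * pi * k * \<tau>)) has_real_derivative
        inverse (sqrt (4 * pi * k * \<tau>)) / 2 * (4 * pi * k)) (at \<tau>)"
      using assms by (auto intro!: derivative_eq_intros simp: mult_less_0_iff zero_less_mult_iff)
    have "inverse (sqrt (4 * pi * k * \<tau>)) = sqrt (4 * pi * k * \<tau>) / (4 * pi * k * \<tau>)"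
      using sqrt_divide_self_eq[of "4 * pi * k * \<tau>"] assms by simp
    then have "inverse (sqrt (4 * pi * k * \<tau>)) / 2 * (4 * pi * k) = sqrt (4 * pi * k * \<tau>) / (2 * \<tau>)"
      using assms by (simp only:) simp
    with D show ?thesis by (rule DERIV_cong)
  qed
  have s: "sqrt (4 * pi * k * \<tau>) > 0" using assms by simp
  have "((\<lambda>\<tau>. heat_kernel k \<tau> x) has_real_derivative
      (exp (- x\<^sup>2 / (4 * k * \<tau>)) * (x\<^sup>2 / (4 * k * \<tau>\<^sup>2)) * sqrt (4 * pi * k * \<tau>) -
        exp (- x\<^sup>2 / (4 * k * \<tau>)) * (sqrt (4 * pi * k * \<tau>) / (2 * \<tau>))) /
      (sqrt (4 * pi * k * \<tau>) * sqrt (4 * pi * k * \<tau>))) (at \<tau>)"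
    unfolding heat_kernel_def
    by (rule DERIV_divide DERIV_fun_exp 1 2)+ (use s in linarith)
  also have "(exp (- x\<^sup>2 / (4 * k * \<tau>)) * (x\<^sup>2 / (4 * k * \<tau>\<^sup>2)) * sqrt (4 * pi * k * \<tau>) -
        exp (- x\<^sup>2 / (4 * k * \<tau>)) * (sqrt (4 * pi * k * \<tau>) / (2 * \<tau>))) /
      (sqrt (4 * pi * k * \<tau>) * sqrt (4 * pi * k * \<tau>)) =
      (x\<^sup>2 / (4 * k * \<tau>\<^sup>2) - 1 / (2 * \<tau>)) * heat_kernel k \<tau> x"
  proof -
    have "(e * X * q - e * (q / Z)) / (q * q) = (X - 1 / Z) * (e / q)" if "q > 0" for e X q Z :: real
    proof -
      have "e * X * q - e * (q / Z) = q * (e * (X - 1 / Z))" by (simp add: algebra_simps)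
      then show ?thesis using that by simp
    qed
    from this[OF s] show ?thesis unfolding heat_kernel_def .
  qed
  also have "\<dots> = k * heat_kernel_xx k \<tau> x"
    unfolding heat_kernel_xx_def using assms by (simp add: field_simps power2_eq_square)
  finally show ?thesis .
qed

lemma heat_kernel_rescale:
  assumes "\<tau> > 0"
  shows "sqrt \<tau> * heat_kernel k \<tau> (sqrt \<tau> * z) = heat_kernel k 1 z"
  using assms by (simp add: heat_kernel_def power_mult_distrib real_sqrt_mult)

text \<open>The largest time goes into the exponent and the smallest into the prefactor, which gives
  a Gaussian tail bound uniform over a time interval.\<close>

lemma heat_kernel_le_of_time_between:
  assumes "k > 0" "0 < \<tau>1" "\<tau>1 \<le> \<tau>" "\<tau> \<le> \<tau>2" "0 \<le> R" "R \<le> \<bar>x\<bar>"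
  shows "heat_kernel k \<tau> x \<le> exp (- R\<^sup>2 / (4 * k * \<tau>2)) / sqrt (4 * pi * k * \<tau>1)"
proof -
  have "R\<^sup>2 \<le> x\<^sup>2" using abs_le_square_iff[of R x] assms(5,6) by simp
  then have "R\<^sup>2 / (4 * k * \<tau>2) \<le> x\<^sup>2 / (4 * k * \<tau>)"
    using assms by (intro frac_le) auto
  then show ?thesis
    unfolding heat_kernel_def using assms by (intro frac_le) auto
qed

section \<open>The error function and its inverse\<close>

lemma DERIV_erf: "(erf has_real_derivative 2 / sqrt pi * exp (- z\<^sup>2)) (at z)"
proof -
  define c where "c = \<bar>z\<bar> + 1"
  have "((\<lambda>u. LBINT y=ereal 0..ereal u. exp (- y\<^sup>2)) has_vector_derivative exp (- z\<^sup>2)) (at z within {-c..c})"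
    by (rule interval_integral_FTC2) (auto simp: c_def intro!: continuous_intros)
  moreover have "at z within {-c..c} = at z"
    by (rule at_within_interior) (auto simp: c_def)
  ultimately have "((\<lambda>u. LBINT y=ereal 0..ereal u. exp (- y\<^sup>2)) has_real_derivative exp (- z\<^sup>2)) (at z)"
    by (simp add: has_real_derivative_iff_has_vector_derivative)
  from DERIV_cmult[OF this, of "2 / sqrt pi"] show ?thesis by (simp add: erf_def[abs_def])
qed

lemma erf_0 [simp]: "erf 0 = 0"
  by (simp add: erf_def)

lemma erf_minus: "erf (- z) = - erf z"
proof -
  have "((\<lambda>z. erf z + erf (- z)) has_real_derivative 0) (at z)" for z
  proof -
    have "((\<lambda>z. - z) has_real_derivative - 1) (at z)" by (auto intro!: derivative_eq_intros)
    from DERIV_add[OF DERIV_erf DERIV_chain2[OF DERIV_erf this]] show ?thesis by simp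
  qed
  then have "erf z + erf (- z) = erf 0 + erf (- 0)"
    using DERIV_isconst_all[of "\<lambda>z. erf z + erf (- z)" z 0] by blast
  then show ?thesis by simp
qed

lemma erf_strict_mono: "strict_mono erf"
  unfolding strict_mono_def
proof (intro allI impI)
  fix x y :: real assume "x < y"
  show "erf x < erf y"
  proof (rule DERIV_pos_imp_increasing[OF \<open>x < y\<close>])
    show "\<exists>d. (erf has_real_derivative d) (at z) \<and> d > 0" for z
      using DERIV_erf[of z] by (intro exI[of _ "2 / sqrt pi * exp (- z\<^sup>2)"]) simp
  qed
qed

lemma erf_at_top: "(erf \<longlongrightarrow> 1) at_top"
proof -
  define g where "g x = indicator {0..} x *\<^sub>R exp (- x\<^sup>2)" for x :: real
  have g: "integrable lborel g" "(LINT x|lborel. g x) = sqrt pi / 2"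
    using gaussian_moment_0 unfolding g_def[abs_def] has_bochner_integral_iff by auto
  have "((\<lambda>y. LINT x|lborel. indicator {..y} x *\<^sub>R g x) \<longlongrightarrow> sqrt pi / 2) at_top"
    using tendsto_integral_at_top[of lborel g] g by simp
  then have "((\<lambda>y. 2 / sqrt pi * (LINT x|lborel. indicator {..y} x *\<^sub>R g x)) \<longlongrightarrow> 2 / sqrt pi * (sqrt pi / 2)) at_top"
    by (intro tendsto_intros)
  moreover have "\<forall>\<^sub>F y in at_top. 2 / sqrt pi * (LINT x|lborel. indicator {..y} x *\<^sub>R g x) = erf y"
    using eventually_ge_at_top[of 0]
  proof eventually_elim
    case (elim y)
    have "(LINT x|lborel. indicator {..y} x *\<^sub>R g x) = (LBINT x:{0..y}. exp (- x\<^sup>2))"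
      unfolding set_lebesgue_integral_def
      by (rule Bochner_Integration.integral_cong) (auto simp: g_def indicator_def)
    then show ?case using elim by (simp add: erf_def interval_integral_Icc)
  qed
  ultimately show ?thesis by (simp add: tendsto_cong)
qed

lemma erf_at_bot: "(erf \<longlongrightarrow> - 1) at_bot"
proof -
  have "((\<lambda>x. - erf (- x)) \<longlongrightarrow> - 1) at_bot"
    by (intro tendsto_intros filterlim_compose[OF erf_at_top filterlim_uminus_at_top_at_bot])
  then show ?thesis by (simp add: erf_minus)
qed

lemma erf_inv_erf:
  assumes "-1 < e" "e < 1"
  shows "erf (inv erf e) = e"
proof -
  obtain u where u: "erf u > e"
    using order_tendstoD(1)[OF erf_at_top assms(2)] by (auto simp: eventually_at_top_linorder)
  obtain v where v: "erf v < e"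
    using order_tendstoD(2)[OF erf_at_bot assms(1)] by (auto simp: eventually_at_bot_linorder)
  have "v \<le> u" using u v erf_strict_mono by (metis less_trans linorder_not_less order.asym strict_mono_less)
  have "continuous_on {v..u} erf"
    using DERIV_erf by (intro continuous_at_imp_continuous_on) (auto intro: DERIV_isCont)
  from IVT'[OF _ _ \<open>v \<le> u\<close> this, of e] u v obtain x where "erf x = e" by auto
  then show ?thesis by (metis f_inv_into_f rangeI)
qed

text \<open>Take for c the least slope of \<open>erf\<close> within distance 1 of \<open>z0\<close>,
  bounded below through \<open>R = \<bar>z0\<bar> + 1\<close>. A gap smaller than c forces
  \<open>\<bar>z - z0\<bar> < 1\<close> by monotonicity, and on that range the slope bound can be
  inverted.\<close>

lemma erf_inverse_estimate:
  "\<exists>c>0. \<forall>z. \<bar>erf z - erf z0\<bar> < c \<longrightarrow> \<bar>z - z0\<bar> \<le> \<bar>erf z - erf z0\<bar> / c"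
proof -
  define R where "R = \<bar>z0\<bar> + 1"
  define c where "c = 2 / sqrt pi * exp (- R\<^sup>2)"
  have "c > 0" by (simp add: c_def)
  have lower: "erf y - erf x \<ge> c * (y - x)" if "x \<le> y" "\<bar>x\<bar> \<le> R" "\<bar>y\<bar> \<le> R" for x y
  proof -
    have "erf x - c * x \<le> erf y - c * y"
    proof (rule DERIV_nonneg_imp_nondecreasing[OF \<open>x \<le> y\<close>])
      fix u assume "x \<le> u" "u \<le> y"
      then have "\<bar>u\<bar> \<le> \<bar>R\<bar>" using that by auto
      then have "u\<^sup>2 \<le> R\<^sup>2" by (simp only: abs_le_square_iff)
      then have "2 / sqrt pi * exp (- u\<^sup>2) - c \<ge> 0" by (simp add: c_def divide_right_mono)
      moreover have "((\<lambda>x. erf x - c * x) has_real_derivative 2 / sqrt pi * exp (- u\<^sup>2) - c) (at u)"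
        by (auto intro!: derivative_eq_intros DERIV_erf)
      ultimately show "\<exists>d. ((\<lambda>x. erf x - c * x) has_real_derivative d) (at u) \<and> d \<ge> 0" by blast
    qed
    then show ?thesis by (simp add: algebra_simps)
  qed
  have z0: "\<bar>z0\<bar> \<le> R" "\<bar>z0 + 1\<bar> \<le> R" "\<bar>z0 - 1\<bar> \<le> R" by (auto simp: R_def)
  have "\<bar>z - z0\<bar> \<le> \<bar>erf z - erf z0\<bar> / c" if z: "\<bar>erf z - erf z0\<bar> < c" for z
  proof -
    have "z < z0 + 1"
    proof (rule ccontr)
      assume "\<not> z < z0 + 1"
      then have "erf (z0 + 1) \<le> erf z" using erf_strict_mono by (simp add: strict_mono_less_eq)
      then show False using lower[of z0 "z0 + 1"] z0 z by auto
    qed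
    moreover have "z > z0 - 1"
    proof (rule ccontr)
      assume "\<not> z > z0 - 1"
      then have "erf z \<le> erf (z0 - 1)" using erf_strict_mono by (simp add: strict_mono_less_eq)
      then show False using lower[of "z0 - 1" z0] z0 z by auto
    qed
    ultimately have "\<bar>z\<bar> \<le> R" by (auto simp: R_def)
    then have "c * \<bar>z - z0\<bar> \<le> \<bar>erf z - erf z0\<bar>"
      using lower[of z z0] lower[of z0 z] z0 by (cases "z \<le> z0") (auto simp: algebra_simps)
    then show ?thesis using \<open>c > 0\<close> by (simp add: field_simps)
  qed
  with \<open>c > 0\<close> show ?thesis by blast
qed

section \<open>The primitive of the heat kernel vanishing at minus infinity, and Riemann
  sums\<close>

definition heat_cdf :: "real \<Rightarrow> real \<Rightarrow> real \<Rightarrow> real" where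
  "heat_cdf k \<tau> z = (1 + erf (z / sqrt (4 * k * \<tau>))) / 2"

lemma DERIV_heat_cdf:
  assumes "k > 0" "\<tau> > 0"
  shows "(heat_cdf k \<tau> has_real_derivative heat_kernel k \<tau> z) (at z)"
proof -
  have q: "sqrt (4 * k * \<tau>) > 0" using assms by simp
  have "((\<lambda>z. z / sqrt (4 * k * \<tau>)) has_real_derivative 1 / sqrt (4 * k * \<tau>)) (at z)"
    by (rule DERIV_cdivide[OF DERIV_ident])
  from DERIV_cdivide[OF DERIV_add[OF DERIV_const[of 1] DERIV_chain2[OF DERIV_erf this]], of 2]
  have "((\<lambda>z. (1 + erf (z / sqrt (4 * k * \<tau>))) / 2) has_real_derivative
      (2 / sqrt pi * exp (- (z / sqrt (4 * k * \<tau>))\<^sup>2) * (1 / sqrt (4 * k * \<tau>))) / 2) (at z)"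
    by simp
  also have "(2 / sqrt pi * exp (- (z / sqrt (4 * k * \<tau>))\<^sup>2) * (1 / sqrt (4 * k * \<tau>))) / 2 = heat_kernel k \<tau> z"
  proof -
    have "sqrt (4 * pi * k * \<tau>) = sqrt pi * sqrt (4 * k * \<tau>)" by (simp flip: real_sqrt_mult add: ac_simps)
    moreover have "0 \<le> 4 * k * \<tau>" using assms by simp
    moreover from this have "sqrt (4 * k * \<tau>) / (4 * k * \<tau>) = 1 / sqrt (4 * k * \<tau>)"
      by (simp only: sqrt_divide_self_eq inverse_eq_divide)
    ultimately show ?thesis by (simp add: heat_kernel_def power_divide)
  qed
  finally show ?thesis by (simp add: heat_cdf_def[abs_def])
qed

lemma heat_cdf_minus: "heat_cdf k \<tau> (- z) = 1 - heat_cdf k \<tau> z"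
  by (simp add: heat_cdf_def erf_minus field_simps)

lemma heat_cdf_at_bot:
  assumes "k > 0" "\<tau> > 0"
  shows "(heat_cdf k \<tau> \<longlongrightarrow> 0) at_bot"
proof -
  have "sqrt (4 * k * \<tau>) > 0" using assms by simp
  then have "filterlim (\<lambda>z. z / sqrt (4 * k * \<tau>)) at_bot at_bot"
    unfolding divide_inverse by (subst mult.commute, intro filterlim_tendsto_pos_mult_at_bot[OF tendsto_const] filterlim_ident) auto
  then have "((\<lambda>z. erf (z / sqrt (4 * k * \<tau>))) \<longlongrightarrow> - 1) at_bot"
    by (rule filterlim_compose[OF erf_at_bot])
  then have "((\<lambda>z. (1 + erf (z / sqrt (4 * k * \<tau>))) / 2) \<longlongrightarrow> (1 + - 1) / 2) at_bot"
    by (intro tendsto_intros) auto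
  then show ?thesis by (simp add: heat_cdf_def[abs_def])
qed

lemma heat_kernel_even: "heat_kernel k \<tau> (- x) = heat_kernel k \<tau> x"
  by (simp add: heat_kernel_def)

lemma heat_kernel_antimono_abs:
  assumes "k > 0" "\<tau> > 0" "\<bar>x\<bar> \<le> \<bar>y\<bar>"
  shows "heat_kernel k \<tau> y \<le> heat_kernel k \<tau> x"
proof -
  have "x\<^sup>2 \<le> y\<^sup>2" using assms(3) by (simp only: abs_le_square_iff)
  then show ?thesis using assms unfolding heat_kernel_def by (intro divide_right_mono) (auto intro!: divide_right_mono)
qed

text \<open>The kernel is unimodal, so its variation on disjoint cells of length \<open>a\<close> sums up to at
  most twice its maximum.  The function \<open>V\<close> below is its variation function.\<close>

lemma heat_kernel_riemann_sum:
  assumes "k > 0" "\<tau> > 0" "a > 0"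
  shows "summable (\<lambda>n. heat_kernel k \<tau> (z - real n * a))"
    and "\<bar>a * (\<Sum>n. heat_kernel k \<tau> (z - real n * a)) - heat_cdf k \<tau> z\<bar> \<le> 2 * a * heat_kernel k \<tau> 0"
proof -
  let ?h = "heat_kernel k \<tau>"
  define V where "V x = (if x \<le> 0 then ?h x else 2 * ?h 0 - ?h x)" for x
  have h0: "?h x \<le> ?h 0" "?h x > 0" for x
    using heat_kernel_antimono_abs[OF assms(1,2), of 0 x] heat_kernel_pos[OF assms(1,2)] by auto
  have V: "\<bar>?h x - ?h y\<bar> \<le> V y - V x" if "x \<le> y" for x y
    using h0[of x] h0[of y] heat_kernel_antimono_abs[OF assms(1,2), of x y]
      heat_kernel_antimono_abs[OF assms(1,2), of y x] that
    by (auto simp: V_def abs_if)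
  have V_bd: "0 \<le> V x" "V x \<le> 2 * ?h 0" for x using h0[of x] by (auto simp: V_def)
  have cell: "\<bar>a * ?h x - (heat_cdf k \<tau> x - heat_cdf k \<tau> (x - a))\<bar> \<le> a * (V x - V (x - a))" for x
  proof -
    obtain \<xi> where \<xi>: "x - a < \<xi>" "\<xi> < x" "heat_cdf k \<tau> x - heat_cdf k \<tau> (x - a) = (x - (x - a)) * ?h \<xi>"
      using MVT2[of "x - a" x "heat_cdf k \<tau>" "?h"] DERIV_heat_cdf[OF assms(1,2)] \<open>a > 0\<close> by auto
    have "\<bar>a * ?h x - (heat_cdf k \<tau> x - heat_cdf k \<tau> (x - a))\<bar> = a * \<bar>?h \<xi> - ?h x\<bar>"
      using \<xi>(3) \<open>a > 0\<close> by (simp add: abs_mult abs_minus_commute flip: right_diff_distrib)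
    also have "\<dots> \<le> a * (V x - V \<xi>)" using V[of \<xi> x] \<xi> \<open>a > 0\<close> by (intro mult_left_mono) auto
    also have "\<dots> \<le> a * (V x - V (x - a))" using V[of "x - a" \<xi>] \<xi> \<open>a > 0\<close> by (intro mult_left_mono) auto
    finally show ?thesis .
  qed
  \<comment> \<open>Both sides of the cell estimate telescope. The remaining \<open>heat_cdf\<close>
    term at the far left end tends to 0.\<close>
  have part: "\<bar>a * (\<Sum>n<N. ?h (z - real n * a)) - (heat_cdf k \<tau> z - heat_cdf k \<tau> (z - real N * a))\<bar>
      \<le> a * (V z - V (z - real N * a))" for N
  proof (induction N)
    case (Suc N)
    have eq: "z - real N * a - a = z - real (Suc N) * a" by (simp add: algebra_simps)
    show ?case using Suc cell[of "z - real N * a"] unfolding eq by (simp add: algebra_simps abs_le_iff)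
  qed simp
  have bound: "\<bar>a * (\<Sum>n<N. ?h (z - real n * a)) - (heat_cdf k \<tau> z - heat_cdf k \<tau> (z - real N * a))\<bar>
      \<le> 2 * a * ?h 0" for N
  proof -
    have "a * (V z - V (z - real N * a)) \<le> a * (2 * ?h 0)"
      using V_bd[of z] V_bd[of "z - real N * a"] \<open>a > 0\<close> by (intro mult_left_mono) auto
    then show ?thesis using part[of N] by simp
  qed
  have filt: "filterlim (\<lambda>N. z - real N * a) at_bot sequentially"
    using \<open>a > 0\<close> by real_asymp
  have cdf_lim: "(\<lambda>N. heat_cdf k \<tau> (z - real N * a)) \<longlonglongrightarrow> 0"
    by (rule filterlim_compose[OF heat_cdf_at_bot[OF assms(1,2)] filt])
  obtain B where B: "\<And>N. \<bar>heat_cdf k \<tau> (z - real N * a)\<bar> \<le> B"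
    using convergent_imp_Bseq[OF convergentI[OF cdf_lim]] by (auto simp: Bseq_def)
  show summ: "summable (\<lambda>n. ?h (z - real n * a))"
  proof (rule summableI_nonneg_bounded)
    show "0 \<le> ?h (z - real n * a)" for n using h0(2) less_imp_le by blast
    show "(\<Sum>n<N. ?h (z - real n * a)) \<le> (heat_cdf k \<tau> z + B + 2 * a * ?h 0) / a" for N
      using bound[of N] B[of N] \<open>a > 0\<close> by (simp add: field_simps abs_le_iff)
  qed
  have "(\<lambda>N. \<bar>a * (\<Sum>n<N. ?h (z - real n * a)) - (heat_cdf k \<tau> z - heat_cdf k \<tau> (z - real N * a))\<bar>)
      \<longlonglongrightarrow> \<bar>a * (\<Sum>n. ?h (z - real n * a)) - (heat_cdf k \<tau> z - 0)\<bar>"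
    by (intro tendsto_intros cdf_lim summable_LIMSEQ[OF summ])
  from tendsto_upperbound[OF this, of "2 * a * ?h 0"] bound
  show "\<bar>a * (\<Sum>n. ?h (z - real n * a)) - heat_cdf k \<tau> z\<bar> \<le> 2 * a * ?h 0" by simp
qed

section \<open>The averaged initial datum\<close>

text \<open>The constant is the maximum of the kernel, of order \<open>1 / sqrt \<tau>\<close>. This
  is the price per unit length for shifting mass of the datum to the origin.\<close>

lemma heat_cdf_lipschitz:
  assumes "k > 0" "\<tau> > 0"
  shows "\<bar>heat_cdf k \<tau> x - heat_cdf k \<tau> y\<bar> \<le> heat_kernel k \<tau> 0 * \<bar>x - y\<bar>"
proof -
  have "heat_cdf k \<tau> v - heat_cdf k \<tau> u \<le> heat_kernel k \<tau> 0 * (v - u)"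
    "heat_cdf k \<tau> u \<le> heat_cdf k \<tau> v" if uv: "u < v" for u v
  proof -
    obtain z where z: "heat_cdf k \<tau> v - heat_cdf k \<tau> u = (v - u) * heat_kernel k \<tau> z"
      using MVT2[OF uv, of "heat_cdf k \<tau>" "heat_kernel k \<tau>"] DERIV_heat_cdf[OF assms] by auto
    have "heat_kernel k \<tau> z \<le> heat_kernel k \<tau> 0"
      using heat_kernel_antimono_abs[OF assms, of 0 z] by simp
    then have "(v - u) * heat_kernel k \<tau> z \<le> (v - u) * heat_kernel k \<tau> 0"
      using uv by (intro mult_left_mono) auto
    then show "heat_cdf k \<tau> v - heat_cdf k \<tau> u \<le> heat_kernel k \<tau> 0 * (v - u)"
      unfolding z by (simp only: mult.commute)
    have "(v - u) * heat_kernel k \<tau> z \<ge> 0"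
      using heat_kernel_pos[OF assms, of z] uv by (intro mult_nonneg_nonneg) auto
    then show "heat_cdf k \<tau> u \<le> heat_cdf k \<tau> v" using z by linarith
  qed
  from this[of x y] this[of y x] show ?thesis by (cases x y rule: linorder_cases) auto
qed

text \<open>Unfolding of the periodised sum: integrating \<open>\<Sum>n. f (x + n a)\<close> against the heat kernel
  amounts to integrating \<open>f\<close> against the periodised heat kernel, which is a Riemann sum.\<close>

lemma periodised_heat_average:
  fixes f :: "real \<Rightarrow> real"
  assumes k: "k > 0" "\<tau> > 0" "a > 0"
    and f: "integrable lebesgue f" "integrable lebesgue (\<lambda>x. x * f x)"
    and f_nonneg: "\<And>x. f x \<ge> 0" and f_zero: "\<And>x. x \<ge> 0 \<Longrightarrow> f x = 0"
  shows "summable (\<lambda>n. f (x + real n * a))"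
    and "integrable lebesgue (\<lambda>x. (\<Sum>n. f (x + real n * a)) * heat_kernel k \<tau> (x - y))"
    and "\<bar>(LINT x|lebesgue. (\<Sum>n. f (x + real n * a)) * heat_kernel k \<tau> (x - y)) -
      (LINT x|lebesgue. f x) / a * heat_cdf k \<tau> (- y)\<bar> \<le>
      heat_kernel k \<tau> 0 * (2 * (LINT x|lebesgue. f x) + (LINT x|lebesgue. \<bar>x * f x\<bar>) / a)"
proof -
  let ?h = "heat_kernel k \<tau>"
  show summ: "summable (\<lambda>n. f (x + real n * a))" for x
  proof (rule summable_finite[of "{..<nat \<lceil>\<bar>x\<bar> / a\<rceil>}"])
    fix n assume "n \<notin> {..<nat \<lceil>\<bar>x\<bar> / a\<rceil>}"
    then have "\<bar>x\<bar> / a \<le> real n" by (simp add: not_less)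
    then have "x + real n * a \<ge> 0" using \<open>a > 0\<close> by (simp add: field_simps abs_if split: if_splits)
    then show "f (x + real n * a) = 0" by (rule f_zero)
  qed simp
  have fm [measurable]: "f \<in> borel_measurable lebesgue" using f(1) by auto
  have idm [measurable]: "(\<lambda>x::real. x) \<in> borel_measurable lebesgue"
    by (rule measurable_completion) simp
  have hm [measurable]: "(\<lambda>x. ?h (x - c)) \<in> borel_measurable lebesgue" for c
    by (rule measurable_completion) (simp add: heat_kernel_def)
  have shift: "(\<lambda>x. x + c) \<in> lebesgue \<rightarrow>\<^sub>M lebesgue" for c :: real
    using lebesgue_affine_measurable[of "\<lambda>_. 1" c] by (simp add: add.commute)
  have fs [measurable]: "(\<lambda>x. f (x + c)) \<in> borel_measurable lebesgue" for c
    using measurable_compose[OF shift fm] by simp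
  define \<theta> where "\<theta> z = (\<Sum>n. ?h (z - real n * a - y))" for z
  have summ_h: "summable (\<lambda>n. ?h (z - real n * a - y))" for z
    using heat_kernel_riemann_sum(1)[OF k, of "z - y"] by (simp add: algebra_simps)
  have h0: "?h z \<ge> 0" for z using heat_kernel_pos[OF k(1,2)] less_imp_le by blast
  have \<theta>: "\<bar>a * \<theta> z - heat_cdf k \<tau> (z - y)\<bar> \<le> 2 * a * ?h 0" for z
    using heat_kernel_riemann_sum(2)[OF k, of "z - y"] by (simp add: \<theta>_def algebra_simps)
  have \<theta>0: "\<theta> z \<ge> 0" for z unfolding \<theta>_def by (intro suminf_nonneg summ_h h0)
  have \<theta>m [measurable]: "\<theta> \<in> borel_measurable lebesgue"
  proof -
    have "(\<lambda>z. ?h (z - (real n * a + y))) \<in> borel_measurable lebesgue" for n by (rule hm)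
    then show ?thesis unfolding \<theta>_def by (intro borel_measurable_suminf) (simp add: diff_diff_eq)
  qed
  \<comment> \<open>The Riemann sum error is charged to \<open>f\<close>, and replacing
    \<open>z - y\<close> by \<open>- y\<close> to \<open>\<bar>z * f z\<bar>\<close>; the latter is
    where the first moment enters.\<close>
  have est: "\<bar>f z * \<theta> z - f z / a * heat_cdf k \<tau> (- y)\<bar> \<le> 2 * ?h 0 * f z + ?h 0 / a * \<bar>z * f z\<bar>" for z
  proof -
    have "\<bar>heat_cdf k \<tau> (z - y) - heat_cdf k \<tau> (- y)\<bar> \<le> ?h 0 * \<bar>z\<bar>"
      using heat_cdf_lipschitz[OF k(1,2), of "z - y" "- y"] by simp
    with \<theta>[of z] have "\<bar>a * \<theta> z - heat_cdf k \<tau> (- y)\<bar> \<le> 2 * a * ?h 0 + ?h 0 * \<bar>z\<bar>" by linarith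
    then have "f z / a * \<bar>a * \<theta> z - heat_cdf k \<tau> (- y)\<bar> \<le> f z / a * (2 * a * ?h 0 + ?h 0 * \<bar>z\<bar>)"
      using f_nonneg[of z] k(3) by (intro mult_left_mono) auto
    moreover have "f z / a * \<bar>a * \<theta> z - heat_cdf k \<tau> (- y)\<bar> = \<bar>f z / a * (a * \<theta> z - heat_cdf k \<tau> (- y))\<bar>"
      using f_nonneg[of z] k(3) by (simp add: abs_mult)
    moreover have "f z / a * (a * \<theta> z - heat_cdf k \<tau> (- y)) = f z * \<theta> z - f z / a * heat_cdf k \<tau> (- y)"
      using k(3) by (simp add: field_simps)
    moreover have "f z / a * (2 * a * ?h 0 + ?h 0 * \<bar>z\<bar>) = 2 * ?h 0 * f z + ?h 0 / a * \<bar>z * f z\<bar>"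
      using k(3) f_nonneg[of z] by (simp add: field_simps abs_mult)
    ultimately show ?thesis by (simp only:)
  qed
  \<comment> \<open>Integrability is settled for the unfolded integrand first. Tonelli for
    nonnegative terms then carries both integrability and the value over to the periodised
    sum.\<close>
  have f\<theta>: "integrable lebesgue (\<lambda>z. f z * \<theta> z)"
  proof (rule Bochner_Integration.integrable_bound)
    show "integrable lebesgue (\<lambda>z. (2 * ?h 0 * f z + ?h 0 / a * \<bar>z * f z\<bar>) + f z / a * heat_cdf k \<tau> (- y))"
      using f by (intro Bochner_Integration.integrable_add integrable_mult_right integrable_mult_left
          integrable_divide integrable_abs)
    show "AE z in lebesgue. norm (f z * \<theta> z) \<le>
      norm ((2 * ?h 0 * f z + ?h 0 / a * \<bar>z * f z\<bar>) + f z / a * heat_cdf k \<tau> (- y))"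
      using est f_nonneg \<theta>0 by (intro AE_I2) (smt (verit) real_norm_def mult_nonneg_nonneg)
  qed measurable
  have "(\<integral>\<^sup>+x. ennreal ((\<Sum>n. f (x + real n * a)) * ?h (x - y)) \<partial>lebesgue) =
      (\<integral>\<^sup>+x. (\<Sum>n. ennreal (f (x + real n * a) * ?h (x - y))) \<partial>lebesgue)"
  proof (rule nn_integral_cong)
    fix x
    show "ennreal ((\<Sum>n. f (x + real n * a)) * ?h (x - y)) = (\<Sum>n. ennreal (f (x + real n * a) * ?h (x - y)))"
      using summ[of x] f_nonneg h0
      by (subst suminf_ennreal2) (auto intro: summable_mult2 simp: suminf_mult2)
  qed
  also have "\<dots> = (\<Sum>n. \<integral>\<^sup>+x. ennreal (f (x + real n * a) * ?h (x - y)) \<partial>lebesgue)"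
    by (rule nn_integral_suminf) measurable
  also have "\<dots> = (\<Sum>n. \<integral>\<^sup>+z. ennreal (f z * ?h (z - real n * a - y)) \<partial>lebesgue)"
  proof (rule suminf_cong)
    fix n
    have "(\<lambda>z. ennreal (f z * ?h (z - (real n * a + y)))) \<in> borel_measurable lebesgue" by measurable
    then have "(\<lambda>z. ennreal (f z * ?h (z - real n * a - y))) \<in> borel_measurable lebesgue"
      by (simp add: diff_diff_eq)
    from nn_integral_real_affine_lebesgue[OF this, of 1 "real n * a"]
    show "(\<integral>\<^sup>+x. ennreal (f (x + real n * a) * ?h (x - y)) \<partial>lebesgue) =
        (\<integral>\<^sup>+z. ennreal (f z * ?h (z - real n * a - y)) \<partial>lebesgue)" by (simp add: add.commute)
  qed
  also have "\<dots> = (\<integral>\<^sup>+z. (\<Sum>n. ennreal (f z * ?h (z - real n * a - y))) \<partial>lebesgue)"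
  proof (rule nn_integral_suminf[symmetric])
    fix n
    have "(\<lambda>z. ennreal (f z * ?h (z - (real n * a + y)))) \<in> borel_measurable lebesgue" by measurable
    then show "(\<lambda>z. ennreal (f z * ?h (z - real n * a - y))) \<in> borel_measurable lebesgue"
      by (simp add: diff_diff_eq)
  qed
  also have "\<dots> = (\<integral>\<^sup>+z. ennreal (f z * \<theta> z) \<partial>lebesgue)"
  proof (rule nn_integral_cong)
    fix z
    show "(\<Sum>n. ennreal (f z * ?h (z - real n * a - y))) = ennreal (f z * \<theta> z)"
      using summ_h[of z] f_nonneg h0
      by (subst suminf_ennreal2) (auto intro: summable_mult simp: suminf_mult \<theta>_def)
  qed
  also have "\<dots> = ennreal (LINT z|lebesgue. f z * \<theta> z)"
    using f\<theta> f_nonneg \<theta>0 by (intro nn_integral_eq_integral) auto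
  finally have nn: "(\<integral>\<^sup>+x. ennreal ((\<Sum>n. f (x + real n * a)) * ?h (x - y)) \<partial>lebesgue) =
    ennreal (LINT z|lebesgue. f z * \<theta> z)" .
  have nonneg: "(\<Sum>n. f (x + real n * a)) * ?h (x - y) \<ge> 0" for x
    using summ f_nonneg h0 by (intro mult_nonneg_nonneg suminf_nonneg) auto
  have meas: "(\<lambda>x. (\<Sum>n. f (x + real n * a)) * ?h (x - y)) \<in> borel_measurable lebesgue"
    by measurable
  show int: "integrable lebesgue (\<lambda>x. (\<Sum>n. f (x + real n * a)) * ?h (x - y))"
    by (rule integrableI_nn_integral_finite[OF meas _ nn]) (use nonneg in \<open>auto intro!: integral_nonneg_AE f_nonneg \<theta>0\<close>)
  have eq: "(LINT x|lebesgue. (\<Sum>n. f (x + real n * a)) * ?h (x - y)) = (LINT z|lebesgue. f z * \<theta> z)"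
    using integral_eq_nn_integral[OF meas] nonneg nn
    by (simp add: f_nonneg \<theta>0)
  have "\<bar>LINT z|lebesgue. f z * \<theta> z - f z / a * heat_cdf k \<tau> (- y)\<bar> \<le>
      (LINT z|lebesgue. 2 * ?h 0 * f z + ?h 0 / a * \<bar>z * f z\<bar>)"
  proof (rule integral_abs_bound[THEN order_trans])
    show "(LINT z|lebesgue. \<bar>f z * \<theta> z - f z / a * heat_cdf k \<tau> (- y)\<bar>) \<le>
      (LINT z|lebesgue. 2 * ?h 0 * f z + ?h 0 / a * \<bar>z * f z\<bar>)"
      using f f\<theta> est by (intro integral_mono integrable_abs Bochner_Integration.integrable_diff
          Bochner_Integration.integrable_add integrable_mult_right integrable_mult_left integrable_divide)
  qed
  also have "(LINT z|lebesgue. 2 * ?h 0 * f z + ?h 0 / a * \<bar>z * f z\<bar>) =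
      2 * ?h 0 * (LINT z|lebesgue. f z) + ?h 0 / a * (LINT z|lebesgue. \<bar>z * f z\<bar>)"
    using f by (subst Bochner_Integration.integral_add) auto
  also have "(LINT z|lebesgue. f z * \<theta> z - f z / a * heat_cdf k \<tau> (- y)) =
      (LINT z|lebesgue. f z * \<theta> z) - (LINT z|lebesgue. f z) / a * heat_cdf k \<tau> (- y)"
    using f f\<theta> by (subst Bochner_Integration.integral_diff) auto
  finally show "\<bar>(LINT x|lebesgue. (\<Sum>n. f (x + real n * a)) * ?h (x - y)) -
      (LINT x|lebesgue. f x) / a * heat_cdf k \<tau> (- y)\<bar> \<le>
      ?h 0 * (2 * (LINT x|lebesgue. f x) + (LINT x|lebesgue. \<bar>x * f x\<bar>) / a)"
    unfolding eq by (simp add: algebra_simps)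
qed

lemma lebesgue_reflect:
  fixes h :: "real \<Rightarrow> real"
  assumes [measurable]: "h \<in> borel_measurable lebesgue"
  shows "(\<lambda>x. h (- x)) \<in> borel_measurable lebesgue"
    and "integrable lebesgue (\<lambda>x. h (- x)) \<longleftrightarrow> integrable lebesgue h"
    and "(LINT x|lebesgue. h (- x)) = (LINT x|lebesgue. h x)"
proof -
  have m: "(\<lambda>x::real. - x) \<in> lebesgue \<rightarrow>\<^sub>M lebesgue"
    using lebesgue_affine_measurable[of "\<lambda>_. - 1" "0::real"] by simp
  have d: "distr lebesgue lebesgue (\<lambda>x::real. - x) = lebesgue"
    using lebesgue_real_affine[of "- 1" 0] by (simp add: density_1)
  show "(\<lambda>x. h (- x)) \<in> borel_measurable lebesgue"
    using measurable_compose[OF m assms] by simp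
  show "integrable lebesgue (\<lambda>x. h (- x)) \<longleftrightarrow> integrable lebesgue h"
    using integrable_distr_eq[OF m assms] d by simp
  show "(LINT x|lebesgue. h (- x)) = (LINT x|lebesgue. h x)"
    using integral_distr[OF m assms] d by simp
qed

text \<open>The right phase is reflected at the origin, so that the unfolding of a function
  supported on the left covers both phases. Evenness of the kernel brings the reflected integral
  back, with centre \<open>- y\<close> in place of \<open>y\<close>.\<close>

lemma initial_datum_heat_average:
  assumes "k > 0" "a > 0" and "integrable lebesgue f" "integrable lebesgue (\<lambda>x. x * f x)"
    and sgn: "\<forall>x<0. f x \<ge> 0" "f 0 = 0" "\<forall>x>0. f x \<le> 0"
    and Ml: "Ml = (LINT x|lebesgue. pos_part (f x))" and Mr: "Mr = (LINT x|lebesgue. neg_part (f x))"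
  shows "initial_datum a f \<in> borel_measurable lebesgue"
    and "\<exists>K. \<forall>\<tau>>0. \<forall>y. \<bar>(LINT x|lebesgue. initial_datum a f x * heat_kernel k \<tau> (x - y)) -
      (Ml / a * (1 - heat_cdf k \<tau> y) - Mr / a * heat_cdf k \<tau> y)\<bar> \<le> K / sqrt \<tau>"
proof -
  define u where "u x = pos_part (f x)" for x
  define v where "v x = neg_part (f x)" for x
  define v' where "v' x = v (- x)" for x
  have fm [measurable]: "f \<in> borel_measurable lebesgue" using assms(3) by auto
  have idm [measurable]: "(\<lambda>x::real. x) \<in> borel_measurable lebesgue"
    by (rule measurable_completion) simp
  have um [measurable]: "u \<in> borel_measurable lebesgue" unfolding u_def pos_part_def by measurable
  have vm [measurable]: "v \<in> borel_measurable lebesgue" unfolding v_def neg_part_def by measurable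
  have v'm [measurable]: "v' \<in> borel_measurable lebesgue"
    unfolding v'_def using lebesgue_reflect(1)[OF vm] .
  have u: "integrable lebesgue u" "integrable lebesgue (\<lambda>x. x * u x)"
  proof -
    have le: "\<bar>u x\<bar> \<le> \<bar>f x\<bar>" for x by (auto simp: u_def pos_part_def)
    show "integrable lebesgue u"
      by (rule Bochner_Integration.integrable_bound[OF assms(3) um]) (use le in auto)
    show "integrable lebesgue (\<lambda>x. x * u x)"
    proof (rule Bochner_Integration.integrable_bound[OF assms(4)])
      show "AE x in lebesgue. norm (x * u x) \<le> norm (x * f x)"
        using le by (auto simp: abs_mult intro!: mult_left_mono)
    qed measurable
  qed
  have v: "integrable lebesgue v" "integrable lebesgue (\<lambda>x. x * v x)"
  proof -
    have le: "\<bar>v x\<bar> \<le> \<bar>f x\<bar>" for x by (auto simp: v_def neg_part_def)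
    show "integrable lebesgue v"
      by (rule Bochner_Integration.integrable_bound[OF assms(3) vm]) (use le in auto)
    show "integrable lebesgue (\<lambda>x. x * v x)"
    proof (rule Bochner_Integration.integrable_bound[OF assms(4)])
      show "AE x in lebesgue. norm (x * v x) \<le> norm (x * f x)"
        using le by (auto simp: abs_mult intro!: mult_left_mono)
    qed measurable
  qed
  have v': "integrable lebesgue v'"
    using v(1) lebesgue_reflect(2)[OF vm] by (simp add: v'_def[abs_def])
  have xv': "integrable lebesgue (\<lambda>x. x * v' x)"
  proof -
    have "(\<lambda>x. x * v x) \<in> borel_measurable lebesgue" by measurable
    from lebesgue_reflect(2)[OF this] v(2) have "integrable lebesgue (\<lambda>x. - x * v (- x))" by simp
    then have "integrable lebesgue (\<lambda>x. - (- x * v (- x)))" by (rule Bochner_Integration.integrable_minus)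
    then show ?thesis by (simp add: v'_def[abs_def])
  qed
  have intv': "(LINT x|lebesgue. v' x) = Mr"
    unfolding v'_def Mr using lebesgue_reflect(3)[OF vm] by (simp add: v_def)
  have u_nonneg: "u x \<ge> 0" and v'_nonneg: "v' x \<ge> 0" for x
    by (auto simp: u_def v'_def v_def pos_part_def neg_part_def)
  have u0: "u x = 0" if "x \<ge> 0" for x
    using that sgn(2) sgn(3)[rule_format, of x] by (cases "x = 0") (simp_all add: u_def pos_part_def)
  have v0: "v x = 0" if "x \<le> 0" for x
    using that sgn(2) sgn(1)[rule_format, of x] by (cases "x = 0") (simp_all add: v_def neg_part_def)
  then have v'0: "v' x = 0" if "x \<ge> 0" for x using that by (simp add: v'_def)
  define U where "U x = (\<Sum>n. u (x + real n * a))" for x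
  define V where "V x = (\<Sum>n. v' (x + real n * a))" for x
  \<comment> \<open>Each series vanishes on the half line of the other one, and both vanish at 0, in
    accordance with the value that \<open>initial_datum\<close> takes there.\<close>
  have datum: "initial_datum a f x = U x - V (- x)" for x
  proof -
    have U0: "U x = 0" if "x \<ge> 0" using that u0 \<open>a > 0\<close> by (simp add: U_def)
    have V0: "V (- x) = 0" if "x \<le> 0"
    proof -
      have "v' (- x + real n * a) = 0" for n
        using that \<open>a > 0\<close> by (intro v'0 add_nonneg_nonneg) auto
      then show ?thesis unfolding V_def by (simp only: suminf_zero)
    qed
    have "V (- x) = (\<Sum>n. neg_part (f (x - real n * a)))" by (simp add: V_def v'_def v_def)
    then show ?thesis using U0 V0 by (auto simp: initial_datum_def U_def u_def)
  qed
  note pU = periodised_heat_average[OF assms(1) _ assms(2) u u_nonneg u0]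
  note pV = periodised_heat_average[OF assms(1) _ assms(2) v' xv' v'_nonneg v'0]
  have shift: "(\<lambda>x. x + c) \<in> lebesgue \<rightarrow>\<^sub>M lebesgue" for c :: real
    using lebesgue_affine_measurable[of "\<lambda>_. 1" c] by (simp add: add.commute)
  have [measurable]: "U \<in> borel_measurable lebesgue"
    unfolding U_def using measurable_compose[OF shift um] by (intro borel_measurable_suminf) simp
  have Vm [measurable]: "V \<in> borel_measurable lebesgue"
    unfolding V_def using measurable_compose[OF shift v'm] by (intro borel_measurable_suminf) simp
  have Vr [measurable]: "(\<lambda>x. V (- x)) \<in> borel_measurable lebesgue"
    by (rule lebesgue_reflect(1)[OF Vm])
  show "initial_datum a f \<in> borel_measurable lebesgue"
    unfolding datum[abs_def] by measurable
  have hm [measurable]: "(\<lambda>x. heat_kernel k \<tau> (x - c)) \<in> borel_measurable lebesgue" for \<tau> c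
    by (rule measurable_completion) (simp add: heat_kernel_def)
  define N where "N = 2 * Ml + (LINT x|lebesgue. \<bar>x * u x\<bar>) / a + (2 * Mr + (LINT x|lebesgue. \<bar>x * v' x\<bar>) / a)"
  have "\<bar>(LINT x|lebesgue. initial_datum a f x * heat_kernel k \<tau> (x - y)) -
      (Ml / a * (1 - heat_cdf k \<tau> y) - Mr / a * heat_cdf k \<tau> y)\<bar> \<le> N / sqrt (4 * pi * k) / sqrt \<tau>"
    if "\<tau> > 0" for \<tau> y
  proof -
    let ?h = "heat_kernel k \<tau>"
    have 1: "\<bar>(LINT x|lebesgue. U x * ?h (x - y)) - Ml / a * (1 - heat_cdf k \<tau> y)\<bar>
        \<le> ?h 0 * (2 * Ml + (LINT x|lebesgue. \<bar>x * u x\<bar>) / a)"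
      using pU(3)[OF \<open>\<tau> > 0\<close>, of y] by (simp add: U_def[symmetric] heat_cdf_minus Ml u_def[symmetric])
    have 2: "\<bar>(LINT x|lebesgue. V x * ?h (x + y)) - Mr / a * heat_cdf k \<tau> y\<bar>
        \<le> ?h 0 * (2 * Mr + (LINT x|lebesgue. \<bar>x * v' x\<bar>) / a)"
      using pV(3)[OF \<open>\<tau> > 0\<close>, of "- y"] by (simp add: V_def[symmetric] intv')
    have iU: "integrable lebesgue (\<lambda>x. U x * ?h (x - y))"
      using pU(2)[OF \<open>\<tau> > 0\<close>, of y] by (simp add: U_def[symmetric])
    have ev: "?h (- x + y) = ?h (x - y)" for x
      using heat_kernel_even[of k \<tau> "x - y"] by (simp add: algebra_simps)
    have m: "(\<lambda>x. V x * ?h (x + y)) \<in> borel_measurable lebesgue"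
      using hm[of \<tau> "- y"] by (simp add: borel_measurable_times)
    have "integrable lebesgue (\<lambda>x. V x * ?h (x + y))"
      using pV(2)[OF \<open>\<tau> > 0\<close>, of "- y"] by (simp add: V_def[symmetric])
    with lebesgue_reflect(2,3)[OF m]
    have iV: "integrable lebesgue (\<lambda>x. V (- x) * ?h (x - y))"
      and 3: "(LINT x|lebesgue. V (- x) * ?h (x - y)) = (LINT x|lebesgue. V x * ?h (x + y))"
      unfolding ev by simp_all
    have "(LINT x|lebesgue. initial_datum a f x * ?h (x - y)) =
        (LINT x|lebesgue. U x * ?h (x - y)) - (LINT x|lebesgue. V x * ?h (x + y))"
      unfolding datum left_diff_distrib 3[symmetric] by (rule Bochner_Integration.integral_diff[OF iU iV])
    then have "\<bar>(LINT x|lebesgue. initial_datum a f x * ?h (x - y)) -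
      (Ml / a * (1 - heat_cdf k \<tau> y) - Mr / a * heat_cdf k \<tau> y)\<bar> \<le> ?h 0 * N"
      using 1 2 unfolding N_def distrib_left by linarith
    also have "?h 0 * N = N / sqrt (4 * pi * k) / sqrt \<tau>"
      by (simp add: heat_kernel_def real_sqrt_mult)
    finally show ?thesis .
  qed
  then show "\<exists>K. \<forall>\<tau>>0. \<forall>y. \<bar>(LINT x|lebesgue. initial_datum a f x * heat_kernel k \<tau> (x - y)) -
      (Ml / a * (1 - heat_cdf k \<tau> y) - Mr / a * heat_cdf k \<tau> y)\<bar> \<le> K / sqrt \<tau>" by blast
qed

text \<open>A nonzero limit d would keep \<open>\<bar>b\<bar>\<close> above
  \<open>\<bar>d\<bar> / 2\<close> on a whole ray, which has infinite measure. Applied to half the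
  difference of \<open>bl\<close> and \<open>br\<close>, this identifies their limits.\<close>

lemma L1_half_line_limit_0:
  assumes "L1 {0<..} b" and lim: "(b \<longlongrightarrow> d) at_top"
  shows "d = 0"
proof (rule ccontr)
  assume "d \<noteq> 0"
  define e where "e = \<bar>d\<bar> / 2"
  have "e > 0" using \<open>d \<noteq> 0\<close> by (simp add: e_def)
  have "\<forall>\<^sub>F t in at_top. \<bar>b t - d\<bar> < e"
    using tendstoD[OF lim \<open>e > 0\<close>] by (simp add: dist_real_def)
  then obtain n0 where n0: "\<And>t. t \<ge> n0 \<Longrightarrow> \<bar>b t - d\<bar> < e" by (auto simp: eventually_at_top_linorder)
  define n where "n = max n0 1"
  have big: "e \<le> \<bar>b t\<bar>" if "t \<ge> n" for t
    using n0[of t] that unfolding e_def n_def by (simp add: abs_if split: if_splits)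
  have "integrable lebesgue (\<lambda>t. indicator {0<..} t *\<^sub>R b t)"
    using assms(1) unfolding L1_def by (subst (asm) integrable_restrict_space) auto
  then have "integrable lebesgue (\<lambda>t. indicator {n..} t * e)"
  proof (rule Bochner_Integration.integrable_bound)
    show "AE t in lebesgue. norm (indicator {n..} t * e) \<le> norm (indicator {0<..} t *\<^sub>R b t)"
      using big \<open>e > 0\<close> by (intro AE_I2) (auto simp: indicator_def n_def)
  qed (rule borel_measurable_times borel_measurable_indicator | simp)+
  then have "integrable lebesgue (\<lambda>t. indicator {n..} t * e * (1 / e))"
    by (rule integrable_mult_left)
  then have "integrable lebesgue (indicator {n..} :: real \<Rightarrow> real)" using \<open>e > 0\<close> by simp
  then have fin: "emeasure lebesgue {n..} < \<infinity>" by (subst (asm) integrable_indicator_iff) auto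
  obtain r where r: "r \<ge> 0" "emeasure lebesgue {n..} = ennreal r"
    using fin by (cases "emeasure lebesgue {n..}") auto
  obtain m :: nat where "r < real m" using reals_Archimedean2 by blast
  have "ennreal (real m) = emeasure lebesgue {n..n + real m}" by simp
  also have "\<dots> \<le> ennreal r" unfolding r(2)[symmetric] by (rule emeasure_mono) auto
  finally show False using \<open>r < real m\<close> r(1) by simp
qed

section \<open>Solutions with a free boundary\<close>

lemma abs_exp_uminus_diff_le:
  fixes u v A :: real
  assumes "\<bar>u\<bar> \<le> A" "\<bar>v\<bar> \<le> A"
  shows "\<bar>exp (- u) - exp (- v)\<bar> \<le> exp A * \<bar>u - v\<bar>"
proof -
  have *: "exp (- a) - exp (- b) \<le> exp A * (b - a)" if "a \<le> b" "\<bar>a\<bar> \<le> A" for a b :: real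
  proof -
    have "1 - exp (a - b) \<le> b - a" using exp_ge_add_one_self[of "a - b"] by linarith
    then have "exp (- a) * (1 - exp (a - b)) \<le> exp A * (b - a)"
      using that by (intro mult_mono) auto
    then show ?thesis by (simp add: algebra_simps flip: exp_add)
  qed
  show ?thesis
  proof (cases "u \<le> v")
    case True
    then have "exp (- u) \<ge> exp (- v)" by simp
    then show ?thesis using *[OF True assms(1)] True by simp
  next
    case False
    then have "exp (- v) \<ge> exp (- u)" by simp
    then show ?thesis using *[of v u] assms(2) False by simp
  qed
qed

lemma lipschitz_ae_deriv_bound:
  assumes lip: "L-lipschitz_on {0..} h" and h: "ae_time_derivative h h'"
  shows "AE t in lebesgue. t > 0 \<longrightarrow> \<bar>h' t\<bar> \<le> L"
  using h unfolding ae_time_derivative_def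
proof eventually_elim
  case (elim t)
  show ?case
  proof
    assume "t > 0"
    then have "((\<lambda>y. (h y - h t) / (y - t)) \<longlongrightarrow> h' t) (at t)"
      using elim by (simp add: has_field_derivative_iff)
    then have "((\<lambda>y. \<bar>(h y - h t) / (y - t)\<bar>) \<longlongrightarrow> \<bar>h' t\<bar>) (at t)" by (rule tendsto_rabs)
    moreover have "\<forall>\<^sub>F y in at t. \<bar>(h y - h t) / (y - t)\<bar> \<le> L"
    proof -
      have "\<forall>\<^sub>F y in at t. y \<in> {0<..} - {t}"
        using \<open>t > 0\<close> by (intro eventually_at_in_open) auto
      then show ?thesis
      proof eventually_elim
        case (elim y)
        then have "\<bar>h y - h t\<bar> \<le> L * \<bar>y - t\<bar>"
          using lipschitz_onD[OF lip, of y t] \<open>t > 0\<close> by (simp add: dist_real_def)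
        then show ?case using elim by (simp add: abs_divide divide_le_eq)
      qed
    qed
    ultimately show "\<bar>h' t\<bar> \<le> L" by (rule tendsto_upperbound) simp
  qed
qed

text \<open>The existential witnesses \<open>Fx\<close> and \<open>Fxx\<close> are fixed and one
  Lipschitz constant serves both coefficients. The initial datum is left out: the results below see
  it only through \<open>F x 0\<close>.\<close>

locale fb_solution =
  fixes k L :: real and bl br bl' br' :: "real \<Rightarrow> real" and F Fx Fxx :: "real \<Rightarrow> real \<Rightarrow> real"
    and p :: "real \<Rightarrow> real"
  assumes k_pos: "k > 0"
    and bl_lip: "L-lipschitz_on {0..} bl" and br_lip: "L-lipschitz_on {0..} br"
    and bl_deriv: "ae_time_derivative bl bl'" and br_deriv: "ae_time_derivative br br'"
    and F_cont: "continuous_on (UNIV \<times> {0..}) (\<lambda>(x, t). F x t)"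
    and F_bdd: "\<And>T. T > 0 \<Longrightarrow> \<exists>C. \<forall>x. \<forall>t\<in>{0..T}. \<bar>F x t\<bar> \<le> C"
    and F_lip: "\<And>x s T. s > 0 \<Longrightarrow> T > s \<Longrightarrow> \<exists>L. L-lipschitz_on {s..T} (\<lambda>t. F x t)"
    and Fx: "\<And>x t. t > 0 \<Longrightarrow> ((\<lambda>y. F y t) has_real_derivative Fx x t) (at x)"
    and Fxx: "\<And>x t. t > 0 \<Longrightarrow> ((\<lambda>y. Fx y t) has_real_derivative Fxx x t) (at x)"
    and Fxx_cont: "continuous_on (UNIV \<times> {0<..}) (\<lambda>(x, t). Fxx x t)"
    and F_eq: "\<And>x. AE t in lebesgue. t > 0 \<longrightarrow>
           ((\<lambda>t. F x t) has_real_derivative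
              (k * Fxx x t + bl' t * pos_part (F x t) - br' t * neg_part (F x t))) (at t)"
    and F_p: "\<And>t. t > 0 \<Longrightarrow> F (p t) t = 0"
    and F_pos: "\<And>t x. t > 0 \<Longrightarrow> x < p t \<Longrightarrow> F x t > 0"
    and F_neg: "\<And>t x. t > 0 \<Longrightarrow> x > p t \<Longrightarrow> F x t < 0"
begin

definition "source x t = bl' t * pos_part (F x t) - br' t * neg_part (F x t)"

lemma source_bound: "AE t in lebesgue. t > 0 \<longrightarrow> (\<forall>x. \<bar>source x t\<bar> \<le> L * \<bar>F x t\<bar>)"
  using lipschitz_ae_deriv_bound[OF bl_lip bl_deriv] lipschitz_ae_deriv_bound[OF br_lip br_deriv]
proof eventually_elim
  case (elim t)
  have "\<bar>source x t\<bar> \<le> L * \<bar>F x t\<bar>" if "t > 0" for x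
  proof (cases "F x t \<ge> 0")
    case True
    then have "source x t = bl' t * F x t" by (simp add: source_def pos_part_def neg_part_def)
    then show ?thesis using elim that by (simp add: abs_mult mult_right_mono)
  next
    case False
    then have "source x t = br' t * F x t" by (simp add: source_def pos_part_def neg_part_def)
    then show ?thesis using elim that by (simp add: abs_mult mult_right_mono)
  qed
  then show ?case by blast
qed

lemma F_cont_comp [continuous_intros]:
  assumes "continuous_on S f" "continuous_on S g" "\<And>z. z \<in> S \<Longrightarrow> g z \<ge> 0"
  shows "continuous_on S (\<lambda>z. F (f z) (g z))"
  using continuous_on_compose2[OF F_cont continuous_on_Pair[OF assms(1,2)]] assms(3) by auto

lemma Fxx_cont_comp [continuous_intros]:
  assumes "continuous_on S f" "continuous_on S g" "\<And>z. z \<in> S \<Longrightarrow> g z > 0"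
  shows "continuous_on S (\<lambda>z. Fxx (f z) (g z))"
  using continuous_on_compose2[OF Fxx_cont continuous_on_Pair[OF assms(1,2)]] assms(3) by auto

section \<open>Gradient bound by odd reflection and a barrier\<close>

lemma reflection_derivs:
  assumes "t > 0"
  shows "((\<lambda>x. F (2 * c - x) t) has_real_derivative - Fx (2 * c - x) t) (at x)"
    and "((\<lambda>x. Fx (2 * c - x) t) has_real_derivative - Fxx (2 * c - x) t) (at x)"
proof -
  have "((\<lambda>x. 2 * c - x) has_real_derivative - 1) (at x)" by (auto intro!: derivative_eq_intros)
  from DERIV_chain2[where f = "\<lambda>y. F y t" and g = "\<lambda>x. 2 * c - x", OF Fx[OF assms] this]
    DERIV_chain2[where f = "\<lambda>y. Fx y t" and g = "\<lambda>x. 2 * c - x", OF Fxx[OF assms] this]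
  show "((\<lambda>x. F (2 * c - x) t) has_real_derivative - Fx (2 * c - x) t) (at x)"
    "((\<lambda>x. Fx (2 * c - x) t) has_real_derivative - Fxx (2 * c - x) t) (at x)" by simp_all
qed

text \<open>The odd reflection of \<open>F\<close> about \<open>c\<close> vanishes at \<open>c\<close>, so that an explicit parabolic
  barrier on one side of \<open>c\<close> bounds its slope there.\<close>

lemma Fx_barrier:
  assumes M: "\<And>x t. t \<in> {0..T} \<Longrightarrow> \<bar>F x t\<bar> \<le> M"
    and \<tau>: "0 < \<tau>" "\<tau> < T" and "r > 0" and B: "k * B > M / \<tau> + L * M" "B * r\<^sup>2 \<ge> 2 * M"
    and \<sigma>: "\<bar>\<sigma>\<bar> = 1"
  shows "\<sigma> * Fx c T \<le> B * r"
proof -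
  define t0 where "t0 = T - \<tau>"
  have t0: "0 < t0" "t0 < T" using \<tau> by (auto simp: t0_def)
  have "\<bar>F c T\<bar> \<le> M" using M[of T] t0 by auto
  then have "M \<ge> 0" by linarith
  have "L \<ge> 0" using lipschitz_on_nonneg[OF bl_lip] .
  have "k * B > 0" using B(1) \<open>M \<ge> 0\<close> \<open>L \<ge> 0\<close> \<tau> by (smt (verit) divide_nonneg_pos mult_nonneg_nonneg)
  then have "B > 0" using k_pos by (simp add: zero_less_mult_iff)
  define Q where "Q x t = \<sigma> * (F x t - F (2 * c - x) t)" for x t
  \<comment> \<open>The parabola vanishes at c with slope \<open>2 * B * r\<close>, equals
    \<open>B * r\<^sup>2\<close> at \<open>c + r\<close>, and has second derivative
    \<open>- 2 * B\<close>. The last term equals \<open>2 * M\<close> at the initial time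
    \<open>t0\<close> and vanishes at T. So the barrier dominates \<open>Q\<close> on the bottom and
    on both lateral sides of the rectangle.\<close>
  define E where "E x t = Q x t - (B * (x - c) * (2 * r - (x - c)) + 2 * M * (T - t) / \<tau>)" for x t
  have Q2M: "Q x t \<le> 2 * M" if "t \<in> {0..T}" for x t
  proof -
    have "\<bar>Q x t\<bar> \<le> 2 * M" using M[OF that, of x] M[OF that, of "2 * c - x"] \<sigma>
      by (auto simp: Q_def abs_mult)
    then show ?thesis by linarith
  qed
  have Econt: "continuous_on ({c..c+r} \<times> {t0..T}) (\<lambda>(x, t). E x t)"
    unfolding E_def Q_def split_beta using t0 \<tau>
    by (auto intro!: continuous_intros)
  have E_le: "E x t \<le> 0" if "x \<in> {c..c+r}" "t \<in> {t0..T}" for x t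
  proof (rule ccontr)
    assume "\<not> E x t \<le> 0"
    have "compact ({c..c+r} \<times> {t0..T})" "{c..c+r} \<times> {t0..T} \<noteq> {}"
      using that by (auto intro!: compact_Times)
    from continuous_attains_sup[OF this Econt]
    obtain x0 s0 where z: "(x0, s0) \<in> {c..c+r} \<times> {t0..T}"
      "\<forall>y\<in>{c..c+r} \<times> {t0..T}. (\<lambda>(x, t). E x t) y \<le> E x0 s0"
      by (auto simp: Ball_def)
    have x0: "c \<le> x0" "x0 \<le> c + r" and s0: "t0 \<le> s0" "s0 \<le> T" using z(1) by auto
    have max: "E y u \<le> E x0 s0" if "y \<in> {c..c+r}" "u \<in> {t0..T}" for y u
      using bspec[OF z(2), of "(y, u)"] that by auto
    have pos: "E x0 s0 > 0" using max[OF that] \<open>\<not> E x t \<le> 0\<close> by simp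
    have par: "B * (x0 - c) * (2 * r - (x0 - c)) \<ge> 0" using x0 \<open>B > 0\<close> by simp
    have tim: "2 * M * (T - s0) / \<tau> \<ge> 0" using s0 \<open>M \<ge> 0\<close> \<tau> by simp
    have "x0 \<noteq> c" using pos tim by (auto simp: E_def Q_def)
    moreover have "x0 \<noteq> c + r"
    proof
      assume "x0 = c + r"
      then have "E x0 s0 = Q x0 s0 - (B * r\<^sup>2 + 2 * M * (T - s0) / \<tau>)"
        by (simp add: E_def power2_eq_square)
      then show False using pos tim B(2) Q2M[of s0 x0] s0 t0 by auto
    qed
    moreover have "s0 \<noteq> t0"
    proof
      assume "s0 = t0"
      then have "2 * M * (T - s0) / \<tau> = 2 * M" using \<tau> by (simp add: t0_def)
      then show False using pos par Q2M[of s0 x0] s0 t0 by (auto simp: E_def)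
    qed
    ultimately have x0': "c < x0" "x0 < c + r" and s0': "t0 < s0" "s0 > 0" using x0 s0 t0 by auto
    \<comment> \<open>The second space derivative of \<open>E\<close> at \<open>x0\<close>, as a
      function of time. The equation may fail at the time \<open>s0\<close> itself, so the sign of
      \<open>e s0\<close> is spread to nearby times by continuity of \<open>Fxx\<close>, and the
      time derivative is then integrated over a short interval.\<close>
    define e where "e s = \<sigma> * (Fxx x0 s - Fxx (2 * c - x0) s) + 2 * B" for s
    have "e s0 \<le> 0"
    proof (rule local_max_second_deriv_le_0)
      show "0 < min (x0 - c) (c + r - x0)" using x0' by auto
      note D1 = reflection_derivs(1)[OF s0'(2)] and D2 = reflection_derivs(2)[OF s0'(2)]
      show "((\<lambda>x. E x s0) has_real_derivative
          \<sigma> * (Fx x s0 + Fx (2 * c - x) s0) - B * (2 * r - 2 * (x - c))) (at x)" for x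
        unfolding E_def Q_def
        by (rule derivative_eq_intros Fx[OF s0'(2)] D1 refl)+ (simp add: algebra_simps)
      show "((\<lambda>x. \<sigma> * (Fx x s0 + Fx (2 * c - x) s0) - B * (2 * r - 2 * (x - c)))
          has_real_derivative e s0) (at x0)"
        unfolding e_def
        by (rule derivative_eq_intros Fxx[OF s0'(2)] D2 refl)+ (simp add: algebra_simps)
      show "E x s0 \<le> E x0 s0" if "\<bar>x - x0\<bar> < min (x0 - c) (c + r - x0)" for x
        using that s0 by (intro max) auto
    qed
    \<comment> \<open>Twice the slack in the first condition on \<open>B\<close>. Half of it absorbs
      the variation of \<open>k * e\<close>; the other half makes \<open>E x0\<close> strictly
      decreasing.\<close>
    define \<delta> where "\<delta> = 2 * (k * B - M / \<tau> - L * M)"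
    have "\<delta> > 0" using B(1) by (simp add: \<delta>_def)
    have "continuous_on {0<..} e"
      unfolding e_def by (auto intro!: continuous_intros)
    then have "isCont e s0" using s0'(2) by (simp add: continuous_on_eq_continuous_at)
    then have "((\<lambda>s. k * e s) \<longlongrightarrow> k * e s0) (at s0)"
      by (intro tendsto_intros) (simp add: isCont_def)
    moreover have "k * e s0 < \<delta> / 2" using \<open>e s0 \<le> 0\<close> k_pos \<open>\<delta> > 0\<close>
      by (smt (verit) mult_nonneg_nonpos half_gt_zero)
    ultimately have "\<forall>\<^sub>F s in at s0. k * e s < \<delta> / 2" by (rule order_tendstoD)
    then obtain \<eta> where \<eta>: "\<eta> > 0" "\<And>s. s \<noteq> s0 \<Longrightarrow> dist s s0 < \<eta> \<Longrightarrow> k * e s < \<delta> / 2"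
      by (auto simp: eventually_at)
    \<comment> \<open>Only times before \<open>s0\<close> are used, because the maximum may lie on
      the top side \<open>s0 = T\<close>.\<close>
    define s1 where "s1 = s0 - min (\<eta> / 2) (s0 - t0)"
    have s1: "s1 < s0" "t0 \<le> s1" "s0 - s1 < \<eta>" using \<eta>(1) s0' by (auto simp: s1_def min_def)
    obtain L1 where L1: "L1-lipschitz_on {s1..s0} (\<lambda>t. F x0 t)"
      using F_lip[of s1 s0] s1 t0 by auto
    obtain L2 where L2: "L2-lipschitz_on {s1..s0} (\<lambda>t. F (2 * c - x0) t)"
      using F_lip[of s1 s0] s1 t0 by auto
    have "\<exists>L3. L3-lipschitz_on {s1..s0} (E x0)"
    proof -
      have "E x0 = (\<lambda>t. \<sigma> * (F x0 t - F (2 * c - x0) t) -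
          (B * (x0 - c) * (2 * r - (x0 - c)) + (2 * M / \<tau>) * (T - t)))"
        by (auto simp: E_def Q_def)
      show ?thesis
        unfolding \<open>E x0 = _\<close>
        by (rule exI, rule lipschitz_on_diff[OF lipschitz_on_cmult_real[OF lipschitz_on_diff[OF L1 L2]]
             lipschitz_on_add[OF lipschitz_on_constant lipschitz_on_cmult_real[OF
               lipschitz_on_diff[OF lipschitz_on_constant lipschitz_on_id]]]])
    qed
    then obtain L3 where L3: "L3-lipschitz_on {s1..s0} (E x0)" ..
    have "AE t in lebesgue. s1 < t \<and> t < s0 \<longrightarrow> (\<exists>d\<le>- \<delta> / 2. (E x0 has_real_derivative d) (at t))"
      using F_eq[of x0] F_eq[of "2 * c - x0"] source_bound
    proof eventually_elim
      case (elim t)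
      show ?case
      proof
        assume t: "s1 < t \<and> t < s0"
        then have "t > 0" "t \<in> {0..T}" using s1 t0 s0 by auto
        let ?d = "\<sigma> * ((k * Fxx x0 t + source x0 t) - (k * Fxx (2 * c - x0) t + source (2 * c - x0) t)) + 2 * M / \<tau>"
        have "(E x0 has_real_derivative ?d) (at t)"
          unfolding E_def Q_def using elim \<open>t > 0\<close> \<tau>
          by (auto intro!: derivative_eq_intros simp: source_def algebra_simps)
        moreover have "?d \<le> - \<delta> / 2"
        proof -
          have b: "\<bar>source x t\<bar> \<le> L * M" for x
            using elim(3)[rule_format, OF \<open>t > 0\<close>, of x]
              mult_left_mono[OF M[OF \<open>t \<in> {0..T}\<close>, of x] \<open>L \<ge> 0\<close>] by (rule order_trans)
          have "\<bar>\<sigma> * (source x0 t - source (2 * c - x0) t)\<bar> \<le> 2 * (L * M)"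
            using b[of x0] b[of "2 * c - x0"] \<sigma> by (auto simp: abs_mult)
          moreover have "?d = k * e t - 2 * k * B + \<sigma> * (source x0 t - source (2 * c - x0) t) + 2 * M / \<tau>"
            by (simp add: e_def algebra_simps)
          moreover have "k * e t < \<delta> / 2" using \<eta>(2)[of t] t s1 by (auto simp: dist_real_def)
          moreover have "2 * M / \<tau> = 2 * (M / \<tau>)" by simp
          ultimately show ?thesis unfolding \<delta>_def abs_le_iff by argo
        qed
        ultimately show "\<exists>d\<le>- \<delta> / 2. (E x0 has_real_derivative d) (at t)" by blast
      qed
    qed
    from lipschitz_AE_deriv_le_imp_diff_le[OF L3 _ this]
    have "E x0 s0 - E x0 s1 \<le> - \<delta> / 2 * (s0 - s1)" using s1 by simp
    moreover have "- \<delta> / 2 * (s0 - s1) < 0" using \<open>\<delta> > 0\<close> s1 by (simp add: mult_neg_pos)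
    moreover have "E x0 s1 \<le> E x0 s0" using x0 s1 s0 by (intro max) auto
    ultimately show False by linarith
  qed
  show ?thesis
  proof (rule ccontr)
    assume neg: "\<not> ?thesis"
    \<comment> \<open>At time T the barrier lies below its tangent at c and touches \<open>Q\<close>
      there, so a steeper slope of \<open>Q\<close> at c would push \<open>Q\<close> above the
      barrier.\<close>
    define h where "h x = Q x T - 2 * B * r * (x - c)" for x
    have "T > 0" using t0 by simp
    note D1 = reflection_derivs(1)[OF \<open>T > 0\<close>]
    have "(h has_real_derivative (2 * (\<sigma> * Fx c T - B * r))) (at c)"
      unfolding h_def Q_def
      by (rule derivative_eq_intros Fx[OF \<open>T > 0\<close>] D1 refl)+ (simp add: algebra_simps)
    then obtain d where d: "d > 0" "\<And>u. u > 0 \<Longrightarrow> u < d \<Longrightarrow> h c < h (c + u)"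
      using DERIV_pos_inc_right[of h _ c] neg by force
    define u where "u = min (d / 2) r"
    have u: "u > 0" "u < d" "u \<le> r" using d \<open>r > 0\<close> by (auto simp: u_def min_def)
    have "E (c + u) T \<le> 0" using u t0 by (intro E_le) auto
    then have "h (c + u) \<le> - B * u * u" by (simp add: E_def h_def algebra_simps)
    also have "\<dots> \<le> 0" using \<open>B > 0\<close> u by (simp add: mult_nonneg_nonneg)
    also have "0 = h c" by (simp add: h_def Q_def)
    finally show False using d(2)[OF u(1,2)] by simp
  qed
qed

text \<open>The two choices of the size of the rectangle: unit size for \<open>T \<ge> 1\<close>, parabolic scaling
  otherwise.\<close>

lemma abs_Fx_le:
  assumes M: "\<And>x t. t \<in> {0..T} \<Longrightarrow> \<bar>F x t\<bar> \<le> M" and "T > 0"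
  shows "T \<le> 1 \<Longrightarrow> \<bar>Fx c T\<bar> \<le> (2 * M + (2 * M + L * M) / k + 1) / sqrt T"
    and "T \<ge> 1 \<Longrightarrow> \<bar>Fx c T\<bar> \<le> 2 * M + (2 * M + L * M) / k + 1"
proof -
  \<comment> \<open>Large enough for both conditions of the barrier, with \<open>B = C\<close> and
    \<open>r = 1\<close> for late times and with \<open>B = C / T\<close> and
    \<open>r = sqrt T\<close> for early ones. It depends on T only through the bound
    \<open>M\<close>.\<close>
  define C where "C = 2 * M + (2 * M + L * M) / k + 1"
  have "\<bar>F c T\<bar> \<le> M" using M[of T] \<open>T > 0\<close> by auto
  then have "M \<ge> 0" by linarith
  have "L \<ge> 0" using lipschitz_on_nonneg[OF bl_lip] .
  have "C \<ge> 2 * M" using \<open>M \<ge> 0\<close> \<open>L \<ge> 0\<close> k_pos by (simp add: C_def)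
  have "k * C = 2 * k * M + (2 * M + L * M) + k" using k_pos by (simp add: C_def field_simps)
  then have kC: "k * C > 2 * M + L * M" using k_pos \<open>M \<ge> 0\<close> by (smt (verit) mult_nonneg_nonneg)
  have *: "\<bar>y\<bar> \<le> z" if "\<And>\<sigma>. \<bar>\<sigma>\<bar> = 1 \<Longrightarrow> \<sigma> * y \<le> z" for y z :: real
    using that[of 1] that[of "-1"] by auto
  { assume "T \<ge> 1"
    have "\<sigma> * Fx c T \<le> C * 1" if "\<bar>\<sigma>\<bar> = 1" for \<sigma>
      by (rule Fx_barrier[OF M, where \<tau> = "1/2"]) (use \<open>T \<ge> 1\<close> kC \<open>C \<ge> 2 * M\<close> that in auto)
    then show "\<bar>Fx c T\<bar> \<le> C" using * by simp }
  { assume "T \<le> 1"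
    have "\<sigma> * Fx c T \<le> (C / T) * sqrt T" if "\<bar>\<sigma>\<bar> = 1" for \<sigma>
    proof (rule Fx_barrier[OF M, where \<tau> = "T/2"])
      have LM: "L * M \<le> L * M / T"
        using \<open>T \<le> 1\<close> \<open>T > 0\<close> \<open>M \<ge> 0\<close> \<open>L \<ge> 0\<close>
          mult_left_mono[of T 1 "L * M"] by (simp add: le_divide_eq)
      have "M / (T / 2) = 2 * M / T" by simp
      have "M / (T / 2) + L * M \<le> (2 * M + L * M) / T"
        unfolding add_divide_distrib \<open>M / (T / 2) = _\<close> using LM by (rule add_left_mono)
      also have "\<dots> < k * C / T" using kC \<open>T > 0\<close> by (simp add: divide_strict_right_mono)
      finally show "M / (T / 2) + L * M < k * (C / T)" by simp
    qed (use \<open>T > 0\<close> \<open>C \<ge> 2 * M\<close> that in auto)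
    moreover have "(C / T) * sqrt T = C / sqrt T"
    proof -
      have "C / T * sqrt T = C * sqrt T / (sqrt T * sqrt T)" using \<open>T > 0\<close> by simp
      also have "\<dots> = C / sqrt T" using \<open>T > 0\<close> by (subst mult_divide_mult_cancel_right) auto
      finally show ?thesis .
    qed
    ultimately show "\<bar>Fx c T\<bar> \<le> C / sqrt T" using * by simp }
qed

section \<open>The two phases and the free boundary\<close>

lemma boundary_coeff_cont_comp:
  assumes "continuous_on S g" "\<And>z. z \<in> S \<Longrightarrow> g z \<ge> 0"
  shows "continuous_on S (\<lambda>z. bl (g z))" and "continuous_on S (\<lambda>z. br (g z))"
  using continuous_on_compose2[OF lipschitz_on_continuous_on[OF bl_lip] assms(1)]
    continuous_on_compose2[OF lipschitz_on_continuous_on[OF br_lip] assms(1)] assms(2)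
  by auto

text \<open>The integrating factor cancels the rough coefficient. What remains is a Lipschitz
  function of time whose almost everywhere derivative has a continuous representative, hence is
  attained at every time.\<close>

lemma exp_F_deriv:
  assumes hlip: "L-lipschitz_on {0..} h" and h: "ae_time_derivative h h'" and "t > 0"
    and src: "\<forall>\<^sub>F s in nhds t. source x s = h' s * F x s"
  shows "((\<lambda>s. exp (- h s) * F x s) has_real_derivative exp (- h t) * k * Fxx x t) (at t)"
proof -
  obtain d where d: "d > 0" "\<And>s. dist s t < d \<Longrightarrow> source x s = h' s * F x s"
    using src by (auto simp: eventually_nhds_metric)
  define a b where "a = t - min d t / 2" and "b = t + min d t / 2"
  have ab: "0 < a" "a < t" "t < b" and abd: "\<And>s. a \<le> s \<Longrightarrow> s \<le> b \<Longrightarrow> dist s t < d"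
    using d(1) \<open>t > 0\<close> by (auto simp: a_def b_def dist_real_def abs_less_iff)
  obtain L1 where L1: "L1-lipschitz_on {a..b} (\<lambda>s. F x s)" using F_lip[of a b x] ab by auto
  have hab: "L-lipschitz_on {a..b} h" by (rule lipschitz_on_subset[OF hlip]) (use ab in auto)
  obtain L2 where L2: "L2-lipschitz_on {a..b} (\<lambda>s. exp (- h s))"
    using lipschitz_on_exp_uminus[OF hab] by auto
  have bdd: "\<exists>A\<ge>0. \<forall>s\<in>{a..b}. \<bar>f s\<bar> \<le> A" if "C-lipschitz_on {a..b} f" for f :: "real \<Rightarrow> real" and C
  proof -
    have "bounded (f ` {a..b})"
      by (intro compact_imp_bounded compact_continuous_image lipschitz_on_continuous_on[OF that]) auto
    then obtain A where A: "\<forall>s\<in>{a..b}. \<bar>f s\<bar> \<le> A" by (auto simp: bounded_iff)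
    have "A \<ge> 0" using bspec[OF A, of t] ab by fastforce
    with A show ?thesis by blast
  qed
  obtain A1 where A1: "A1 \<ge> 0" "\<forall>s\<in>{a..b}. \<bar>F x s\<bar> \<le> A1" using bdd[OF L1] by auto
  obtain A2 where A2: "A2 \<ge> 0" "\<forall>s\<in>{a..b}. \<bar>exp (- h s)\<bar> \<le> A2" using bdd[OF L2] by auto
  have "(A2 * L1 + A1 * L2)-lipschitz_on {a..b} (\<lambda>s. exp (- h s) * F x s)"
    by (rule lipschitz_on_mult_bounded[OF L2 L1]) (use A1 A2 in auto)
  moreover have "continuous_on {a..b} (\<lambda>s. exp (- h s) * k * Fxx x s)"
    using ab lipschitz_on_continuous_on[OF hab] by (auto intro!: continuous_intros)
  moreover have "AE s in lebesgue. a < s \<and> s < b \<longrightarrow>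
      ((\<lambda>s. exp (- h s) * F x s) has_real_derivative exp (- h s) * k * Fxx x s) (at s)"
    using F_eq[of x] h[unfolded ae_time_derivative_def]
  proof eventually_elim
    case (elim s)
    show ?case
    proof
      assume s: "a < s \<and> s < b"
      then have "s > 0" using ab by auto
      have "source x s = h' s * F x s" using d(2)[OF abd] s by auto
      then have "((\<lambda>t. F x t) has_real_derivative k * Fxx x s + h' s * F x s) (at s)"
        using elim(1) \<open>s > 0\<close> by (simp add: source_def add_diff_eq[symmetric] del: add_diff_eq)
      moreover have "(h has_real_derivative h' s) (at s)" using elim(2) \<open>s > 0\<close> by simp
      ultimately show "((\<lambda>s. exp (- h s) * F x s) has_real_derivative exp (- h s) * k * Fxx x s) (at s)"
        by (auto intro!: derivative_eq_intros simp: algebra_simps)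
    qed
  qed
  ultimately show ?thesis
    by (rule lipschitz_AE_deriv_continuous_imp_deriv[OF _ ab(2,3)])
qed

text \<open>On each side of the free boundary \<open>exp (- b\<^sub>l) F\<close>, resp. \<open>exp (- b\<^sub>r) F\<close>, solves the
  heat equation classically.  The free weights on the two sides allow to
  treat the two phases separately as well as jointly.\<close>

definition "phases \<alpha> \<beta> x t =
  \<alpha> * exp (- bl t) * pos_part (F x t) - \<beta> * exp (- br t) * neg_part (F x t)"

definition "phase_coeff \<alpha> \<beta> x t = (if x < p t then \<alpha> * exp (- bl t) else \<beta> * exp (- br t))"

definition "coeff_bound \<alpha> \<beta> t = \<bar>\<alpha>\<bar> * exp (- bl t) + \<bar>\<beta>\<bar> * exp (- br t)"

lemma abs_phase_coeff_le: "\<bar>phase_coeff \<alpha> \<beta> x t\<bar> \<le> coeff_bound \<alpha> \<beta> t"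
  by (simp add: phase_coeff_def coeff_bound_def abs_mult)

lemma coeff_bound_nonneg: "coeff_bound \<alpha> \<beta> t \<ge> 0"
  by (simp add: coeff_bound_def)

lemma abs_phases_le: "\<bar>phases \<alpha> \<beta> x t\<bar> \<le> coeff_bound \<alpha> \<beta> t * \<bar>F x t\<bar>"
  by (cases "F x t \<ge> 0")
    (auto simp: phases_def coeff_bound_def pos_part_def neg_part_def abs_mult distrib_right
      intro: mult_nonneg_nonpos)

lemma F_sign_iff:
  assumes "t > 0"
  shows "F x t > 0 \<longleftrightarrow> x < p t" "F x t < 0 \<longleftrightarrow> x > p t" "F x t = 0 \<longleftrightarrow> x = p t"
  using F_p[OF assms] F_pos[OF assms, of x] F_neg[OF assms, of x]
  by (cases "x < p t"; cases "x = p t"; force)+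

lemma phases_eq: "t > 0 \<Longrightarrow> phases \<alpha> \<beta> x t = phase_coeff \<alpha> \<beta> x t * F x t"
  using F_sign_iff[of t x]
  by (cases "x < p t"; cases "x = p t") (auto simp: phases_def phase_coeff_def pos_part_def neg_part_def)

lemma phases_cont_comp [continuous_intros]:
  assumes "continuous_on S f" "continuous_on S g" "\<And>z. z \<in> S \<Longrightarrow> g z \<ge> 0"
  shows "continuous_on S (\<lambda>z. phases \<alpha> \<beta> (f z) (g z))"
  unfolding phases_def pos_part_def neg_part_def
  by (intro continuous_intros boundary_coeff_cont_comp F_cont_comp assms)

text \<open>Off the free boundary the sign of \<open>F x\<close> persists for nearby times, so the
  source is linear in \<open>F\<close> there and a single integrating factor suffices.\<close>

lemma phases_deriv:
  assumes "t > 0" "x \<noteq> p t"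
  shows "((\<lambda>s. phases \<alpha> \<beta> x s) has_real_derivative phase_coeff \<alpha> \<beta> x t * k * Fxx x t) (at t)"
proof -
  have cont: "continuous_on {0<..} (\<lambda>s. F x s)" by (auto intro!: continuous_intros)
  have "isCont (\<lambda>s. F x s) t" using cont \<open>t > 0\<close> by (simp add: continuous_on_eq_continuous_at)
  then have lim: "((\<lambda>s. F x s) \<longlongrightarrow> F x t) (nhds t)"
    by (simp add: isCont_def tendsto_at_iff_tendsto_nhds)
  show ?thesis
  proof (cases "x < p t")
    case True
    then have "\<forall>\<^sub>F s in nhds t. F x s > 0" using lim F_pos[OF \<open>t > 0\<close>] by (intro order_tendstoD)
    then have ev: "\<forall>\<^sub>F s in nhds t. source x s = bl' s * F x s \<and>
        \<alpha> * (exp (- bl s) * F x s) = phases \<alpha> \<beta> x s"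
      by eventually_elim (auto simp: source_def phases_def pos_part_def neg_part_def)
    then have "((\<lambda>s. exp (- bl s) * F x s) has_real_derivative exp (- bl t) * k * Fxx x t) (at t)"
      by (intro exp_F_deriv[OF bl_lip bl_deriv \<open>t > 0\<close>]) (auto elim: eventually_mono)
    from DERIV_cmult[OF this, of \<alpha>]
    have "((\<lambda>s. \<alpha> * (exp (- bl s) * F x s)) has_real_derivative phase_coeff \<alpha> \<beta> x t * k * Fxx x t) (at t)"
      using True by (simp add: phase_coeff_def algebra_simps)
    then show ?thesis
      using ev by (subst DERIV_cong_ev[symmetric, OF refl _ refl]) (auto elim: eventually_mono)
  next
    case False
    then have "\<forall>\<^sub>F s in nhds t. F x s < 0" using lim F_neg[OF \<open>t > 0\<close>] assms(2)
      by (intro order_tendstoD) auto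
    then have ev: "\<forall>\<^sub>F s in nhds t. source x s = br' s * F x s \<and>
        \<beta> * (exp (- br s) * F x s) = phases \<alpha> \<beta> x s"
      by eventually_elim (auto simp: source_def phases_def pos_part_def neg_part_def)
    then have "((\<lambda>s. exp (- br s) * F x s) has_real_derivative exp (- br t) * k * Fxx x t) (at t)"
      by (intro exp_F_deriv[OF br_lip br_deriv \<open>t > 0\<close>]) (auto elim: eventually_mono)
    from DERIV_cmult[OF this, of \<beta>]
    have "((\<lambda>s. \<beta> * (exp (- br s) * F x s)) has_real_derivative phase_coeff \<alpha> \<beta> x t * k * Fxx x t) (at t)"
      using False by (simp add: phase_coeff_def algebra_simps)
    then show ?thesis
      using ev by (subst DERIV_cong_ev[symmetric, OF refl _ refl]) (auto elim: eventually_mono)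
  qed
qed

text \<open>The sign of \<open>F\<close> at a fixed point beside \<open>p t\<close> persists for
  nearby times and traps \<open>p s\<close> on the same side of that point.\<close>

lemma isCont_p:
  assumes "t > 0"
  shows "isCont p t"
proof -
  have lim: "((\<lambda>s. F x s) \<longlongrightarrow> F x t) (at t)" for x
  proof -
    have "continuous_on {0<..} (\<lambda>s. F x s)" by (auto intro!: continuous_intros)
    then have "isCont (\<lambda>s. F x s) t" using \<open>t > 0\<close> by (simp add: continuous_on_eq_continuous_at)
    then show ?thesis by (simp add: isCont_def)
  qed
  have t0: "\<forall>\<^sub>F s in at t. s > 0"
    using order_tendstoD(1)[OF tendsto_ident_at \<open>t > 0\<close>] .
  have "(p \<longlongrightarrow> p t) (at t)"
  proof (rule order_tendstoI)
    fix y assume "y < p t"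
    from order_tendstoD(1)[OF lim F_pos[OF \<open>t > 0\<close> this]] t0
    show "\<forall>\<^sub>F s in at t. y < p s" by eventually_elim (simp add: F_sign_iff)
  next
    fix y assume "y > p t"
    from order_tendstoD(2)[OF lim F_neg[OF \<open>t > 0\<close> this]] t0
    show "\<forall>\<^sub>F s in at t. y > p s" by eventually_elim (simp add: F_sign_iff)
  qed
  then show ?thesis by (simp add: isCont_def)
qed

text \<open>\<open>F\<close> vanishes at \<open>p t\<close> and is negative to its right. This sign
  makes the boundary term act as a sink when a single phase is considered.\<close>

lemma Fx_p_nonpos:
  assumes "t > 0"
  shows "Fx (p t) t \<le> 0"
proof (rule ccontr)
  assume "\<not> ?thesis"
  then obtain d where "d > 0" "\<And>u. u > 0 \<Longrightarrow> u < d \<Longrightarrow> F (p t) t < F (p t + u) t"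
    using DERIV_pos_inc_right[OF Fx[OF assms, of "p t"]] by auto
  from this(1) this(2)[of "d / 2"] show False
    using F_p[OF assms] F_neg[OF assms, of "p t + d / 2"] by auto
qed

section \<open>Green's identity on truncated intervals\<close>

definition "truncated_average \<alpha> \<beta> y T R s =
  integral {-R..R} (\<lambda>x. phases \<alpha> \<beta> x s * heat_kernel k (T - s) (x - y))"

text \<open>The flux in Green's second identity: its x-derivative is
  \<open>F\<^sub>x\<^sub>x\<close> times the kernel minus \<open>F\<close> times the second
  derivative of the kernel.\<close>

definition "heat_flux y T x s =
  Fx x s * heat_kernel k (T - s) (x - y) - F x s * heat_kernel_x k (T - s) (x - y)"

text \<open>The kernel solves the backward equation and the phases the forward one, so on each side
  of \<open>p s\<close> the time derivative of the integrand is an exact x-derivative. Integrating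
  up to \<open>p s\<close> from both sides leaves the end fluxes and, because the weights differ, an
  interface flux. No term from the motion of \<open>p\<close> arises, since the integrand vanishes
  there.\<close>

lemma truncated_average_deriv:
  assumes s: "0 < s" "s < T" and R: "\<bar>p s\<bar> < R"
  shows "(truncated_average \<alpha> \<beta> y T R has_real_derivative
    k * \<alpha> * exp (- bl s) * (heat_flux y T (p s) s - heat_flux y T (-R) s) +
    k * \<beta> * exp (- br s) * (heat_flux y T R s - heat_flux y T (p s) s)) (at s)"
proof -
  define G where "G x u = phases \<alpha> \<beta> x u * heat_kernel k (T - u) (x - y)" for x u
  define d where "d x u = phase_coeff \<alpha> \<beta> x u * k *
    (Fxx x u * heat_kernel k (T - u) (x - y) - F x u * heat_kernel_xx k (T - u) (x - y))" for x u
  define J where "J = k * \<alpha> * exp (- bl s) * (heat_flux y T (p s) s - heat_flux y T (-R) s) +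
    k * \<beta> * exp (- br s) * (heat_flux y T R s - heat_flux y T (p s) s)"
  have G_deriv: "((\<lambda>u. G x u) has_real_derivative d x u) (at u)" if "0 < u" "u < T" "x \<noteq> p u" for x u
  proof -
    have "((\<lambda>u. T - u) has_real_derivative - 1) (at u)" by (auto intro!: derivative_eq_intros)
    from DERIV_chain2[where f = "\<lambda>\<tau>. heat_kernel k \<tau> (x - y)" and g = "\<lambda>u. T - u",
        OF DERIV_heat_kernel_time[OF k_pos] this]
    have "((\<lambda>u. heat_kernel k (T - u) (x - y)) has_real_derivative
        - (k * heat_kernel_xx k (T - u) (x - y))) (at u)" using that by simp
    from DERIV_mult[OF phases_deriv[OF that(1,3)] this]
    show ?thesis unfolding G_def
      by (rule DERIV_cong) (use that in \<open>simp add: d_def phases_eq algebra_simps\<close>)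
  qed
  have G_cont: "continuous_on S (\<lambda>z. G (f z) (g z))"
    if "continuous_on S f" "continuous_on S g" "\<And>z. z \<in> S \<Longrightarrow> g z \<ge> 0 \<and> g z < T"
    for S :: "real set" and f g
    unfolding G_def using that k_pos by (auto intro!: continuous_intros)
  \<comment> \<open>Times at which \<open>G x\<close> may fail to be differentiable are zeros of
    \<open>G x\<close>, so a uniform Lipschitz bound in time follows from the derivative off the
    zeros.\<close>
  have G_zero: "x \<noteq> p u" if "G x u \<noteq> 0" "u > 0" for x u
    using that F_p[of u] by (auto simp: G_def phases_eq)
  define s1 s2 where "s1 = s / 2" and "s2 = (s + T) / 2"
  have s12: "0 < s1" "s1 < s" "s < s2" "s2 < T" using s by (auto simp: s1_def s2_def)
  obtain M where M: "M \<ge> 0" "\<And>x u. x \<in> {-R..R} \<Longrightarrow> u \<in> {s1..s2} \<Longrightarrow> \<bar>d x u\<bar> \<le> M"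
  proof -
    \<comment> \<open>The weight in \<open>d\<close> may jump across the free boundary, so
      compactness is applied to a continuous majorant instead.\<close>
    define \<Phi> where "\<Phi> z = coeff_bound \<alpha> \<beta> (snd z) * k *
      (\<bar>Fxx (fst z) (snd z) * heat_kernel k (T - snd z) (fst z - y)\<bar> +
       \<bar>F (fst z) (snd z) * heat_kernel_xx k (T - snd z) (fst z - y)\<bar>)" for z
    have "continuous_on ({-R..R} \<times> {s1..s2}) \<Phi>"
      unfolding \<Phi>_def coeff_bound_def using s12 k_pos
      by (auto intro!: continuous_intros boundary_coeff_cont_comp)
    then have "bounded (\<Phi> ` ({-R..R} \<times> {s1..s2}))"
      by (intro compact_imp_bounded compact_continuous_image compact_Times) auto
    then obtain M where M: "\<forall>z\<in>{-R..R} \<times> {s1..s2}. \<bar>\<Phi> z\<bar> \<le> M" by (auto simp: bounded_iff)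
    have "\<bar>d x u\<bar> \<le> max M 0" if "x \<in> {-R..R}" "u \<in> {s1..s2}" for x u
    proof -
      have "\<bar>d x u\<bar> \<le> \<Phi> (x, u)"
        unfolding d_def \<Phi>_def fst_conv snd_conv using k_pos abs_phase_coeff_le[of \<alpha> \<beta> x u]
        by (auto simp: abs_mult intro!: mult_mono order_trans[OF abs_triangle_ineq4])
      also have "\<dots> \<le> M" using bspec[OF M, of "(x, u)"] that by auto
      finally show ?thesis by simp
    qed
    then show ?thesis using that[of "max M 0"] by simp
  qed
  have G_lip: "\<bar>G x v - G x u\<bar> \<le> M * (v - u)"
    if "x \<in> {-R..R}" "u \<in> {s1..s2}" "v \<in> {s1..s2}" "u \<le> v" for x u v
  proof (rule abs_diff_le_of_deriv_off_zeros)
    show "continuous_on {u..v} (\<lambda>t. G x t)" using that s12 by (intro G_cont) auto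
    show "\<exists>e. ((\<lambda>t. G x t) has_real_derivative e) (at t) \<and> \<bar>e\<bar> \<le> M"
      if t: "u < t" "t < v" "G x t \<noteq> 0" for t
      using G_deriv[of t x] G_zero[OF t(3)] M(2)[of x t] t that s12 \<open>x \<in> {-R..R}\<close>
        \<open>u \<in> {s1..s2}\<close> \<open>v \<in> {s1..s2}\<close> by (intro exI[of _ "d x t"]) auto
  qed (use that M in auto)
  have G_lip': "\<bar>G x u - G x s\<bar> \<le> M * \<bar>u - s\<bar>" if "x \<in> {-R..R}" "u \<in> {s1..s2}" for x u
    using G_lip[of x u s] G_lip[of x s u] that s12 by (cases "u \<le> s") auto
  have G_int: "(\<lambda>x. G x u) integrable_on {-R..R}" if "0 < u" "u < T" for u
    using that by (intro integrable_continuous_real G_cont) auto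
  have d_int: "((\<lambda>x. d x s) has_integral J) {-R..R}"
  proof -
    have flux: "((\<lambda>x. heat_flux y T x s) has_real_derivative
        Fxx x s * heat_kernel k (T - s) (x - y) - F x s * heat_kernel_xx k (T - s) (x - y)) (at x)" for x
    proof -
      have "T - s > 0" using s by simp
      show ?thesis unfolding heat_flux_def
        by (rule DERIV_cong[OF DERIV_diff[OF DERIV_mult[OF Fxx[OF s(1)] DERIV_heat_kernel[OF k_pos \<open>T - s > 0\<close>]]
             DERIV_mult[OF Fx[OF s(1)] DERIV_heat_kernel_x[OF k_pos \<open>T - s > 0\<close>]]]])
          (simp add: algebra_simps)
    qed
    have cont: "continuous_on A (\<lambda>x. heat_flux y T x s)" for A
      using DERIV_continuous_on[OF has_field_derivative_at_within[OF flux]] by blast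
    have "((\<lambda>x. d x s) has_integral k * \<alpha> * exp (- bl s) * heat_flux y T (p s) s -
        k * \<alpha> * exp (- bl s) * heat_flux y T (-R) s) {-R..p s}"
    proof (rule fundamental_theorem_of_calculus_interior_strong[of "{}"])
      fix x assume "x \<in> {-R<..<p s} - {}"
      then have "((\<lambda>x. k * \<alpha> * exp (- bl s) * heat_flux y T x s) has_real_derivative d x s) (at x)"
        by (intro DERIV_cong[OF DERIV_cmult[OF flux]]) (simp add: d_def phase_coeff_def)
      then show "((\<lambda>x. k * \<alpha> * exp (- bl s) * heat_flux y T x s) has_vector_derivative d x s) (at x)"
        by (simp add: has_real_derivative_iff_has_vector_derivative)
    qed (use R in \<open>auto intro!: continuous_intros cont\<close>)
    moreover have "((\<lambda>x. d x s) has_integral k * \<beta> * exp (- br s) * heat_flux y T R s -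
        k * \<beta> * exp (- br s) * heat_flux y T (p s) s) {p s..R}"
    proof (rule fundamental_theorem_of_calculus_interior_strong[of "{}"])
      fix x assume "x \<in> {p s<..<R} - {}"
      then have "((\<lambda>x. k * \<beta> * exp (- br s) * heat_flux y T x s) has_real_derivative d x s) (at x)"
        by (intro DERIV_cong[OF DERIV_cmult[OF flux]]) (simp add: d_def phase_coeff_def)
      then show "((\<lambda>x. k * \<beta> * exp (- br s) * heat_flux y T x s) has_vector_derivative d x s) (at x)"
        by (simp add: has_real_derivative_iff_has_vector_derivative)
    qed (use R in \<open>auto intro!: continuous_intros cont\<close>)
    ultimately have "((\<lambda>x. d x s) has_integral
        (k * \<alpha> * exp (- bl s) * heat_flux y T (p s) s - k * \<alpha> * exp (- bl s) * heat_flux y T (-R) s) +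
        (k * \<beta> * exp (- br s) * heat_flux y T R s - k * \<beta> * exp (- br s) * heat_flux y T (p s) s)) {-R..R}"
      using R by (intro has_integral_combine[where c = "p s"]) auto
    then show ?thesis by (simp add: J_def algebra_simps)
  qed
  have "((\<lambda>u. (truncated_average \<alpha> \<beta> y T R u - truncated_average \<alpha> \<beta> y T R s) / (u - s)) \<longlongrightarrow> J)
    (at s within {s1<..<s2})"
    unfolding tendsto_at_iff_sequentially
  proof (intro allI impI)
    fix X :: "nat \<Rightarrow> real" assume X: "\<forall>i. X i \<in> {s1<..<s2} - {s}" "X \<longlonglongrightarrow> s"
    have Xi: "s1 < X i" "X i < s2" "X i \<noteq> s" "0 < X i" "X i < T" for i
      using X(1)[rule_format, of i] s12 by auto
    \<comment> \<open>The quotient is overwritten at the one point \<open>p s\<close>, where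
      convergence is not known. This leaves the integrals unchanged and gives convergence at every
      x.\<close>
    define q where "q n x = (if x = p s then 0 else (G x (X n) - G x s) / (X n - s))" for n x
    have q_int: "((\<lambda>x. q n x) has_integral
        (truncated_average \<alpha> \<beta> y T R (X n) - truncated_average \<alpha> \<beta> y T R s) / (X n - s)) {-R..R}" for n
    proof (rule has_integral_spike_finite[of "{p s}"])
      show "((\<lambda>x. (G x (X n) - G x s) / (X n - s)) has_integral
        (truncated_average \<alpha> \<beta> y T R (X n) - truncated_average \<alpha> \<beta> y T R s) / (X n - s)) {-R..R}"
        unfolding truncated_average_def G_def[symmetric]
        by (intro has_integral_divide has_integral_diff integrable_integral G_int Xi s)
    qed (auto simp: q_def)
    have "(\<lambda>n. integral {-R..R} (q n)) \<longlonglongrightarrow> integral {-R..R} (\<lambda>x. if x = p s then 0 else d x s)"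
    proof (rule dominated_convergence(2))
      show "q n integrable_on {-R..R}" for n using q_int by blast
      show "(\<lambda>x. M) integrable_on {-R..R}" by (rule integrable_const_ivl)
      show "norm (q n x) \<le> M" if "x \<in> {-R..R}" for n x
        using G_lip'[OF that, of "X n"] Xi[of n] M(1) by (auto simp: q_def divide_le_eq)
      show "(\<lambda>n. q n x) \<longlonglongrightarrow> (if x = p s then 0 else d x s)" if "x \<in> {-R..R}" for x
      proof (cases "x = p s")
        case False
        then have "((\<lambda>u. (G x u - G x s) / (u - s)) \<longlongrightarrow> d x s) (at s)"
          using G_deriv[OF s] by (simp add: has_field_derivative_iff)
        moreover have "filterlim X (at s) sequentially"
          using X(2) Xi(3) by (auto simp: filterlim_at)
        ultimately have "(\<lambda>n. (G x (X n) - G x s) / (X n - s)) \<longlonglongrightarrow> d x s"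
          by (rule filterlim_compose)
        then show ?thesis using False by (simp add: q_def)
      qed (simp add: q_def)
    qed
    moreover have "integral {-R..R} (\<lambda>x. if x = p s then 0 else d x s) = J"
      by (intro integral_unique has_integral_spike_finite[OF _ _ d_int, of "{p s}"]) auto
    moreover have "integral {-R..R} (q n) =
        (truncated_average \<alpha> \<beta> y T R (X n) - truncated_average \<alpha> \<beta> y T R s) / (X n - s)" for n
      using q_int by (rule integral_unique)
    ultimately show "((\<lambda>u. (truncated_average \<alpha> \<beta> y T R u - truncated_average \<alpha> \<beta> y T R s) / (u - s)) \<circ> X)
        \<longlonglongrightarrow> J" by (simp add: comp_def)
  qed
  moreover have "at s within {s1<..<s2} = at s" using s12 by (intro at_within_open) auto
  ultimately show ?thesis unfolding J_def has_field_derivative_iff by simp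
qed

text \<open>Written in the variable \<open>z = (x - y) / sqrt (T - s)\<close>, which turns the
  singular kernel into a fixed weight. The formula therefore still makes sense at
  \<open>s = T\<close>, where it returns the point value, and it is continuous up to that time by
  dominated convergence.\<close>

definition "average \<alpha> \<beta> y T s =
  (LINT z|lborel. phases \<alpha> \<beta> (y + sqrt (T - s) * z) s * heat_kernel k 1 z)"

lemma phases_measurable [measurable]:
  assumes "s \<ge> 0" and [measurable]: "f \<in> borel_measurable borel"
  shows "(\<lambda>x. phases \<alpha> \<beta> (f x) s) \<in> borel_measurable borel"
proof -
  have "(\<lambda>x. phases \<alpha> \<beta> x s) \<in> borel_measurable borel"
    using assms(1) by (intro borel_measurable_continuous_onI continuous_intros) auto
  then show ?thesis by measurable
qed

lemma phases_bounded:
  assumes "T > 0"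
  shows "\<exists>C\<ge>0. \<forall>x. \<forall>t\<in>{0..T}. \<bar>phases \<alpha> \<beta> x t\<bar> \<le> C"
proof -
  obtain M where M: "\<And>x t. t \<in> {0..T} \<Longrightarrow> \<bar>F x t\<bar> \<le> M" using F_bdd[OF assms] by blast
  have "continuous_on {0..T} (coeff_bound \<alpha> \<beta>)"
    unfolding coeff_bound_def by (auto intro!: continuous_intros boundary_coeff_cont_comp)
  then have "bounded (coeff_bound \<alpha> \<beta> ` {0..T})"
    by (intro compact_imp_bounded compact_continuous_image) auto
  then obtain A where A: "\<forall>t\<in>{0..T}. \<bar>coeff_bound \<alpha> \<beta> t\<bar> \<le> A" by (auto simp: bounded_iff)
  have "\<bar>phases \<alpha> \<beta> x t\<bar> \<le> A * M" if "t \<in> {0..T}" for x t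
  proof -
    have "\<bar>phases \<alpha> \<beta> x t\<bar> \<le> coeff_bound \<alpha> \<beta> t * \<bar>F x t\<bar>" by (rule abs_phases_le)
    also have "\<dots> \<le> A * M"
      using bspec[OF A that] M[OF that, of x] coeff_bound_nonneg[of \<alpha> \<beta> t] by (intro mult_mono) auto
    finally show ?thesis .
  qed
  moreover have "A * M \<ge> 0" using calculation[of 0 0] assms by auto
  ultimately show ?thesis by blast
qed

lemma integrable_phases_heat_kernel:
  assumes "0 \<le> s" "s < T"
  shows "integrable lborel (\<lambda>x. phases \<alpha> \<beta> x s * heat_kernel k (T - s) (x - y))"
proof -
  obtain C where C: "C \<ge> 0" "\<And>x t. t \<in> {0..T} \<Longrightarrow> \<bar>phases \<alpha> \<beta> x t\<bar> \<le> C"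
    using phases_bounded[of T] assms by force
  show ?thesis
  proof (rule Bochner_Integration.integrable_bound)
    show "integrable lborel (\<lambda>x. C * heat_kernel k (T - s) (x - y))"
      using assms k_pos by (intro integrable_mult_right integrable_heat_kernel_shift) auto
    show "AE x in lborel. norm (phases \<alpha> \<beta> x s * heat_kernel k (T - s) (x - y))
        \<le> norm (C * heat_kernel k (T - s) (x - y))"
      using C assms heat_kernel_pos[OF k_pos, of "T - s"]
      by (auto simp: abs_mult intro!: mult_right_mono)
  qed (use assms in measurable)
qed

lemma average_eq:
  assumes "0 \<le> s" "s < T"
  shows "average \<alpha> \<beta> y T s = (LINT x|lborel. phases \<alpha> \<beta> x s * heat_kernel k (T - s) (x - y))"
proof -
  have c: "sqrt (T - s) \<noteq> 0" "sqrt (T - s) > 0" using assms by auto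
  have "(LINT x|lborel. phases \<alpha> \<beta> x s * heat_kernel k (T - s) (x - y)) =
      (LINT z|lborel. phases \<alpha> \<beta> (y + sqrt (T - s) * z) s * (sqrt (T - s) * heat_kernel k (T - s) (sqrt (T - s) * z)))"
    by (subst lborel_integral_real_affine[OF c(1), of _ y])
      (use c in \<open>simp add: integral_mult_right_zero[symmetric] algebra_simps del: integral_mult_right_zero\<close>)
  also have "\<dots> = average \<alpha> \<beta> y T s"
    using heat_kernel_rescale[of "T - s"] assms by (simp add: average_def)
  finally show ?thesis by simp
qed

lemma truncated_average_tendsto:
  assumes "0 \<le> s" "s < T"
  shows "(\<lambda>n. truncated_average \<alpha> \<beta> y T (real n) s) \<longlonglongrightarrow> average \<alpha> \<beta> y T s"
proof -
  define g where "g x = phases \<alpha> \<beta> x s * heat_kernel k (T - s) (x - y)" for x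
  have int: "integrable lborel g"
    unfolding g_def by (rule integrable_phases_heat_kernel[OF assms])
  have "(\<lambda>n. LINT x|lborel. indicator {- real n..real n} x *\<^sub>R g x) \<longlonglongrightarrow> (LINT x|lborel. g x)"
  proof (rule integral_dominated_convergence)
    show "integrable lborel (\<lambda>x. norm (g x))" using int by simp
    show "AE x in lborel. (\<lambda>n. indicator {- real n..real n} x *\<^sub>R g x) \<longlonglongrightarrow> g x"
    proof (rule AE_I2)
      fix x
      have "\<forall>\<^sub>F n in sequentially. indicator {- real n..real n} x *\<^sub>R g x = g x"
        using eventually_ge_at_top[of "nat \<lceil>\<bar>x\<bar>\<rceil>"] by eventually_elim (auto simp: indicator_def; linarith)
      then show "(\<lambda>n. indicator {- real n..real n} x *\<^sub>R g x) \<longlonglongrightarrow> g x" by (rule tendsto_eventually)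
    qed
    show "AE x in lborel. norm (indicator {- real n..real n} x *\<^sub>R g x) \<le> norm (g x)" for n
      by (auto simp: indicator_def)
    show "g \<in> borel_measurable lborel" using int by auto
    show "(\<lambda>x. indicator {- real n..real n} x *\<^sub>R g x) \<in> borel_measurable lborel" for n
      using int by measurable
  qed
  moreover have "(LINT x|lborel. indicator {- real n..real n} x *\<^sub>R g x) = truncated_average \<alpha> \<beta> y T (real n) s" for n
  proof -
    have "set_integrable lborel {- real n..real n} g"
      unfolding set_integrable_def using int by (intro integrable_mult_indicator) auto
    from set_borel_integral_eq_integral(2)[OF this] show ?thesis
      by (simp add: set_lebesgue_integral_def truncated_average_def g_def[abs_def])
  qed
  ultimately show ?thesis using assms by (simp add: average_eq g_def)
qed

lemma average_cont:
  assumes "T > 0"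
  shows "continuous_on {0..T} (average \<alpha> \<beta> y T)"
proof (rule continuous_on_sequentiallyI)
  fix u a assume u: "\<forall>n. u n \<in> {0..T}" and a: "a \<in> {0..T}" "u \<longlonglongrightarrow> a"
  obtain C where C: "C \<ge> 0" "\<And>x t. t \<in> {0..T} \<Longrightarrow> \<bar>phases \<alpha> \<beta> x t\<bar> \<le> C"
    using phases_bounded[OF assms] by force
  show "(\<lambda>n. average \<alpha> \<beta> y T (u n)) \<longlonglongrightarrow> average \<alpha> \<beta> y T a"
    unfolding average_def
  proof (rule integral_dominated_convergence)
    show "integrable lborel (\<lambda>z. C * heat_kernel k 1 z)"
      using k_pos by (intro integrable_mult_right integrable_heat_kernel) auto
    show "AE z in lborel. norm (phases \<alpha> \<beta> (y + sqrt (T - u n) * z) (u n) * heat_kernel k 1 z)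
        \<le> C * heat_kernel k 1 z" for n
    proof (rule AE_I2)
      show "norm (phases \<alpha> \<beta> (y + sqrt (T - u n) * z) (u n) * heat_kernel k 1 z)
        \<le> C * heat_kernel k 1 z" for z
        using C(2)[of "u n"] u heat_kernel_pos[OF k_pos, of 1 z]
        by (auto simp: abs_mult intro!: mult_right_mono)
    qed
    have "continuous_on {0..T} (\<lambda>t. phases \<alpha> \<beta> (y + sqrt (T - t) * z) t)" for z
      by (auto intro!: continuous_intros)
    from continuous_on_tendsto_compose[OF this a(2,1)]
    have "(\<lambda>n. phases \<alpha> \<beta> (y + sqrt (T - u n) * z) (u n)) \<longlonglongrightarrow>
        phases \<alpha> \<beta> (y + sqrt (T - a) * z) a" for z
      using u by auto
    then show "AE z in lborel. (\<lambda>n. phases \<alpha> \<beta> (y + sqrt (T - u n) * z) (u n) * heat_kernel k 1 z)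
        \<longlonglongrightarrow> phases \<alpha> \<beta> (y + sqrt (T - a) * z) a * heat_kernel k 1 z"
      by (auto intro!: tendsto_intros)
  qed (use u a in \<open>auto intro!: borel_measurable_times\<close>)
qed

lemma average_end: "average \<alpha> \<beta> y T T = phases \<alpha> \<beta> y T"
  using integral_heat_kernel[OF k_pos, of 1] by (simp add: average_def)

text \<open>Flux estimates hold only strictly between the times 0 and T, where slope and kernel are
  under control. Continuity of the average on the closed interval allows passing to both ends, and
  at T it becomes the point value.\<close>

lemma phases_le_of_average_bound:
  assumes "0 < c" "0 < c'" "c' < T"
    and bound: "\<And>s1 s2. 0 < s1 \<Longrightarrow> s1 < c \<Longrightarrow> c' < s2 \<Longrightarrow> s2 < T \<Longrightarrow>
      average \<alpha> \<beta> y T s2 \<le> average \<alpha> \<beta> y T s1 + B"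
  shows "phases \<alpha> \<beta> y T \<le> average \<alpha> \<beta> y T 0 + B"
proof -
  have "T > 0" using assms by simp
  note cont = average_cont[OF this, of \<alpha> \<beta> y]
  have r: "(average \<alpha> \<beta> y T \<longlongrightarrow> average \<alpha> \<beta> y T 0) (at_right 0)"
    using continuous_on_Icc_at_rightD[OF cont \<open>T > 0\<close>] .
  have l: "(average \<alpha> \<beta> y T \<longlongrightarrow> average \<alpha> \<beta> y T T) (at_left T)"
    using continuous_on_Icc_at_leftD[OF cont \<open>T > 0\<close>] .
  have "average \<alpha> \<beta> y T s2 \<le> average \<alpha> \<beta> y T 0 + B" if "c' < s2" "s2 < T" for s2
  proof (rule tendsto_lowerbound)
    show "((\<lambda>s. average \<alpha> \<beta> y T s + B) \<longlongrightarrow> average \<alpha> \<beta> y T 0 + B) (at_right 0)"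
      using r by (intro tendsto_intros)
    show "\<forall>\<^sub>F s in at_right 0. average \<alpha> \<beta> y T s2 \<le> average \<alpha> \<beta> y T s + B"
      using eventually_at_right_real[OF assms(1)] by eventually_elim (use that in \<open>auto intro!: bound\<close>)
  qed simp
  then have "\<forall>\<^sub>F s in at_left T. average \<alpha> \<beta> y T s \<le> average \<alpha> \<beta> y T 0 + B"
    using eventually_at_left_real[OF assms(3)] by (auto elim!: eventually_mono)
  from tendsto_upperbound[OF l this] show ?thesis by (simp add: average_end)
qed

section \<open>Comparison of averages at two times\<close>

lemma heat_flux_p: "s > 0 \<Longrightarrow> heat_flux y T (p s) s = Fx (p s) s * heat_kernel k (T - s) (p s - y)"
  by (simp add: heat_flux_def F_p)

text \<open>The fluxes through the ends \<open>R\<close> and \<open>- R\<close> are at most a linear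
  factor in \<open>R\<close> times a Gaussian tail, because \<open>F\<close> and its slope are
  bounded on the compact time interval. They vanish as \<open>R\<close> grows, so only the interface
  flux survives, and it is dominated by the derivative of \<open>h\<close>.\<close>

lemma average_diff_le:
  assumes s: "0 < s1" "s1 \<le> s2" "s2 < T"
    and g: "\<And>s. s1 \<le> s \<Longrightarrow> s \<le> s2 \<Longrightarrow> (h has_real_derivative g s) (at s)"
    and flux: "\<And>s. s1 \<le> s \<Longrightarrow> s \<le> s2 \<Longrightarrow> k * (\<alpha> * exp (- bl s) - \<beta> * exp (- br s)) *
      (Fx (p s) s * heat_kernel k (T - s) (p s - y)) \<le> g s"
  shows "average \<alpha> \<beta> y T s2 - average \<alpha> \<beta> y T s1 \<le> h s2 - h s1"
proof -
  have "T > 0" using s by simp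
  obtain M where M: "\<And>x t. t \<in> {0..T} \<Longrightarrow> \<bar>F x t\<bar> \<le> M" using F_bdd[OF \<open>T > 0\<close>] by blast
  then have "M \<ge> 0" using \<open>T > 0\<close> M[of 0 0] by fastforce
  have "L \<ge> 0" using lipschitz_on_nonneg[OF bl_lip] .
  define C0 where "C0 = 2 * M + (2 * M + L * M) / k + 1"
  have "C0 \<ge> 0" using \<open>M \<ge> 0\<close> \<open>L \<ge> 0\<close> k_pos by (simp add: C0_def)
  define C1 where "C1 = C0 / sqrt s1 + C0"
  have "C1 \<ge> 0" using \<open>C0 \<ge> 0\<close> s by (simp add: C1_def)
  have Fx_le: "\<bar>Fx x t\<bar> \<le> C1" if "s1 \<le> t" "t \<le> s2" for x t
  proof (cases "t \<le> 1")
    case True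
    have "\<bar>Fx x t\<bar> \<le> C0 / sqrt t" unfolding C0_def
      by (rule abs_Fx_le(1)) (use that s True in \<open>auto intro!: M\<close>)
    also have "\<dots> \<le> C0 / sqrt s1" using that s \<open>C0 \<ge> 0\<close> by (intro divide_left_mono) auto
    finally show ?thesis using \<open>C0 \<ge> 0\<close> by (simp add: C1_def)
  next
    case False
    have "\<bar>Fx x t\<bar> \<le> C0" unfolding C0_def
      by (rule abs_Fx_le(2)) (use that s False in \<open>auto intro!: M\<close>)
    moreover have "C0 / sqrt s1 \<ge> 0" using \<open>C0 \<ge> 0\<close> s by simp
    ultimately show ?thesis by (simp add: C1_def)
  qed
  have "continuous_on {s1..s2} (coeff_bound \<alpha> \<beta>)"
    unfolding coeff_bound_def using s by (auto intro!: continuous_intros boundary_coeff_cont_comp)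
  then have "bounded (coeff_bound \<alpha> \<beta> ` {s1..s2})"
    by (intro compact_imp_bounded compact_continuous_image) auto
  then obtain A where A: "\<forall>t\<in>{s1..s2}. \<bar>coeff_bound \<alpha> \<beta> t\<bar> \<le> A" by (auto simp: bounded_iff)
  then have "A \<ge> 0" using s bspec[OF A, of s1] by auto
  have "continuous_on {s1..s2} p" using isCont_p s by (intro continuous_at_imp_continuous_on) auto
  then have "bounded (p ` {s1..s2})" by (intro compact_imp_bounded compact_continuous_image) auto
  then obtain P where P: "\<forall>t\<in>{s1..s2}. \<bar>p t\<bar> \<le> P" by (auto simp: bounded_iff)
  \<comment> \<open>\<open>E\<close> bounds the kernel at both ends uniformly over the times
    involved, using that their distance from y is at least \<open>R - \<bar>y\<bar>\<close>. The
    factor 2 in \<open>D\<close> below counts the two ends.\<close>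
  define E where "E R = exp (- (R - \<bar>y\<bar>)\<^sup>2 / (4 * k * T)) / sqrt (4 * pi * k * (T - s2))" for R
  define D where "D R = 2 * k * A * ((C1 + M * ((R + \<bar>y\<bar>) / (2 * k * (T - s2)))) * E R)" for R
  have bdry: "\<bar>heat_flux y T x s\<bar> \<le> (C1 + M * ((R + \<bar>y\<bar>) / (2 * k * (T - s2)))) * E R"
    if R: "R > \<bar>y\<bar>" "\<bar>x\<bar> = R" and s': "s1 \<le> s" "s \<le> s2" for R x s
  proof -
    have hk: "heat_kernel k (T - s) (x - y) \<le> E R" unfolding E_def
      by (rule heat_kernel_le_of_time_between) (use R s s' k_pos in auto)
    have hk0: "heat_kernel k (T - s) (x - y) > 0" using s s' k_pos by (intro heat_kernel_pos) auto
    have "\<bar>(x - y) / (2 * k * (T - s))\<bar> \<le> (R + \<bar>y\<bar>) / (2 * k * (T - s2))"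
      unfolding abs_divide using R s s' k_pos by (intro frac_le) auto
    then have hkx: "\<bar>heat_kernel_x k (T - s) (x - y)\<bar> \<le> (R + \<bar>y\<bar>) / (2 * k * (T - s2)) * E R"
      using hk hk0 R s k_pos unfolding heat_kernel_x_def abs_mult abs_minus_cancel
      by (intro mult_mono) auto
    have "E R > 0" using hk hk0 by simp
    have "\<bar>heat_flux y T x s\<bar> \<le> \<bar>Fx x s\<bar> * heat_kernel k (T - s) (x - y) + \<bar>F x s\<bar> * \<bar>heat_kernel_x k (T - s) (x - y)\<bar>"
      unfolding heat_flux_def using hk0 by (intro order_trans[OF abs_triangle_ineq4]) (simp add: abs_mult)
    also have "\<dots> \<le> C1 * E R + M * ((R + \<bar>y\<bar>) / (2 * k * (T - s2)) * E R)"
      using Fx_le[OF s'] M[of s x] hk hk0 hkx s s' \<open>C1 \<ge> 0\<close> \<open>M \<ge> 0\<close> by (intro add_mono mult_mono) auto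
    finally show ?thesis by (simp add: algebra_simps)
  qed
  have D_lim: "D \<longlonglongrightarrow> 0"
  proof -
    have 1: "((\<lambda>R::real. exp (- (R - \<bar>y\<bar>)\<^sup>2 / c)) \<longlongrightarrow> 0) at_top" if "c > 0" for c
      using that by real_asymp
    have 2: "((\<lambda>R::real. (R + \<bar>y\<bar>) * exp (- (R - \<bar>y\<bar>)\<^sup>2 / c)) \<longlongrightarrow> 0) at_top" if "c > 0" for c
      using that by real_asymp
    have "4 * k * T > 0" using k_pos \<open>T > 0\<close> by simp
    note 1 = 1[OF this] and 2 = 2[OF this]
    have "((\<lambda>R. 2 * k * A / sqrt (4 * pi * k * (T - s2)) *
      (C1 * exp (- (R - \<bar>y\<bar>)\<^sup>2 / (4 * k * T)) + M / (2 * k * (T - s2)) * ((R + \<bar>y\<bar>) * exp (- (R - \<bar>y\<bar>)\<^sup>2 / (4 * k * T)))))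
      \<longlongrightarrow> 2 * k * A / sqrt (4 * pi * k * (T - s2)) * (C1 * 0 + M / (2 * k * (T - s2)) * 0)) at_top"
      by (intro tendsto_intros 1 2)
    moreover have "c * ((a + m * (r / K)) * (e / q)) = c / q * (a * e + m / K * (r * e))"
      for a c e m q r K :: real by (simp add: divide_inverse algebra_simps)
    then have "D = (\<lambda>R. 2 * k * A / sqrt (4 * pi * k * (T - s2)) *
      (C1 * exp (- (R - \<bar>y\<bar>)\<^sup>2 / (4 * k * T)) + M / (2 * k * (T - s2)) * ((R + \<bar>y\<bar>) * exp (- (R - \<bar>y\<bar>)\<^sup>2 / (4 * k * T)))))"
      by (intro ext) (simp only: D_def E_def)
    ultimately have "(D \<longlongrightarrow> 0) at_top" by simp
    then show ?thesis by (rule filterlim_compose[OF _ filterlim_real_sequentially])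
  qed
  have trunc: "truncated_average \<alpha> \<beta> y T R s2 - truncated_average \<alpha> \<beta> y T R s1 \<le> h s2 - h s1 + D R * (s2 - s1)"
    if R: "R > \<bar>y\<bar>" "R > P" for R
  proof -
    \<comment> \<open>The linear term \<open>D R * s\<close> absorbs the end fluxes, which makes the
      difference monotone in time.\<close>
    have "truncated_average \<alpha> \<beta> y T R s2 - h s2 - D R * s2 \<le> truncated_average \<alpha> \<beta> y T R s1 - h s1 - D R * s1"
    proof (rule DERIV_nonpos_imp_nonincreasing[OF \<open>s1 \<le> s2\<close>])
      fix u assume u: "s1 \<le> u" "u \<le> s2"
      define J where "J = k * \<alpha> * exp (- bl u) * (heat_flux y T (p u) u - heat_flux y T (-R) u) +
        k * \<beta> * exp (- br u) * (heat_flux y T R u - heat_flux y T (p u) u)"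
      have "(truncated_average \<alpha> \<beta> y T R has_real_derivative J) (at u)" unfolding J_def
        by (rule truncated_average_deriv) (use u s R bspec[OF P, of u] in auto)
      then have "((\<lambda>u. truncated_average \<alpha> \<beta> y T R u - h u - D R * u) has_real_derivative J - g u - D R) (at u)"
        by (auto intro!: derivative_eq_intros g u)
      moreover have "J - g u - D R \<le> 0"
      proof -
        define Z where "Z = (C1 + M * ((R + \<bar>y\<bar>) / (2 * k * (T - s2)))) * E R"
        have Z: "\<bar>heat_flux y T R u\<bar> \<le> Z" "\<bar>heat_flux y T (-R) u\<bar> \<le> Z"
          unfolding Z_def by (rule bdry; use R u in simp)+
        have cA: "coeff_bound \<alpha> \<beta> u \<le> A" using bspec[OF A, of u] u by auto
        have a: "\<bar>\<alpha> * exp (- bl u)\<bar> \<le> A" "\<bar>\<beta> * exp (- br u)\<bar> \<le> A"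
          using cA unfolding coeff_bound_def abs_mult
          by (auto intro: order_trans[rotated])
        have "\<bar>k * \<alpha> * exp (- bl u) * heat_flux y T (-R) u\<bar> \<le> k * (A * Z)"
          using mult_mono[OF a(1) Z(2) \<open>A \<ge> 0\<close> abs_ge_zero] k_pos by (simp add: abs_mult mult.assoc)
        moreover have "\<bar>k * \<beta> * exp (- br u) * heat_flux y T R u\<bar> \<le> k * (A * Z)"
          using mult_mono[OF a(2) Z(1) \<open>A \<ge> 0\<close> abs_ge_zero] k_pos by (simp add: abs_mult mult.assoc)
        moreover have "J = k * (\<alpha> * exp (- bl u) - \<beta> * exp (- br u)) * (Fx (p u) u * heat_kernel k (T - u) (p u - y)) -
            k * \<alpha> * exp (- bl u) * heat_flux y T (-R) u + k * \<beta> * exp (- br u) * heat_flux y T R u"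
          using u s by (simp add: J_def heat_flux_p algebra_simps)
        moreover have "D R = 2 * (k * (A * Z))" by (simp add: D_def Z_def)
        ultimately show ?thesis using flux[OF u] by (simp add: abs_le_iff)
      qed
      ultimately show "\<exists>z. ((\<lambda>u. truncated_average \<alpha> \<beta> y T R u - h u - D R * u) has_real_derivative z) (at u) \<and> z \<le> 0"
        by blast
    qed
    then show ?thesis by (simp add: algebra_simps)
  qed
  show ?thesis
  proof (rule tendsto_le)
    show "(\<lambda>n. truncated_average \<alpha> \<beta> y T (real n) s2 - truncated_average \<alpha> \<beta> y T (real n) s1)
        \<longlonglongrightarrow> average \<alpha> \<beta> y T s2 - average \<alpha> \<beta> y T s1"
      using s by (intro tendsto_diff truncated_average_tendsto) auto
    show "(\<lambda>n. h s2 - h s1 + D (real n) * (s2 - s1)) \<longlonglongrightarrow> h s2 - h s1"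
      using D_lim by (auto intro!: tendsto_eq_intros)
    have "\<forall>\<^sub>F n in sequentially. max \<bar>y\<bar> P < real n"
      using filterlim_at_top_dense[THEN iffD1, OF filterlim_real_sequentially] by (rule spec)
    then show "\<forall>\<^sub>F n in sequentially. truncated_average \<alpha> \<beta> y T (real n) s2 - truncated_average \<alpha> \<beta> y T (real n) s1
        \<le> h s2 - h s1 + D (real n) * (s2 - s1)"
      by eventually_elim (auto intro!: trunc)
  qed simp
qed

section \<open>A bound on the solution uniform in time\<close>

lemma average_le:
  assumes "0 \<le> s" "s < T" and le: "\<And>x. \<bar>phases \<alpha> \<beta> x s\<bar> \<le> C"
  shows "average \<alpha> \<beta> y T s \<le> C"
proof -
  have "average \<alpha> \<beta> y T s \<le> (LINT x|lborel. C * heat_kernel k (T - s) (x - y))"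
    unfolding average_eq[OF assms(1,2)]
  proof (rule integral_mono)
    show "integrable lborel (\<lambda>x. C * heat_kernel k (T - s) (x - y))"
      using assms k_pos by (intro integrable_mult_right integrable_heat_kernel_shift) auto
    show "phases \<alpha> \<beta> x s * heat_kernel k (T - s) (x - y) \<le> C * heat_kernel k (T - s) (x - y)" for x
      using abs_le_D1[OF le[of x]] heat_kernel_pos[OF k_pos, of "T - s" "x - y"] assms(1,2)
      by (intro mult_right_mono) auto
  qed (rule integrable_phases_heat_kernel[OF assms(1,2)])
  also have "\<dots> = C * (LINT x|lborel. heat_kernel k (T - s) (x - y))" by simp
  also have "(LINT x|lborel. heat_kernel k (T - s) (x - y)) = 1"
    using lborel_integral_real_affine[of 1 "heat_kernel k (T - s)" "- y"] integral_heat_kernel[OF k_pos, of "T - s"] assms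
    by simp
  finally show ?thesis by simp
qed

text \<open>The weights (1, 0) and (0, -1) isolate the positive and the negative part. In both cases
  the interface flux is nonpositive, so averages do not increase. One factor \<open>exp A\<close>
  bounds the weight at time 0, the other removes the weight at time T. As a consequence the constant
  in the gradient bound no longer depends on time.\<close>

lemma F_global_bound:
  assumes A: "\<And>t. t \<ge> 0 \<Longrightarrow> \<bar>bl t\<bar> \<le> A" "\<And>t. t \<ge> 0 \<Longrightarrow> \<bar>br t\<bar> \<le> A"
    and M: "\<And>x. \<bar>F x 0\<bar> \<le> M" and "T \<ge> 0"
  shows "\<bar>F y T\<bar> \<le> exp (2 * A) * M"
proof -
  have "M \<ge> 0" using M[of 0] by linarith
  have "A \<ge> 0" using A(1)[of 0] by linarith
  show ?thesis
  proof (cases "T = 0")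
    case True
    have "1 * M \<le> exp (2 * A) * M" using \<open>M \<ge> 0\<close> \<open>A \<ge> 0\<close> by (intro mult_right_mono) auto
    then show ?thesis using M[of y] True by simp
  next
    case False
    then have "T > 0" using \<open>T \<ge> 0\<close> by simp
    have key: "phases \<alpha> \<beta> y T \<le> exp A * M" if ab: "\<alpha> = 1 \<and> \<beta> = 0 \<or> \<alpha> = 0 \<and> \<beta> = - 1" for \<alpha> \<beta>
    proof -
      have "phases \<alpha> \<beta> y T \<le> average \<alpha> \<beta> y T 0 + 0"
      proof (rule phases_le_of_average_bound[of "T / 2" "T / 2"])
        fix s1 s2 assume s: "0 < s1" "s1 < T / 2" "T / 2 < s2" "s2 < T"
        have "average \<alpha> \<beta> y T s2 - average \<alpha> \<beta> y T s1 \<le> 0 - 0"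
        proof (rule average_diff_le[where h = "\<lambda>_. 0" and g = "\<lambda>_. 0"])
          fix t assume t: "s1 \<le> t" "t \<le> s2"
          have "Fx (p t) t * heat_kernel k (T - t) (p t - y) \<le> 0"
            using Fx_p_nonpos[of t] heat_kernel_pos[OF k_pos, of "T - t" "p t - y"] s t
            by (intro mult_nonpos_nonneg) auto
          moreover have "k * (\<alpha> * exp (- bl t) - \<beta> * exp (- br t)) \<ge> 0" using ab k_pos by auto
          ultimately show "k * (\<alpha> * exp (- bl t) - \<beta> * exp (- br t)) *
            (Fx (p t) t * heat_kernel k (T - t) (p t - y)) \<le> 0" by (rule mult_nonneg_nonpos[rotated])
        qed (use s in auto)
        then show "average \<alpha> \<beta> y T s2 \<le> average \<alpha> \<beta> y T s1 + 0" by simp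
      qed (use \<open>T > 0\<close> in auto)
      also have "average \<alpha> \<beta> y T 0 \<le> exp A * M"
      proof (rule average_le)
        fix x
        have "coeff_bound \<alpha> \<beta> 0 \<le> exp A"
          using ab A(1)[of 0] A(2)[of 0] by (auto simp: coeff_bound_def)
        then show "\<bar>phases \<alpha> \<beta> x 0\<bar> \<le> exp A * M"
          using abs_phases_le[of \<alpha> \<beta> x 0] M[of x] mult_mono[of "coeff_bound \<alpha> \<beta> 0" "exp A" "\<bar>F x 0\<bar>" M]
          by auto
      qed (use \<open>T > 0\<close> in auto)
      finally show ?thesis by simp
    qed
    have e: "z \<le> exp (2 * A) * M" if "exp (- b) * z \<le> exp A * M" "\<bar>b\<bar> \<le> A" for b z
    proof -
      have "z = exp b * (exp (- b) * z)" by (simp add: exp_minus)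
      also have "\<dots> \<le> exp A * (exp A * M)"
        using that \<open>M \<ge> 0\<close> by (intro order_trans[OF mult_left_mono[OF that(1)] mult_right_mono]) auto
      also have "\<dots> = exp (2 * A) * M" by (simp only: mult_2 exp_add mult.assoc)
      finally show ?thesis .
    qed
    have "pos_part (F y T) \<le> exp (2 * A) * M"
      by (rule e[of "bl T"]) (use key[of 1 0] A \<open>T > 0\<close> in \<open>auto simp: phases_def\<close>)
    moreover have "neg_part (F y T) \<le> exp (2 * A) * M"
      by (rule e[of "br T"]) (use key[of 0 "-1"] A \<open>T > 0\<close> in \<open>auto simp: phases_def\<close>)
    ultimately show ?thesis by (auto simp: pos_part_def neg_part_def abs_le_iff)
  qed
qed

section \<open>Decay of the averaged initial datum along the free boundary\<close>

text \<open>The flux through the free boundary at time \<open>t\<close> contributes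
  \<open>(T - t)\<^bsup>-1/2\<^esup>\<close> times \<open>t\<^bsup>-1/2\<^esup>\<close> for \<open>t \<le> 1\<close>, resp. times \<open>t\<^bsup>-w\<^esup>\<close> for \<open>t \<ge> 1\<close>.  The intervals
  from 0 to 1, from 1 to \<open>T/2\<close> and from \<open>T/2\<close> to \<open>T\<close> are integrated separately.\<close>

lemma initial_average_at_free_boundary:
  assumes A: "\<And>t. t \<ge> 0 \<Longrightarrow> \<bar>bl t\<bar> \<le> A" "\<And>t. t \<ge> 0 \<Longrightarrow> \<bar>br t\<bar> \<le> A"
    and M: "\<And>x. \<bar>F x 0\<bar> \<le> M" and "w > 1"
    and C: "\<And>t. t > 0 \<Longrightarrow> \<bar>bl t - br t\<bar> \<le> C * t powr (- w)"
    and b0: "bl 0 = 0" "br 0 = 0"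
  shows "\<exists>K. \<forall>T\<ge>2. \<bar>LINT x|lborel. F x 0 * heat_kernel k T (x - p T)\<bar> \<le> K / sqrt T"
proof -
  define M' where "M' = exp (2 * A) * M"
  have M': "\<bar>F x t\<bar> \<le> M'" if "t \<ge> 0" for x t
    unfolding M'_def using A M that by (rule F_global_bound)
  have "M' \<ge> 0" using M'[of 0 0] by linarith
  have "A \<ge> 0" using A(1)[of 0] by linarith
  have "L \<ge> 0" using lipschitz_on_nonneg[OF bl_lip] .
  define C0 where "C0 = 2 * M' + (2 * M' + L * M') / k + 1"
  have "C0 \<ge> 0" using \<open>M' \<ge> 0\<close> \<open>L \<ge> 0\<close> k_pos by (simp add: C0_def)
  have Fx1: "\<bar>Fx x t\<bar> \<le> C0 * (1 / sqrt t)" if "0 < t" "t \<le> 1" for x t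
    using abs_Fx_le(1)[of t M' x] that M' by (simp add: C0_def)
  have Fx2: "\<bar>Fx x t\<bar> \<le> C0" if "1 \<le> t" for x t
    using abs_Fx_le(2)[of t M' x] that M' by (simp add: C0_def)
  \<comment> \<open>One constant for two regimes: \<open>\<bar>bl t - br t\<bar>\<close> is at most
    \<open>2 * A\<close> for early times, where the power is useless, and at most
    \<open>C * t powr (- w)\<close> for late ones.\<close>
  define B where "B = exp A * max (2 * A) C"
  have "B \<ge> 0" using \<open>A \<ge> 0\<close> by (simp add: B_def)
  have b1: "\<bar>exp (- bl t) - exp (- br t)\<bar> \<le> B" if "t > 0" for t
  proof -
    have "\<bar>exp (- bl t) - exp (- br t)\<bar> \<le> exp A * \<bar>bl t - br t\<bar>"
      using A that by (intro abs_exp_uminus_diff_le) auto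
    also have "\<dots> \<le> B" unfolding B_def using A[of t] that by (intro mult_left_mono) auto
    finally show ?thesis .
  qed
  have b2: "\<bar>exp (- bl t) - exp (- br t)\<bar> \<le> B * t powr (- w)" if "t > 0" for t
  proof -
    have "\<bar>exp (- bl t) - exp (- br t)\<bar> \<le> exp A * \<bar>bl t - br t\<bar>"
      using A that by (intro abs_exp_uminus_diff_le) auto
    also have "\<dots> \<le> exp A * (max (2 * A) C * t powr (- w))"
      using C[OF that] mult_right_mono[of C "max (2 * A) C" "t powr (- w)"]
      by (intro mult_left_mono) auto
    finally show ?thesis by (simp add: B_def)
  qed
  define Q where "Q = k * B * C0 / sqrt (4 * pi * k)"
  have "Q \<ge> 0" using k_pos \<open>B \<ge> 0\<close> \<open>C0 \<ge> 0\<close> by (simp add: Q_def)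
  \<comment> \<open>\<open>X\<close> records the decay of the coefficient difference and
    \<open>Y\<close> that of the slope. The sign \<open>\<sigma>\<close> is kept so that one
    computation yields an upper and a lower bound.\<close>
  have flux: "k * (\<sigma> * exp (- bl t) - \<sigma> * exp (- br t)) * (Fx (p t) t * heat_kernel k (T - t) (p t - y))
      \<le> Q * (X * Y * (1 / sqrt (T - t)))"
    if "\<bar>\<sigma>\<bar> = 1" "t < T" and X: "\<bar>exp (- bl t) - exp (- br t)\<bar> \<le> B * X" "X \<ge> 0"
      and Y: "\<bar>Fx (p t) t\<bar> \<le> C0 * Y" "Y \<ge> 0" for \<sigma> t T y X Y
  proof -
    have hk: "heat_kernel k (T - t) (p t - y) \<le> 1 / sqrt (4 * pi * k) * (1 / sqrt (T - t))"
      using heat_kernel_le[OF k_pos, of "T - t"] that by (simp add: real_sqrt_mult)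
    have hk0: "heat_kernel k (T - t) (p t - y) > 0" using that k_pos by (intro heat_kernel_pos) auto
    have "k * (\<sigma> * exp (- bl t) - \<sigma> * exp (- br t)) * (Fx (p t) t * heat_kernel k (T - t) (p t - y))
        \<le> \<bar>k * (\<sigma> * exp (- bl t) - \<sigma> * exp (- br t)) * (Fx (p t) t * heat_kernel k (T - t) (p t - y))\<bar>"
      by (rule abs_ge_self)
    also have "\<dots> = k * \<bar>exp (- bl t) - exp (- br t)\<bar> * (\<bar>Fx (p t) t\<bar> * heat_kernel k (T - t) (p t - y))"
      using \<open>\<bar>\<sigma>\<bar> = 1\<close> k_pos hk0 by (simp add: abs_mult flip: right_diff_distrib)
    also have "\<dots> \<le> k * (B * X) * ((C0 * Y) * (1 / sqrt (4 * pi * k) * (1 / sqrt (T - t))))"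
      using X Y hk hk0 k_pos \<open>B \<ge> 0\<close> \<open>C0 \<ge> 0\<close> by (intro mult_mono) auto
    also have "\<dots> = Q * (X * Y * (1 / sqrt (T - t)))" by (simp add: Q_def)
    finally show ?thesis .
  qed
  have main: "phases \<sigma> \<sigma> y T \<le> average \<sigma> \<sigma> y T 0 + Q / sqrt (T / 2) * (4 + 1 / (w - 1))"
    if "T \<ge> 2" "\<bar>\<sigma>\<bar> = 1" for T y \<sigma>
  proof -
    define H where "H = T / 2"
    have H: "H \<ge> 1" "T = 2 * H" using \<open>T \<ge> 2\<close> by (auto simp: H_def)
    have half: "1 / sqrt (T - t) \<le> 1 / sqrt H" if "t \<le> H" for t
      using that H by (intro divide_left_mono) auto
    \<comment> \<open>In units of \<open>Q / sqrt H\<close>: times up to 1 contribute 2, times from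
      1 to \<open>H\<close> contribute \<open>1 / (w - 1)\<close>, and later times contribute 2. Up
      to \<open>H\<close> the kernel is of order \<open>1 / sqrt H\<close>, and the integral of
      \<open>t powr (- w)\<close> from 1 to \<open>H\<close> is bounded independently of
      \<open>H\<close> because \<open>w > 1\<close>.\<close>
    have bnd: "average \<sigma> \<sigma> y T s2 \<le> average \<sigma> \<sigma> y T s1 + Q / sqrt H * (4 + 1 / (w - 1))"
      if s: "0 < s1" "s1 \<le> 1" "H \<le> s2" "s2 < T" for s1 s2
    proof -
      have "average \<sigma> \<sigma> y T 1 - average \<sigma> \<sigma> y T s1 \<le> Q / sqrt H * (2 * sqrt 1) - Q / sqrt H * (2 * sqrt s1)"
      proof (rule average_diff_le[where g = "\<lambda>t. Q / sqrt H * (1 / sqrt t)"])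
        fix t assume t: "s1 \<le> t" "t \<le> 1"
        then have "t > 0" using s by simp
        show "((\<lambda>t. Q / sqrt H * (2 * sqrt t)) has_real_derivative Q / sqrt H * (1 / sqrt t)) (at t)"
          by (intro DERIV_cmult) (use \<open>t > 0\<close> in \<open>auto intro!: derivative_eq_intros simp: divide_simps\<close>)
        have "k * (\<sigma> * exp (- bl t) - \<sigma> * exp (- br t)) * (Fx (p t) t * heat_kernel k (T - t) (p t - y))
            \<le> Q * (1 * (1 / sqrt t) * (1 / sqrt (T - t)))"
          using b1[OF \<open>t > 0\<close>] Fx1[OF \<open>t > 0\<close>] t H \<open>t > 0\<close> \<open>\<bar>\<sigma>\<bar> = 1\<close> by (intro flux) auto
        also have "\<dots> \<le> Q * (1 * (1 / sqrt t) * (1 / sqrt H))"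
          using half[of t] t H \<open>Q \<ge> 0\<close> \<open>t > 0\<close> by (intro mult_left_mono) auto
        finally show "k * (\<sigma> * exp (- bl t) - \<sigma> * exp (- br t)) * (Fx (p t) t * heat_kernel k (T - t) (p t - y))
            \<le> Q / sqrt H * (1 / sqrt t)" by (simp add: mult.commute)
      qed (use s H in auto)
      moreover have "Q / sqrt H * (2 * sqrt s1) \<ge> 0" using \<open>Q \<ge> 0\<close> H s by simp
      ultimately have 1: "average \<sigma> \<sigma> y T 1 - average \<sigma> \<sigma> y T s1 \<le> Q / sqrt H * 2" by simp
      have "average \<sigma> \<sigma> y T H - average \<sigma> \<sigma> y T 1 \<le>
          Q / sqrt H * (H powr (1 - w) / (1 - w)) - Q / sqrt H * (1 powr (1 - w) / (1 - w))"
      proof (rule average_diff_le[where g = "\<lambda>t. Q / sqrt H * t powr (- w)"])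
        fix t assume t: "1 \<le> t" "t \<le> H"
        then have "t > 0" by simp
        show "((\<lambda>t. Q / sqrt H * (t powr (1 - w) / (1 - w))) has_real_derivative Q / sqrt H * t powr (- w)) (at t)"
          by (intro DERIV_cmult) (use \<open>t > 0\<close> \<open>w > 1\<close> in \<open>auto intro!: derivative_eq_intros\<close>)
        have "k * (\<sigma> * exp (- bl t) - \<sigma> * exp (- br t)) * (Fx (p t) t * heat_kernel k (T - t) (p t - y))
            \<le> Q * (t powr (- w) * 1 * (1 / sqrt (T - t)))"
          using b2[OF \<open>t > 0\<close>] Fx2[of t] t H \<open>t > 0\<close> \<open>\<bar>\<sigma>\<bar> = 1\<close> by (intro flux) auto
        also have "\<dots> \<le> Q * (t powr (- w) * 1 * (1 / sqrt H))"
          using half[of t] t H \<open>Q \<ge> 0\<close> \<open>t > 0\<close> by (intro mult_left_mono) auto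
        finally show "k * (\<sigma> * exp (- bl t) - \<sigma> * exp (- br t)) * (Fx (p t) t * heat_kernel k (T - t) (p t - y))
            \<le> Q / sqrt H * t powr (- w)" by (simp add: mult.commute)
      qed (use H in auto)
      moreover have "Q / sqrt H * (H powr (1 - w) / (1 - w)) \<le> 0"
        using \<open>Q \<ge> 0\<close> H \<open>w > 1\<close> by (intro mult_nonneg_nonpos divide_nonneg_nonpos) auto
      moreover have "- (Q / sqrt H * (1 powr (1 - w) / (1 - w))) = Q / sqrt H * (1 / (w - 1))"
        using \<open>w > 1\<close> H by (simp add: divide_simps) (simp add: algebra_simps)
      ultimately have 2: "average \<sigma> \<sigma> y T H - average \<sigma> \<sigma> y T 1 \<le> Q / sqrt H * (1 / (w - 1))" by linarith
      have "average \<sigma> \<sigma> y T s2 - average \<sigma> \<sigma> y T H \<le>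
          Q / H * (- 2 * sqrt (T - s2)) - Q / H * (- 2 * sqrt (T - H))"
      proof (rule average_diff_le[where g = "\<lambda>t. Q / H * (1 / sqrt (T - t))"])
        fix t assume t: "H \<le> t" "t \<le> s2"
        then have "t > 0" "t < T" using H s by auto
        show "((\<lambda>t. Q / H * (- 2 * sqrt (T - t))) has_real_derivative Q / H * (1 / sqrt (T - t))) (at t)"
          by (intro DERIV_cmult) (use \<open>t < T\<close> in \<open>auto intro!: derivative_eq_intros simp: divide_simps\<close>)
        \<comment> \<open>Integrating the kernel singularity over the second half costs
          \<open>sqrt H\<close>. The coefficient decay, weakened to \<open>1 / H\<close>, turns this
          into \<open>1 / sqrt H\<close>.\<close>
        have "t powr (- w) \<le> H powr (- w)"
          using t H \<open>w > 1\<close> by (intro powr_mono2') auto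
        also have "\<dots> \<le> H powr (- 1)" using H \<open>w > 1\<close> by (intro powr_mono) auto
        finally have tw: "t powr (- w) \<le> 1 / H" using H by (simp add: powr_minus_divide)
        have "k * (\<sigma> * exp (- bl t) - \<sigma> * exp (- br t)) * (Fx (p t) t * heat_kernel k (T - t) (p t - y))
            \<le> Q * (t powr (- w) * 1 * (1 / sqrt (T - t)))"
          using b2[OF \<open>t > 0\<close>] Fx2[of t] t H \<open>t > 0\<close> \<open>t < T\<close> \<open>\<bar>\<sigma>\<bar> = 1\<close> by (intro flux) auto
        also have "\<dots> \<le> Q * (1 / H * 1 * (1 / sqrt (T - t)))"
          using tw \<open>Q \<ge> 0\<close> \<open>t < T\<close> by (intro mult_left_mono mult_right_mono) auto
        finally show "k * (\<sigma> * exp (- bl t) - \<sigma> * exp (- br t)) * (Fx (p t) t * heat_kernel k (T - t) (p t - y))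
            \<le> Q / H * (1 / sqrt (T - t))" by simp
      qed (use H s in auto)
      moreover have "Q / H * (- 2 * sqrt (T - s2)) \<le> 0"
        by (rule mult_nonneg_nonpos) (use \<open>Q \<ge> 0\<close> H s in auto)
      moreover have "- (Q / H * (- 2 * sqrt (T - H))) = Q / sqrt H * 2"
      proof -
        have "sqrt H / H = 1 / sqrt H" using sqrt_divide_self_eq[of H] H by (simp add: divide_inverse)
        moreover have "- (Q / H * (- 2 * sqrt (T - H))) = 2 * Q * (sqrt H / H)" using H by simp
        ultimately show ?thesis by simp
      qed
      ultimately have 3: "average \<sigma> \<sigma> y T s2 - average \<sigma> \<sigma> y T H \<le> Q / sqrt H * 2" by linarith
      have "Q / sqrt H * (4 + 1 / (w - 1)) = Q / sqrt H * 2 + Q / sqrt H * (1 / (w - 1)) + Q / sqrt H * 2"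
        by (simp add: distrib_left)
      with 1 2 3 show ?thesis by linarith
    qed
    have "phases \<sigma> \<sigma> y T \<le> average \<sigma> \<sigma> y T 0 + Q / sqrt H * (4 + 1 / (w - 1))"
    proof (rule phases_le_of_average_bound[of 1 H])
      show "average \<sigma> \<sigma> y T s2 \<le> average \<sigma> \<sigma> y T s1 + Q / sqrt H * (4 + 1 / (w - 1))"
        if "0 < s1" "s1 < 1" "H < s2" "s2 < T" for s1 s2
        using that by (intro bnd) auto
    qed (use H in auto)
    then show ?thesis by (simp add: H_def)
  qed
  \<comment> \<open>With \<open>bl\<close> and \<open>br\<close> vanishing at time 0, equal weights
    reproduce \<open>F\<close> itself there.\<close>
  have avg: "average \<sigma> \<sigma> y T 0 = \<sigma> * (LINT x|lborel. F x 0 * heat_kernel k T (x - y))" if "T > 0" for \<sigma> y T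
  proof -
    have "phases \<sigma> \<sigma> x 0 = \<sigma> * F x 0" for x
      using b0 by (auto simp: phases_def pos_part_def neg_part_def max_def min_def)
    then show ?thesis using that by (simp add: average_eq mult.assoc)
  qed
  define K where "K = Q * sqrt 2 * (4 + 1 / (w - 1))"
  have "\<bar>LINT x|lborel. F x 0 * heat_kernel k T (x - p T)\<bar> \<le> K / sqrt T" if "T \<ge> 2" for T
  proof -
    \<comment> \<open>On the free boundary the left side of \<open>main\<close> is 0, so
      \<open>\<sigma> = 1\<close> bounds the integral from below and \<open>\<sigma> = - 1\<close>
      from above.\<close>
    have "phases \<sigma> \<sigma> (p T) T = 0" for \<sigma>
      using F_p[of T] \<open>T \<ge> 2\<close> by (simp add: phases_eq)
    moreover have "Q / sqrt (T / 2) * (4 + 1 / (w - 1)) = K / sqrt T"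
      by (simp add: K_def real_sqrt_divide)
    ultimately show ?thesis
      using main[OF that, of 1 "p T"] main[OF that, of "-1" "p T"] avg[of T 1 "p T"] avg[of T "-1" "p T"] that
      by (simp add: abs_le_iff)
  qed
  then show ?thesis by blast
qed

end

section \<open>Asymptotics of the free boundary\<close>

theorem theorem4p3:
  fixes k a w Ml Mr bl_inf br_inf \<alpha>l \<alpha>r \<beta>1 :: real
    and fI bl br bl' br' p :: "real \<Rightarrow> real"
    and F :: "real \<Rightarrow> real \<Rightarrow> real"
  assumes "k > 0" and "a > 0"
    and "Linf UNIV fI" and "L1 UNIV fI" and "L1 UNIV (\<lambda>x. x * fI x)"
    and "\<forall>x<0. fI x \<ge> 0" and "fI 0 = 0" and "\<forall>x>0. fI x \<le> 0"
    and "Ml = (LINT x|lebesgue. pos_part (fI x))" and "Ml > 0"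
    and "Mr = (LINT x|lebesgue. neg_part (fI x))" and "Mr > 0"
    and "W1inf UNIV (initial_datum a fI)"
    and "\<exists>L. L-lipschitz_on {0..} bl" and "\<exists>L. L-lipschitz_on {0..} br"
    and "bl 0 = 0" and "br 0 = 0"
    and "W1inf {0<..} (\<lambda>t. (bl t - br t) / 2)" and "W11 {0<..} (\<lambda>t. (bl t - br t) / 2)"
    and "(bl \<longlongrightarrow> bl_inf) at_top" and "(br \<longlongrightarrow> br_inf) at_top"
    and "w > 1"
    and "\<exists>C. \<forall>t>0. \<bar>bl t - bl_inf\<bar> + \<bar>br t - br_inf\<bar> \<le> C * t powr (- w)"
    and "ae_time_derivative bl bl'" and "ae_time_derivative br br'"
    and "global_solution k bl' br' (initial_datum a fI) F"
    and "free_boundary F p"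
    and "\<alpha>l = 1 / a * exp bl_inf * Ml" and "\<alpha>r = 1 / a * exp br_inf * Mr"
    and "\<beta>1 = sqrt (4 * k) * inv erf ((\<alpha>l - \<alpha>r) / (\<alpha>l + \<alpha>r))"
  shows "\<exists>r. r \<in> O[at_top](\<lambda>t. 1 / sqrt t) \<and>
             (\<forall>\<^sub>F t in at_top. p t = (\<beta>1 + r t) * sqrt t)"
proof -
  obtain Lb where Lb: "Lb-lipschitz_on {0..} bl" using assms(14) by blast
  obtain Lr where Lr: "Lr-lipschitz_on {0..} br" using assms(15) by blast
  define L where "L = max Lb Lr"
  have lip: "L-lipschitz_on {0..} bl" "L-lipschitz_on {0..} br"
    using Lb Lr by (auto simp: L_def intro: lipschitz_on_mono)
  note sol = \<open>global_solution k bl' br' (initial_datum a fI) F\<close>[unfolded global_solution_def]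
  obtain Fx Fxx where Fx:
    "\<forall>x. \<forall>t>0. ((\<lambda>y. F y t) has_real_derivative Fx x t) (at x) \<and>
        ((\<lambda>y. Fx y t) has_real_derivative Fxx x t) (at x)"
    "continuous_on (UNIV \<times> {0<..}) (\<lambda>(x, t). Fxx x t)"
    "\<forall>x. AE t in lebesgue. t > 0 \<longrightarrow> ((\<lambda>t. F x t) has_real_derivative
        (k * Fxx x t + bl' t * pos_part (F x t) - br' t * neg_part (F x t))) (at t)"
    using sol by (elim conjE exE)
  interpret fb_solution k L bl br bl' br' F Fx Fxx p
  proof
    show "continuous_on (UNIV \<times> {0..}) (\<lambda>(x, t). F x t)" using sol by (elim conjE)
    show "\<exists>C. \<forall>x. \<forall>t\<in>{0..T}. \<bar>F x t\<bar> \<le> C" if "T > 0" for T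
      using sol that by (elim conjE) blast
    show "\<exists>L. L-lipschitz_on {s..T} (\<lambda>t. F x t)" if "s > 0" "T > s" for x s T
      using sol that by (elim conjE) blast
  qed (use assms(1,24,25,27) lip Fx in \<open>auto simp: free_boundary_def\<close>)

  have "bl_inf = br_inf"
  proof -
    have "L1 {0<..} (\<lambda>t. (bl t - br t) / 2)" using assms(19) by (simp add: W11_def)
    moreover have "((\<lambda>t. (bl t - br t) / 2) \<longlongrightarrow> (bl_inf - br_inf) / 2) at_top"
      by (intro tendsto_intros assms(20,21)) simp
    ultimately have "(bl_inf - br_inf) / 2 = 0" by (rule L1_half_line_limit_0)
    then show ?thesis by simp
  qed
  obtain C where C: "\<And>t. t > 0 \<Longrightarrow> \<bar>bl t - bl_inf\<bar> + \<bar>br t - br_inf\<bar> \<le> C * t powr (- w)"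
    using assms(23) by blast
  have decay: "\<bar>bl t - br t\<bar> \<le> C * t powr (- w)" if "t > 0" for t
    using C[OF that] \<open>bl_inf = br_inf\<close> by linarith
  \<comment> \<open>Up to time 1 the bound comes from Lipschitz continuity and the zero initial
    values. The power bound, which degenerates at 0, is used only afterwards.\<close>
  define A where "A = max L (\<bar>bl_inf\<bar> + \<bar>C\<bar>)"
  have A: "\<bar>bl t\<bar> \<le> A" "\<bar>br t\<bar> \<le> A" if "t \<ge> 0" for t
  proof -
    have "\<bar>bl t\<bar> \<le> A \<and> \<bar>br t\<bar> \<le> A"
    proof (cases "t \<le> 1")
      case True
      have "L \<ge> 0" using lipschitz_on_nonneg[OF lip(1)] .
      then have "L * t \<le> L" using True that by (simp add: mult_left_le)
      then show ?thesis
        using lipschitz_onD[OF lip(1), of t 0] lipschitz_onD[OF lip(2), of t 0] that assms(16,17)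
        by (auto simp: A_def dist_real_def)
    next
      case False
      have "t powr (- w) \<le> 1 powr (- w)"
        using False \<open>w > 1\<close> by (intro powr_mono2') auto
      then have "C * t powr (- w) \<le> \<bar>C\<bar> * 1" by (intro mult_mono) auto
      then have "\<bar>bl t\<bar> \<le> \<bar>bl_inf\<bar> + \<bar>C\<bar> \<and> \<bar>br t\<bar> \<le> \<bar>bl_inf\<bar> + \<bar>C\<bar>"
        using C[of t] False \<open>bl_inf = br_inf\<close> by auto
      then show ?thesis unfolding A_def by linarith
    qed
    then show "\<bar>bl t\<bar> \<le> A" "\<bar>br t\<bar> \<le> A" by auto
  qed
  obtain M where M: "\<And>x. \<bar>F x 0\<bar> \<le> M" using F_bdd[of 1] by force
  obtain K1 where K1: "\<And>T. T \<ge> 2 \<Longrightarrow> \<bar>LINT x|lborel. F x 0 * heat_kernel k T (x - p T)\<bar> \<le> K1 / sqrt T"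
    using initial_average_at_free_boundary[OF A M \<open>w > 1\<close> decay assms(16,17)] by blast

  have fI: "integrable lebesgue fI" "integrable lebesgue (\<lambda>x. x * fI x)"
    using assms(4,5) unfolding L1_def by (simp_all add: lebesgue_on_UNIV_eq)
  note datum = initial_datum_heat_average[OF assms(1,2) fI assms(6-8,9,11)]
  obtain K2 where K2: "\<And>T y. T > 0 \<Longrightarrow>
      \<bar>(LINT x|lebesgue. initial_datum a fI x * heat_kernel k T (x - y)) -
        (Ml / a * (1 - heat_cdf k T y) - Mr / a * heat_cdf k T y)\<bar> \<le> K2 / sqrt T"
    using datum(2) by blast
  \<comment> \<open>\<open>F\<close> is continuous, hence Borel, at time 0, while the datum is only
    known to be Lebesgue measurable. The comparison almost everywhere therefore takes place in the
    completion.\<close>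
  have same: "(LINT x|lborel. F x 0 * heat_kernel k T (x - y)) =
      (LINT x|lebesgue. initial_datum a fI x * heat_kernel k T (x - y))" if "T > 0" for T y
  proof -
    have "(\<lambda>x. F x 0) \<in> borel_measurable borel"
      by (intro borel_measurable_continuous_onI continuous_intros) auto
    then have m: "(\<lambda>x. F x 0 * heat_kernel k T (x - y)) \<in> borel_measurable lborel" by measurable
    have h: "(\<lambda>x. heat_kernel k T (x - y)) \<in> borel_measurable lebesgue"
      by (rule measurable_completion) simp
    have "AE x in lebesgue. F x 0 = initial_datum a fI x" using sol by (elim conjE)
    then have "AE x in lebesgue. F x 0 * heat_kernel k T (x - y) = initial_datum a fI x * heat_kernel k T (x - y)"
      by eventually_elim simp
    then have "(LINT x|lebesgue. F x 0 * heat_kernel k T (x - y)) =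
      (LINT x|lebesgue. initial_datum a fI x * heat_kernel k T (x - y))"
      by (intro integral_cong_AE measurable_completion[OF m] borel_measurable_times datum(1) h)
    then show ?thesis using integral_completion[OF m] by simp
  qed

  \<comment> \<open>The quotient of the masses: the common factor \<open>exp bl_inf / a\<close>
    cancels from the quotient of \<open>\<alpha>l - \<alpha>r\<close> by
    \<open>\<alpha>l + \<alpha>r\<close>.\<close>
  define e0 where "e0 = (Ml - Mr) / (Ml + Mr)"
  define \<eta> where "\<eta> T = p T / sqrt (4 * k * T)" for T
  define K3 where "K3 = 2 * a * (K1 + K2) / (Ml + Mr)"
  have pos: "Ml > 0" "Mr > 0" "a > 0" "k > 0" using assms by auto
  have est: "\<bar>erf (\<eta> T) - e0\<bar> \<le> K3 / sqrt T" if "T \<ge> 2" for T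
  proof -
    have "\<bar>Ml / a * (1 - heat_cdf k T (p T)) - Mr / a * heat_cdf k T (p T)\<bar> \<le> K1 / sqrt T + K2 / sqrt T"
      using K1[OF that] K2[of T "p T"] same[of T "p T"] that by linarith
    \<comment> \<open>The limit profile is affine in \<open>erf (\<eta> T)\<close> and vanishes
      exactly at \<open>e0\<close>, so its smallness at \<open>p T\<close> is closeness of
      \<open>erf (\<eta> T)\<close> to \<open>e0\<close>.\<close>
    moreover have "Ml / a * (1 - heat_cdf k T (p T)) - Mr / a * heat_cdf k T (p T) =
        (Ml + Mr) / (2 * a) * (e0 - erf (\<eta> T))"
      using pos unfolding heat_cdf_def \<eta>_def[symmetric] e0_def
      by (simp add: divide_simps) (simp add: algebra_simps)
    ultimately have "(Ml + Mr) / (2 * a) * \<bar>e0 - erf (\<eta> T)\<bar> \<le> (K1 + K2) / sqrt T"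
      using pos by (simp add: abs_mult add_divide_distrib)
    then have "\<bar>e0 - erf (\<eta> T)\<bar> \<le> (K1 + K2) / sqrt T / ((Ml + Mr) / (2 * a))"
      using pos by (subst pos_le_divide_eq) (auto simp: mult.commute)
    then show ?thesis by (simp add: K3_def abs_minus_commute mult_ac)
  qed
  have "- 1 < e0" "e0 < 1" using pos by (auto simp: e0_def divide_simps)
  then have e0: "erf (inv erf e0) = e0" by (rule erf_inv_erf)
  have \<beta>1: "\<beta>1 = sqrt (4 * k) * inv erf e0"
  proof -
    have "\<alpha>l - \<alpha>r = exp bl_inf / a * (Ml - Mr)" "\<alpha>l + \<alpha>r = exp bl_inf / a * (Ml + Mr)"
      unfolding assms(28,29) \<open>bl_inf = br_inf\<close>
      by (simp_all add: algebra_simps add_divide_distrib diff_divide_distrib)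
    moreover have "exp bl_inf / a \<noteq> 0" using pos by simp
    ultimately have "(\<alpha>l - \<alpha>r) / (\<alpha>l + \<alpha>r) = e0"
      unfolding e0_def using mult_divide_mult_cancel_left[of "exp bl_inf / a"] by metis
    then show ?thesis using assms(30) by simp
  qed
  obtain c where c: "c > 0" "\<And>z. \<bar>erf z - e0\<bar> < c \<Longrightarrow> \<bar>z - inv erf e0\<bar> \<le> \<bar>erf z - e0\<bar> / c"
    using erf_inverse_estimate[of "inv erf e0"] unfolding e0 by blast
  define r where "r t = p t / sqrt t - \<beta>1" for t
  have r_eq: "r t = sqrt (4 * k) * (\<eta> t - inv erf e0)" if "t > 0" for t
    using that pos unfolding r_def \<beta>1 \<eta>_def
    by (simp add: real_sqrt_mult field_simps)
  have "((\<lambda>t. K3 / sqrt t) \<longlongrightarrow> 0) at_top" by real_asymp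
  \<comment> \<open>The inverse estimate requires a gap below c, and the rate already obtained
    provides this for all large times.\<close>
  then have ev: "\<forall>\<^sub>F t in at_top. K3 / sqrt t < c" by (rule order_tendstoD) (rule c(1))
  have "\<forall>\<^sub>F t in at_top. norm (r t) \<le> sqrt (4 * k) * K3 / c * norm (1 / sqrt t)"
    using ev eventually_ge_at_top[of 2]
  proof eventually_elim
    case (elim t)
    have "\<bar>erf (\<eta> t) - e0\<bar> < c" using est[of t] elim by linarith
    then have "\<bar>\<eta> t - inv erf e0\<bar> \<le> \<bar>erf (\<eta> t) - e0\<bar> / c" by (rule c(2))
    also have "\<dots> \<le> K3 / sqrt t / c" using est[of t] elim c(1) by (intro divide_right_mono) auto
    finally have "sqrt (4 * k) * \<bar>\<eta> t - inv erf e0\<bar> \<le> sqrt (4 * k) * (K3 / sqrt t / c)"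
      using pos by (intro mult_left_mono) auto
    moreover have "\<bar>r t\<bar> = sqrt (4 * k) * \<bar>\<eta> t - inv erf e0\<bar>"
      using r_eq[of t] elim pos by (simp add: abs_mult)
    ultimately show ?case using elim by (simp add: mult_ac)
  qed
  then have "r \<in> O[at_top](\<lambda>t. 1 / sqrt t)" by (rule bigoI)
  moreover have "\<forall>\<^sub>F t in at_top. p t = (\<beta>1 + r t) * sqrt t"
    using eventually_gt_at_top[of 0] by eventually_elim (simp add: r_def)
  ultimately show ?thesis by blast
qed

end
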